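(* Suppose $p=p_n$ satisfies $\frac{\log p_n}{n}\to\beta\in(0,\infty)$ as $n\to\infty$. For each $n$ let $\mathbf{X}_1,\dots,\mathbf{X}_p$ be independent $n$-dimensional random vectors with a common spherical distribution (which may depend on $n$) satisfying $P(\mathbf{X}_1=\mathbf{0})=0$, and let $L_n=\max_{1\le i<j\le p}|\rho_{ij}|$, where $\rho_{ij}$ is the Pearson correlation coefficient of $\mathbf{X}_i$ and $\mathbf{X}_j$. Then: (i) $L_n\to\sqrt{1-e^{-4\beta}}$ in probability as $n\to\infty$. (ii) Let $T_n=\log(1-L_n^2)$. Then, as $n\to\infty$, $nT_n+4\log p-\log\log p$ converges weakly to the distribution with distribution function $$F(y)=1-\exp\left\{-K(\beta)e^{(y+8\beta)/2}\right\},\quad y\in\mathbb{R},\qquad\text{where } K(\beta)=\left(\frac{\beta}{2\pi(1-e^{-4\beta})}\right)^{1/2}.$$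
   Context: A random vector $\mathbf{Y}\in\mathbb{R}^n$ has a spherical distribution if $\mathbf{O}\mathbf{Y}$ and $\mathbf{Y}$ have the same probability distribution for every $n\times n$ orthogonal matrix $\mathbf{O}$. For $\mathbf{x}=(x_1,\dots,x_n)^T$, $\mathbf{y}=(y_1,\dots,y_n)^T\in\mathbb{R}^n$, the Pearson correlation coefficient is $$\rho_{\mathbf{x},\mathbf{y}}=\frac{\sum_{i=1}^n(x_i-\bar x)(y_i-\bar y)}{\sqrt{\sum_{i=1}^n(x_i-\bar x)^2\cdot\sum_{i=1}^n(y_i-\bar y)^2}},\qquad \bar x=\frac1n\sum_{i=1}^n x_i,\quad \bar y=\frac1n\sum_{i=1}^n y_i,$$ and $\rho_{ij}=\rho_{\mathbf{X}_i,\mathbf{X}_j}$ (almost surely well defined for $n\ge2$). $\log$ is the natural logarithm, and $p=p_n$ is an integer depending on $n$ only. *)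

theory Defs
  imports "HOL-Probability.Probability"
begin

text \<open>
  Since the dimension tends to infinity, \<open>\<real>\<^sup>n\<close> is the space of extensional functions on
  \<open>{..<n}\<close>. Coordinates and vectors are numbered from 0.
\<close>

abbreviation Rn :: "nat \<Rightarrow> (nat \<Rightarrow> real) measure" where
  "Rn n \<equiv> PiM {..<n} (\<lambda>_. borel)"

definition mat_vec :: "nat \<Rightarrow> (nat \<Rightarrow> nat \<Rightarrow> real) \<Rightarrow> (nat \<Rightarrow> real) \<Rightarrow> nat \<Rightarrow> real" where
  "mat_vec n Q x = (\<lambda>i\<in>{..<n}. \<Sum>k<n. Q i k * x k)"

definition orthogonal_mat :: "nat \<Rightarrow> (nat \<Rightarrow> nat \<Rightarrow> real) \<Rightarrow> bool" where
  "orthogonal_mat n Q \<longleftrightarrow>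
     (\<forall>i<n. \<forall>j<n. (\<Sum>k<n. Q k i * Q k j) = (if i = j then 1 else 0) \<and>
                  (\<Sum>k<n. Q i k * Q j k) = (if i = j then 1 else 0))"

definition spherical :: "nat \<Rightarrow> 'a measure \<Rightarrow> ('a \<Rightarrow> nat \<Rightarrow> real) \<Rightarrow> bool" where
  "spherical n M Y \<longleftrightarrow> Y \<in> measurable M (Rn n) \<and>
     (\<forall>Q. orthogonal_mat n Q \<longrightarrow>
        distr M (Rn n) (\<lambda>\<omega>. mat_vec n Q (Y \<omega>)) = distr M (Rn n) Y)"

definition mean :: "nat \<Rightarrow> (nat \<Rightarrow> real) \<Rightarrow> real" where
  "mean n x = (\<Sum>i<n. x i) / real n"

text \<open>The value is 0 if a denominator vanishes, that is, if \<open>x\<close> or \<open>y\<close> is constant.\<close>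

definition pearson :: "nat \<Rightarrow> (nat \<Rightarrow> real) \<Rightarrow> (nat \<Rightarrow> real) \<Rightarrow> real" where
  "pearson n x y =
     (\<Sum>i<n. (x i - mean n x) * (y i - mean n y)) /
     sqrt ((\<Sum>i<n. (x i - mean n x)\<^sup>2) * (\<Sum>i<n. (y i - mean n y)\<^sup>2))"

text \<open>Meaningful for \<open>p \<ge> 2\<close> only; otherwise this is the unspecified constant \<open>Max {}\<close>.\<close>

definition max_corr :: "nat \<Rightarrow> nat \<Rightarrow> (nat \<Rightarrow> nat \<Rightarrow> real) \<Rightarrow> real" where
  "max_corr n p x = Max {\<bar>pearson n (x i) (x j)\<bar> | i j. i < j \<and> j < p}"

text \<open>Convergence in probability to a constant; the probability space may vary with \<open>n\<close>.\<close>

definition tendsto_in_prob :: "(nat \<Rightarrow> 'a measure) \<Rightarrow> (nat \<Rightarrow> 'a \<Rightarrow> real) \<Rightarrow> real \<Rightarrow> bool" where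
  "tendsto_in_prob M Z c \<longleftrightarrow>
     (\<forall>\<epsilon>>0. (\<lambda>n. measure (M n) {\<omega> \<in> space (M n). \<bar>Z n \<omega> - c\<bar> > \<epsilon>}) \<longlonglongrightarrow> 0)"

definition K :: "real \<Rightarrow> real" where
  "K \<beta> = sqrt (\<beta> / (2 * pi * (1 - exp (- 4 * \<beta>))))"

definition limit_cdf :: "real \<Rightarrow> real \<Rightarrow> real" where
  "limit_cdf \<beta> y = 1 - exp (- (K \<beta> * exp ((y + 8 * \<beta>) / 2)))"

end

theory Submission
  imports Defs
begin

text \<open>
  Centring a vector removes its component along the all-ones vector, so the correlation of
  \<open>x\<close> and \<open>y\<close> is the cosine of the angle between two vectors of an \<open>(n - 1)\<close>-dimensional space. If
  \<open>Y\<close> is spherical, the law of this cosine does not depend on the fixed non-constant vector \<open>x\<close>,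
  because a rotation carries \<open>x\<close> to any other direction. Averaging over a Gaussian \<open>x\<close>
  shows that it does not depend on the law of \<open>Y\<close> either (\<open>measure_cap_eq_gauss\<close>): by Fubini the
  probability that a Gaussian vector and \<open>Y\<close> have an absolute correlation of at least \<open>t\<close> is both the constant that
  belongs to \<open>Y\<close> and the one that belongs to the Gaussian. Let \<open>q\<close> be this number.

  Join two of the \<open>p\<close> vectors by an edge if the absolute value of their correlation is at least
  \<open>t\<close>. An edge has probability \<open>q\<close>, and since \<open>q\<close> is also the conditional probability given one
  end point, two edges that share a vertex are independent. This alone makes the probability that
  there is no edge converge to \<open>exp (- l)\<close> whenever \<open>p\<^sup>2 q / 2\<close> tends to \<open>l\<close> and \<open>p\<close> to infinity.
  Indeed, let the vectors arrive one after the other. Given that no edge is present among the first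
  \<open>k\<close>, inclusion and exclusion show that vector \<open>k\<close> creates one with probability \<open>k q\<close>, up to an
  error of order \<open>k\<^sup>2 q\<^sup>2\<close> in the joint probability. These errors add up to \<open>O(p\<^sup>3 q\<^sup>2)\<close>, which
  vanishes, and the product of the factors \<open>1 - k q\<close> tends to \<open>exp (- l)\<close>
  (\<open>avoidance_step\<close>, \<open>avoidance_tendsto\<close>).

  For the Gaussian \<open>q\<close> is a tail of a Student distribution (\<open>gauss_cap_ratio\<close>): it equals
  \<open>I(s) / I(0)\<close>, where \<open>I(s)\<close> is the integral of \<open>(1 + v\<^sup>2)\<^bsup>-(n-1)/2\<^esup>\<close> over \<open>v \<ge> s\<close>, and
  \<open>s = t / sqrt (1 - t\<^sup>2)\<close>.
  Integration by parts encloses the numerator between two elementary bounds of the same order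
  (\<open>gauss_cap_bounds\<close>), and dominated convergence gives the asymptotics \<open>sqrt (pi / (2 n))\<close> of the
  denominator (\<open>half_mass_asymp\<close>). With \<open>t = t_n(y)\<close> chosen such that
  \<open>n log (1 - t\<^sup>2) + 4 log p - log log p = y\<close>, the expected number \<open>p\<^sup>2 q / 2\<close> of edges tends to
  \<open>K(\<beta>) exp ((y + 8 \<beta>) / 2)\<close> (\<open>expected_exceedances_tendsto\<close>), hence the probability that \<open>L_n\<close> is at
  least \<open>t_n(y)\<close> tends to the limiting distribution function at \<open>y\<close>. That is the second claim.
  The first follows because \<open>t_n(y)\<close> tends to \<open>sqrt (1 - exp (- 4 \<beta>))\<close> for every \<open>y\<close>, while the
  limiting distribution function tends to 0 and 1 at the two ends of the line.
\<close>

section \<open>Random graphs with independent adjacent edges\<close>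

text \<open>
  The union of the first \<open>k\<close> sets meets set \<open>k\<close> in a union of \<open>k\<close> pairwise intersections, so by
  subadditivity each new set contributes its own measure up to those intersections.
\<close>

lemma (in finite_measure) bonferroni_lower:
  fixes C :: "nat \<Rightarrow> 'a set"
  assumes C: "\<And>i. i < k \<Longrightarrow> C i \<in> sets M"
  shows "(\<Sum>i<k. measure M (C i)) \<le> measure M (\<Union>i<k. C i) + (\<Sum>j<k. \<Sum>i<j. measure M (C i \<inter> C j))"
  using C
proof (induction k)
  case (Suc k)
  let ?U = "\<Union>i<k. C i"
  have U: "?U \<in> sets M" using Suc.prems by auto
  have "measure M (?U \<inter> C k) = measure M (\<Union>i<k. C i \<inter> C k)"
    by (rule arg_cong[where f = "measure M"]) auto
  also have "\<dots> \<le> (\<Sum>i<k. measure M (C i \<inter> C k))"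
    by (rule finite_measure_subadditive_finite) (use Suc.prems in auto)
  finally have "measure M (?U \<inter> C k) \<le> (\<Sum>i<k. measure M (C i \<inter> C k))" .
  moreover have "measure M (\<Union>i<Suc k. C i) = measure M ?U + measure M (C k) - measure M (?U \<inter> C k)"
  proof -
    have "(\<Union>i<Suc k. C i) = ?U \<union> C k" by (auto simp: less_Suc_eq)
    moreover have "measure M (?U \<union> C k) = measure M ?U + measure M (C k - ?U)"
      by (rule finite_measure_Union') (use U Suc.prems in auto)
    moreover have "measure M (C k - ?U) = measure M (C k) - measure M (C k \<inter> ?U)"
      by (rule finite_measure_Diff') (use U Suc.prems in auto)
    moreover have "C k \<inter> ?U = ?U \<inter> C k" by (rule Int_commute)
    ultimately show ?thesis by (simp only:)
  qed
  moreover have "(\<Sum>i<k. measure M (C i)) \<le> measure M ?U + (\<Sum>j<k. \<Sum>i<j. measure M (C i \<inter> C j))"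
    by (rule Suc.IH) (use Suc.prems in auto)
  ultimately show ?case unfolding sum.lessThan_Suc by linarith
qed simp

text \<open>
  The edge relation of a random graph whose vertices are independent points with law \<open>D\<close>. Almost
  every point is related to a new point with the same probability \<open>q\<close>; this is what makes edges with a
  common end point independent.
\<close>

locale homogeneous_relation = prob_space D for D :: "'b measure" +
  fixes R :: "'b \<Rightarrow> 'b \<Rightarrow> bool" and q :: real
  assumes R_measurable [measurable]: "Measurable.pred (D \<Otimes>\<^sub>M D) (\<lambda>z. R (fst z) (snd z))"
    and R_sym: "R x y \<Longrightarrow> R y x"
    and degree: "AE x in D. measure D {y \<in> space D. R x y} = q"
begin

abbreviation sample :: "nat set \<Rightarrow> (nat \<Rightarrow> 'b) measure" where
  "sample J \<equiv> PiM J (\<lambda>_. D)"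

lemma q_bounds: "0 \<le> q" "q \<le> 1"
proof -
  have "AE x in D. 0 \<le> q \<and> q \<le> 1"
    using degree by eventually_elim auto
  then show "0 \<le> q" "q \<le> 1" by auto
qed

lemma prob_space_sample: "prob_space (sample J)"
  by (intro prob_space_PiM prob_space_axioms)

lemma pred_R_component [measurable (raw)]:
  assumes [measurable]: "f \<in> measurable N D" "g \<in> measurable N D"
  shows "Measurable.pred N (\<lambda>x. R (f x) (g x))"
proof -
  have "(\<lambda>x. (f x, g x)) \<in> measurable N (D \<Otimes>\<^sub>M D)"
    by measurable
  from measurable_compose[OF this R_measurable] show ?thesis by simp
qed

text \<open>
  Fubini for one distinguished point: if a condition \<open>W\<close> on the new point \<open>j\<close> has the same
  conditional probability \<open>r\<close> for almost every choice of the others, it is independent of all that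
  happens among the others.
\<close>

lemma measure_sample_insert:
  assumes J: "finite J" "j \<notin> J"
    and Q: "Measurable.pred (sample J) Q"
    and W: "Measurable.pred (sample (insert j J)) W"
    and cond: "AE x in sample J. measure D {y \<in> space D. W (x(j := y))} = r"
  shows "measure (sample (insert j J)) {x \<in> space (sample (insert j J)). Q (restrict x J) \<and> W x}
           = r * measure (sample J) {x \<in> space (sample J). Q x}"
proof -
  interpret PS: product_sigma_finite "\<lambda>_::nat. D"
    by standard
  interpret S: prob_space "sample J" by (rule prob_space_sample)
  interpret S': prob_space "sample (insert j J)" by (rule prob_space_sample)
  have r0: "0 \<le> r"
  proof -
    have "AE x in sample J. 0 \<le> r"
      using cond by eventually_elim auto
    then show ?thesis by auto
  qed
  note [measurable] = Q W
  have [measurable]: "Measurable.pred (sample (insert j J)) (\<lambda>x. Q (restrict x J))"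
    by (rule measurable_compose[OF measurable_restrict_subset Q]) auto
  let ?E = "{x \<in> space (sample (insert j J)). Q (restrict x J) \<and> W x}"
  have "emeasure (sample (insert j J)) ?E = (\<integral>\<^sup>+x. indicator ?E x \<partial>sample (insert j J))"
    by (rule nn_integral_indicator[symmetric]) measurable
  also have "\<dots> = (\<integral>\<^sup>+x. \<integral>\<^sup>+y. indicator ?E (x(j := y)) \<partial>D \<partial>sample J)"
    by (rule PS.product_nn_integral_insert) (use J in measurable)
  also have "\<dots> = (\<integral>\<^sup>+x. ennreal r * indicator {x \<in> space (sample J). Q x} x \<partial>sample J)"
  proof (rule nn_integral_cong_AE)
    from cond AE_space show "AE x in sample J. (\<integral>\<^sup>+y. indicator ?E (x(j := y)) \<partial>D)
         = ennreal r * indicator {x \<in> space (sample J). Q x} x"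
    proof eventually_elim
      case (elim x)
      have upd: "(\<lambda>y. x(j := y)) \<in> measurable D (sample (insert j J))"
        using measurable_component_update[OF elim(2) J(2)] by simp
      have m: "{y \<in> space D. W (x(j := y))} \<in> sets D"
        using measurable_compose[OF upd W] by (simp add: pred_def)
      have restr: "restrict (x(j := y)) J = x" for y
        using elim J by (auto simp: space_PiM PiE_def extensional_def restrict_def fun_eq_iff)
      have sp: "x(j := y) \<in> space (sample (insert j J))" if "y \<in> space D" for y
        using measurable_space[OF upd that] .
      have "(\<integral>\<^sup>+y. indicator ?E (x(j := y)) \<partial>D)
          = (\<integral>\<^sup>+y. indicator {x. Q x} x * indicator {y \<in> space D. W (x(j := y))} y \<partial>D)"
        by (rule nn_integral_cong) (auto simp: indicator_def restr sp)
      also have "\<dots> = indicator {x. Q x} x * emeasure D {y \<in> space D. W (x(j := y))}"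
        by (rule nn_integral_cmult_indicator[OF m])
      also have "\<dots> = ennreal r * indicator {x \<in> space (sample J). Q x} x"
        using elim by (auto simp: emeasure_eq_measure indicator_def)
      finally show ?case .
    qed
  qed
  also have "\<dots> = ennreal r * emeasure (sample J) {x \<in> space (sample J). Q x}"
    by (rule nn_integral_cmult_indicator) measurable
  finally show ?thesis
    using r0 by (simp add: S.emeasure_eq_measure S'.emeasure_eq_measure ennreal_mult'[symmetric])
qed

lemma AE_degree:
  assumes "finite J" "i \<in> J" "j \<notin> J"
  shows "AE x in sample J. measure D {y \<in> space D. R ((x(j := y)) i) ((x(j := y)) j)} = q"
proof -
  have "AE x in sample J. measure D {y \<in> space D. R (x i) y} = q"
    by (rule AE_PiM_component) (use assms degree prob_space_axioms in auto)
  moreover have "i \<noteq> j" using assms by auto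
  ultimately show ?thesis by simp
qed

definition avoid :: "nat \<Rightarrow> (nat \<Rightarrow> 'b) \<Rightarrow> bool" where
  "avoid k x \<longleftrightarrow> (\<forall>j<k. \<forall>i<j. \<not> R (x i) (x j))"

definition avoidance :: "nat \<Rightarrow> real" where
  "avoidance k = measure (sample {..<k}) {x \<in> space (sample {..<k}). avoid k x}"

lemma pred_avoid:
  assumes "{..<k} \<subseteq> J" shows "Measurable.pred (sample J) (avoid k)"
proof -
  have nR: "Measurable.pred (sample J) (\<lambda>x. \<not> R (x i) (x j))" if "i < k" "j < k" for i j
    by (intro pred_intros_logic(2) pred_R_component measurable_component_singleton) (use that assms in auto)
  have "Measurable.pred (sample J) (\<lambda>x. \<forall>j\<in>{..<k}. \<forall>i\<in>{..<j}. \<not> R (x i) (x j))"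
    by (intro pred_intros_finite) (auto intro: nR)
  moreover have "avoid k = (\<lambda>x. \<forall>j\<in>{..<k}. \<forall>i\<in>{..<j}. \<not> R (x i) (x j))"
    unfolding fun_eq_iff avoid_def by blast
  ultimately show ?thesis by (simp only:)
qed

lemma avoid_restrict: "{..<k} \<subseteq> J \<Longrightarrow> avoid k (restrict x J) \<longleftrightarrow> avoid k x"
  unfolding avoid_def by (auto simp: subset_iff)

lemma prob_avoid_extend:
  "measure (sample {..<Suc k}) {x \<in> space (sample {..<Suc k}). avoid k x} = avoidance k"
  using measure_sample_insert[of "{..<k}" k "avoid k" "\<lambda>_. True" 1] pred_avoid[of k "{..<k}"]
    prob_space
  by (simp add: lessThan_Suc avoidance_def avoid_restrict)

lemma prob_avoid_and_edge:
  assumes "i < k"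
  shows "measure (sample {..<Suc k}) {x \<in> space (sample {..<Suc k}). avoid k x \<and> R (x i) (x k)} = q * avoidance k"
proof -
  have "measure (sample (insert k {..<k})) {x \<in> space (sample (insert k {..<k})).
          avoid k (restrict x {..<k}) \<and> R (x i) (x k)} = q * avoidance k"
    unfolding avoidance_def
    by (rule measure_sample_insert)
       (use assms AE_degree[of "{..<k}" i k] in \<open>auto intro!: pred_avoid pred_R_component measurable_component_singleton\<close>)
  then show ?thesis by (simp add: lessThan_Suc avoid_restrict)
qed

lemma prob_edge:
  assumes "finite J" "i \<in> J" "j \<in> J" "i \<noteq> j"
  shows "measure (sample J) {x \<in> space (sample J). R (x i) (x j)} = q"
proof -
  let ?J = "J - {j}"
  interpret S: prob_space "sample ?J" by (rule prob_space_sample)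
  have J: "insert j ?J = J" using assms by auto
  have "measure (sample (insert j ?J)) {x \<in> space (sample (insert j ?J)). True \<and> R (x i) (x j)}
      = q * measure (sample ?J) {x \<in> space (sample ?J). True}"
    by (rule measure_sample_insert)
       (use assms AE_degree[of ?J i j] in \<open>auto intro!: pred_R_component measurable_component_singleton\<close>)
  then show ?thesis using J S.prob_space by simp
qed

text \<open>
  Condition on the end point \<open>i'\<close> that is not shared: by symmetry of the relation, given the rest it is
  joined to \<open>k\<close> with probability \<open>q\<close>, independently of the other edge.
\<close>

lemma prob_two_edges:
  assumes "i < k" "i' < k" "i \<noteq> i'"
  shows "measure (sample {..<Suc k}) {x \<in> space (sample {..<Suc k}). R (x i) (x k) \<and> R (x i') (x k)} = q\<^sup>2"
proof -
  let ?J = "{..<Suc k} - {i'}"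
  have J: "insert i' ?J = {..<Suc k}" using assms by auto
  have "measure (sample (insert i' ?J)) {x \<in> space (sample (insert i' ?J)).
            R (restrict x ?J i) (restrict x ?J k) \<and> R (x k) (x i')}
      = q * measure (sample ?J) {x \<in> space (sample ?J). R (x i) (x k)}"
    by (rule measure_sample_insert)
       (use assms AE_degree[of ?J k i'] in \<open>auto intro!: pred_R_component measurable_component_singleton\<close>)
  also have "measure (sample ?J) {x \<in> space (sample ?J). R (x i) (x k)} = q"
    by (rule prob_edge) (use assms in auto)
  also have edges: "{x \<in> space (sample (insert i' ?J)). R (restrict x ?J i) (restrict x ?J k) \<and> R (x k) (x i')}
      = {x \<in> space (sample {..<Suc k}). R (x i) (x k) \<and> R (x i') (x k)}"
    using assms R_sym unfolding J by auto
  finally show ?thesis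
    using assms unfolding J by (simp add: power2_eq_square)
qed

text \<open>
  Vertex \<open>k\<close> keeps the graph edgeless if none of the \<open>k\<close> possible new edges occurs. Each of them is
  independent of the graph on the first \<open>k\<close> vertices. The first two inclusion and exclusion bounds
  then give both inequalities, where the double sum bounds the probability of two simultaneous new edges.
\<close>

lemma avoidance_step:
  shows "(1 - real k * q) * avoidance k \<le> avoidance (Suc k)"
    and "avoidance (Suc k) \<le> (1 - real k * q) * avoidance k + (\<Sum>j<k. \<Sum>i<j. q\<^sup>2)"
proof -
  let ?S = "sample {..<Suc k}"
  interpret S: prob_space ?S by (rule prob_space_sample)
  define A where "A = {x \<in> space ?S. avoid k x}"
  define B where "B i = {x \<in> space ?S. avoid k x \<and> R (x i) (x k)}" for i
  have mA [measurable]: "Measurable.pred ?S (avoid k)" by (rule pred_avoid) auto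
  have mR: "Measurable.pred ?S (\<lambda>x. R (x i) (x k))" if "i < k" for i
    by (intro pred_R_component measurable_component_singleton) (use that in auto)
  have A: "A \<in> sets ?S" unfolding A_def by measurable
  have B: "B i \<in> sets ?S" if "i < k" for i
    unfolding B_def using mR[OF that] by measurable
  have "avoid (Suc k) x \<longleftrightarrow> avoid k x \<and> (\<forall>i<k. \<not> R (x i) (x k))" for x
    unfolding avoid_def by (auto simp: less_Suc_eq)
  then have "{x \<in> space ?S. avoid (Suc k) x} = A - (\<Union>i<k. B i)"
    unfolding A_def B_def by auto
  then have "avoidance (Suc k) = S.prob (A - (\<Union>i<k. B i))"
    by (simp add: avoidance_def)
  also have "\<dots> = S.prob A - S.prob (\<Union>i<k. B i)"
    by (rule S.finite_measure_Diff) (use A B in \<open>auto simp: A_def B_def\<close>)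
  finally have *: "avoidance (Suc k) = avoidance k - S.prob (\<Union>i<k. B i)"
    using prob_avoid_extend by (simp add: A_def)
  have sumB: "(\<Sum>i<k. S.prob (B i)) = real k * q * avoidance k"
    by (simp add: B_def prob_avoid_and_edge)
  have "S.prob (\<Union>i<k. B i) \<le> (\<Sum>i<k. S.prob (B i))"
    by (rule S.finite_measure_subadditive_finite) (use B in auto)
  with * sumB show "(1 - real k * q) * avoidance k \<le> avoidance (Suc k)"
    by (simp add: algebra_simps)
  have "(\<Sum>i<k. S.prob (B i)) \<le> S.prob (\<Union>i<k. B i) + (\<Sum>j<k. \<Sum>i<j. S.prob (B i \<inter> B j))"
    by (rule S.bonferroni_lower) (use B in auto)
  also have "(\<Sum>j<k. \<Sum>i<j. S.prob (B i \<inter> B j)) \<le> (\<Sum>j<k. \<Sum>i<j. q\<^sup>2)"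
  proof (intro sum_mono)
    fix j i assume ij: "j \<in> {..<k}" "i \<in> {..<j}"
    have "S.prob (B i \<inter> B j) \<le> S.prob {x \<in> space ?S. R (x i) (x k) \<and> R (x j) (x k)}"
      by (rule S.finite_measure_mono) (use mR[of i] mR[of j] ij in \<open>auto simp: B_def\<close>)
    also have "\<dots> = q\<^sup>2" by (rule prob_two_edges) (use ij in auto)
    finally show "S.prob (B i \<inter> B j) \<le> q\<^sup>2" .
  qed
  finally show "avoidance (Suc k) \<le> (1 - real k * q) * avoidance k + (\<Sum>j<k. \<Sum>i<j. q\<^sup>2)"
    using * sumB by (simp add: algebra_simps)
qed

lemma avoidance_bounds:
  assumes "real k * q \<le> 1"
  shows "(\<Prod>i<k. 1 - real i * q) \<le> avoidance k"
    and "avoidance k \<le> (\<Prod>i<k. 1 - real i * q) + real k ^ 3 * q\<^sup>2"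
proof -
  have "(\<Prod>i<k. 1 - real i * q) \<le> avoidance k \<and> avoidance k \<le> (\<Prod>i<k. 1 - real i * q) + real k ^ 3 * q\<^sup>2"
    using assms
  proof (induction k)
    case 0
    interpret S: prob_space "sample {}" by (rule prob_space_sample)
    have "avoidance 0 = 1"
      using S.prob_space by (simp add: avoidance_def avoid_def)
    then show ?case by simp
  next
    case (Suc k)
    have le: "real k * q \<le> 1"
      using Suc.prems q_bounds by (simp add: algebra_simps)
    note IH = Suc.IH[OF le]
    have "(1 - real k * q) * (\<Prod>i<k. 1 - real i * q) \<le> (1 - real k * q) * avoidance k"
      using IH le by (intro mult_left_mono) auto
    with avoidance_step(1)[of k] have 1: "(\<Prod>i<Suc k. 1 - real i * q) \<le> avoidance (Suc k)"
      by (simp add: mult.commute)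
    have "(1 - real k * q) * avoidance k \<le> (1 - real k * q) * ((\<Prod>i<k. 1 - real i * q) + real k ^ 3 * q\<^sup>2)"
      using IH le by (intro mult_left_mono) auto
    also have "\<dots> = (\<Prod>i<Suc k. 1 - real i * q) + (1 - real k * q) * (real k ^ 3 * q\<^sup>2)"
      by (simp add: algebra_simps)
    also have "(1 - real k * q) * (real k ^ 3 * q\<^sup>2) \<le> 1 * (real k ^ 3 * q\<^sup>2)"
      using le q_bounds by (intro mult_right_mono) auto
    finally have 2: "(1 - real k * q) * avoidance k \<le> (\<Prod>i<Suc k. 1 - real i * q) + real k ^ 3 * q\<^sup>2"
      by simp
    have "(\<Sum>j<k. \<Sum>i<j. q\<^sup>2) \<le> (\<Sum>j<k. real k * q\<^sup>2)"
      by (intro sum_mono) (auto intro!: mult_right_mono)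
    then have "(\<Sum>j<k. \<Sum>i<j. q\<^sup>2) \<le> real k ^ 2 * q\<^sup>2"
      by (simp add: power2_eq_square mult.assoc)
    with 2 avoidance_step(2)[of k]
    have "avoidance (Suc k) \<le> (\<Prod>i<Suc k. 1 - real i * q) + (real k ^ 3 + real k ^ 2) * q\<^sup>2"
      by (simp add: algebra_simps)
    also have "(real k ^ 3 + real k ^ 2) * q\<^sup>2 \<le> real (Suc k) ^ 3 * q\<^sup>2"
      by (intro mult_right_mono) (auto simp: power2_eq_square power3_eq_cube algebra_simps)
    finally show ?case using 1 by simp
  qed
  then show "(\<Prod>i<k. 1 - real i * q) \<le> avoidance k"
    and "avoidance k \<le> (\<Prod>i<k. 1 - real i * q) + real k ^ 3 * q\<^sup>2" by auto
qed

text \<open>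
  The product of the factors \<open>1 - i q\<close> is compared with \<open>exp (- q \<Sum> i)\<close>; the quadratic terms of the
  logarithm add up to at most \<open>2 k\<^sup>3 q\<^sup>2\<close>, the order of the error that is already present.
\<close>

lemma avoidance_exp_bounds:
  assumes kq: "real k * q \<le> 1 / 2"
  shows "exp (- (real k * real (k - 1) / 2 * q) - 2 * (real k ^ 3 * q\<^sup>2)) \<le> avoidance k"
    and "avoidance k \<le> exp (- (real k * real (k - 1) / 2 * q)) + real k ^ 3 * q\<^sup>2"
proof -
  have sum: "(\<Sum>i<k. real i) = real k * real (k - 1) / 2"
  proof (induction k)
    case (Suc k)
    then show ?case by (cases k) (auto simp: field_simps)
  qed simp
  have iq: "0 \<le> real i * q" "real i * q \<le> 1 / 2" if "i < k" for i
  proof -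
    show "0 \<le> real i * q" using q_bounds by simp
    have "real i * q \<le> real k * q" using that q_bounds by (intro mult_right_mono) auto
    then show "real i * q \<le> 1 / 2" using kq by simp
  qed
  have "(\<Prod>i<k. 1 - real i * q) \<le> (\<Prod>i<k. exp (- (real i * q)))"
  proof (intro prod_mono conjI)
    fix i assume "i \<in> {..<k}"
    then show "0 \<le> 1 - real i * q" using iq[of i] by auto
    show "1 - real i * q \<le> exp (- (real i * q))" using exp_ge_add_one_self[of "- (real i * q)"] by simp
  qed
  also have "\<dots> = exp (- (\<Sum>i<k. real i) * q)"
    by (simp add: exp_sum[symmetric] sum_negf sum_distrib_right)
  finally show "avoidance k \<le> exp (- (real k * real (k - 1) / 2 * q)) + real k ^ 3 * q\<^sup>2"
    using avoidance_bounds(2)[of k] kq by (simp add: sum)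
  have "(\<Sum>i<k. (real i * q)\<^sup>2) \<le> (\<Sum>i<k. (real k * q)\<^sup>2)"
    using q_bounds by (intro sum_mono power_mono mult_right_mono) auto
  also have "\<dots> = real k ^ 3 * q\<^sup>2"
    by (simp add: power2_eq_square power3_eq_cube)
  finally have "(\<Sum>i<k. (real i * q)\<^sup>2) \<le> real k ^ 3 * q\<^sup>2" .
  moreover have "(\<Sum>i<k. real i * q) = real k * real (k - 1) / 2 * q"
    by (simp only: sum_distrib_right[symmetric] sum)
  ultimately have "exp (- (real k * real (k - 1) / 2 * q) - 2 * (real k ^ 3 * q\<^sup>2))
      \<le> exp (\<Sum>i<k. - (real i * q) - 2 * (real i * q)\<^sup>2)"
    by (simp add: sum_subtractf sum_negf sum_distrib_left[symmetric])
  also have "\<dots> = (\<Prod>i<k. exp (- (real i * q) - 2 * (real i * q)\<^sup>2))"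
    by (simp add: exp_sum)
  also have "\<dots> \<le> (\<Prod>i<k. 1 - real i * q)"
  proof (intro prod_mono conjI)
    fix i assume "i \<in> {..<k}"
    then have x: "0 \<le> real i * q" "real i * q \<le> 1/2" using iq[of i] by auto
    have "- (real i * q) - 2 * (real i * q)\<^sup>2 \<le> ln (1 - real i * q)"
      by (rule ln_one_minus_pos_lower_bound) (use x in auto)
    then have "exp (- (real i * q) - 2 * (real i * q)\<^sup>2) \<le> exp (ln (1 - real i * q))"
      by simp
    also have "\<dots> = 1 - real i * q" using x by (intro exp_ln) auto
    finally show "exp (- (real i * q) - 2 * (real i * q)\<^sup>2) \<le> 1 - real i * q" .
  qed simp
  also have "\<dots> \<le> avoidance k"
    by (rule avoidance_bounds) (use kq in simp)
  finally show "exp (- (real k * real (k - 1) / 2 * q) - 2 * (real k ^ 3 * q\<^sup>2)) \<le> avoidance k" .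
qed

end

text \<open>
  A Poisson limit for the number of edges, restricted to the event that it is zero. The hypotheses
  force \<open>p q\<close> and \<open>p\<^sup>3 q\<^sup>2\<close> to vanish, and the exponents \<open>p (p - 1) q / 2\<close> of the two bounds tend to \<open>l\<close>.
\<close>

lemma avoidance_tendsto:
  assumes hom: "\<forall>\<^sub>F n in sequentially. homogeneous_relation (D n) (R n) (q n)"
    and p: "filterlim p at_top sequentially"
    and mean: "(\<lambda>n. (real (p n))\<^sup>2 * q n / 2) \<longlonglongrightarrow> l"
  shows "(\<lambda>n. homogeneous_relation.avoidance (D n) (R n) (p n)) \<longlonglongrightarrow> exp (- l)"
proof -
  let ?e = "\<lambda>n. real (p n) * real (p n - 1) / 2 * q n"
  let ?r = "\<lambda>n. real (p n) ^ 3 * (q n)\<^sup>2"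
  have p': "filterlim (\<lambda>n. real (p n)) at_top sequentially"
    using filterlim_compose[OF filterlim_real_sequentially p] .
  have inv: "(\<lambda>n. 1 / real (p n)) \<longlonglongrightarrow> 0"
    using tendsto_inverse_0_at_top[OF p'] by (simp add: inverse_eq_divide)
  have pos: "\<forall>\<^sub>F n in sequentially. p n \<ge> 1"
    using p by (simp add: filterlim_at_top)
  have "(\<lambda>n. (real (p n))\<^sup>2 * q n / 2 * (1 - 1 / real (p n))) \<longlonglongrightarrow> l * (1 - 0)"
    by (intro tendsto_intros mean inv)
  moreover have "\<forall>\<^sub>F n in sequentially. (real (p n))\<^sup>2 * q n / 2 * (1 - 1 / real (p n)) = ?e n"
    using pos
  proof eventually_elim
    case (elim n)
    have id: "x\<^sup>2 * y / 2 * (1 - 1 / x) = x * (x - 1) / 2 * y" if "x \<noteq> 0" for x y :: real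
      using that by (simp add: power2_eq_square divide_simps)
    have "real (p n - 1) = real (p n) - 1" using elim by (simp add: of_nat_diff)
    then show ?case using id[of "real (p n)" "q n"] elim by simp
  qed
  ultimately have "?e \<longlonglongrightarrow> l * (1 - 0)"
    by (rule Lim_transform_eventually)
  then have e: "?e \<longlonglongrightarrow> l" by simp
  have "(\<lambda>n. 4 * ((real (p n))\<^sup>2 * q n / 2)\<^sup>2 * (1 / real (p n))) \<longlonglongrightarrow> 4 * l\<^sup>2 * 0"
    by (intro tendsto_intros mean inv)
  moreover have "\<forall>\<^sub>F n in sequentially. 4 * ((real (p n))\<^sup>2 * q n / 2)\<^sup>2 * (1 / real (p n)) = ?r n"
    using pos
  proof eventually_elim
    case (elim n)
    have id: "4 * (x\<^sup>2 * y / 2)\<^sup>2 * (1 / x) = x ^ 3 * y\<^sup>2" if "x \<noteq> 0" for x y :: real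
      using that by (simp add: power2_eq_square power3_eq_cube)
    show ?case by (rule id) (use elim in auto)
  qed
  ultimately have "?r \<longlonglongrightarrow> 4 * l\<^sup>2 * 0"
    by (rule Lim_transform_eventually)
  then have r: "?r \<longlonglongrightarrow> 0" by simp
  have "(\<lambda>n. 2 * ((real (p n))\<^sup>2 * q n / 2) * (1 / real (p n))) \<longlonglongrightarrow> 2 * l * 0"
    by (intro tendsto_intros mean inv)
  moreover have "\<forall>\<^sub>F n in sequentially. 2 * ((real (p n))\<^sup>2 * q n / 2) * (1 / real (p n)) = real (p n) * q n"
    using pos by eventually_elim (simp add: power2_eq_square)
  ultimately have "(\<lambda>n. real (p n) * q n) \<longlonglongrightarrow> 2 * l * 0"
    by (rule Lim_transform_eventually)
  then have "(\<lambda>n. real (p n) * q n) \<longlonglongrightarrow> 0" by simp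
  then have small: "\<forall>\<^sub>F n in sequentially. real (p n) * q n < 1 / 2"
    by (rule order_tendstoD) simp
  show ?thesis
  proof (rule tendsto_sandwich)
    show "\<forall>\<^sub>F n in sequentially. exp (- ?e n - 2 * ?r n) \<le> homogeneous_relation.avoidance (D n) (R n) (p n)"
      using small hom
      by eventually_elim (rule homogeneous_relation.avoidance_exp_bounds(1), auto)
    show "\<forall>\<^sub>F n in sequentially. homogeneous_relation.avoidance (D n) (R n) (p n) \<le> exp (- ?e n) + ?r n"
      using small hom
      by eventually_elim (rule homogeneous_relation.avoidance_exp_bounds(2), auto)
    have "(\<lambda>n. exp (- ?e n - 2 * ?r n)) \<longlonglongrightarrow> exp (- l - 2 * 0)"
      by (intro tendsto_intros e r)
    then show "(\<lambda>n. exp (- ?e n - 2 * ?r n)) \<longlonglongrightarrow> exp (- l)" by simp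
    have "(\<lambda>n. exp (- ?e n) + ?r n) \<longlonglongrightarrow> exp (- l) + 0"
      by (intro tendsto_intros e r)
    then show "(\<lambda>n. exp (- ?e n) + ?r n) \<longlonglongrightarrow> exp (- l)" by simp
  qed
qed

section \<open>Rotations of coordinate planes\<close>

definition dot :: "nat \<Rightarrow> (nat \<Rightarrow> real) \<Rightarrow> (nat \<Rightarrow> real) \<Rightarrow> real" where
  "dot n x y = (\<Sum>k<n. x k * y k)"

text \<open>
  Rotation of the plane of the coordinates \<open>i\<close> and \<open>j\<close>, with cosine \<open>c\<close> and sine \<open>s\<close>. These
  rotations suffice below, and they change only two coordinates, so that the Gaussian measure can be
  treated by an integral over the plane.
\<close>

definition givens :: "nat \<Rightarrow> nat \<Rightarrow> real \<Rightarrow> real \<Rightarrow> (nat \<Rightarrow> real) \<Rightarrow> nat \<Rightarrow> real" where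
  "givens i j c s x = x(i := c * x i + s * x j, j := c * x j - s * x i)"

lemma sum_remove2:
  fixes f :: "nat \<Rightarrow> real"
  assumes "i < n" "j < n" "i \<noteq> j"
  shows "(\<Sum>k<n. f k) = f i + f j + (\<Sum>k\<in>{..<n} - {i, j}. f k)"
proof -
  have "(\<Sum>k<n. f k) = f i + (\<Sum>k\<in>{..<n} - {i}. f k)"
    by (rule sum.remove) (use assms in auto)
  also have "(\<Sum>k\<in>{..<n} - {i}. f k) = f j + (\<Sum>k\<in>{..<n} - {i} - {j}. f k)"
    by (rule sum.remove) (use assms in auto)
  also have "{..<n} - {i} - {j} = {..<n} - {i, j}" by auto
  finally show ?thesis by simp
qed

lemma dot_givens:
  assumes "i < n" "j < n" "i \<noteq> j" and cs: "c\<^sup>2 + s\<^sup>2 = 1"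
  shows "dot n (givens i j c s x) (givens i j c s y) = dot n x y"
proof -
  have rest: "(\<Sum>k\<in>{..<n} - {i, j}. givens i j c s x k * givens i j c s y k) = (\<Sum>k\<in>{..<n} - {i, j}. x k * y k)"
    by (rule sum.cong) (auto simp: givens_def)
  have "(c * x i + s * x j) * (c * y i + s * y j) + (c * x j - s * x i) * (c * y j - s * y i)
      = (c\<^sup>2 + s\<^sup>2) * (x i * y i + x j * y j)"
    by (simp add: power2_eq_square algebra_simps)
  then show ?thesis
    using assms(3) unfolding dot_def sum_remove2[OF assms(1-3)] rest cs
    by (simp add: givens_def)
qed

lemma givens_inverse:
  assumes "i \<noteq> j" "c\<^sup>2 + s\<^sup>2 = 1"
  shows "givens i j c s (givens i j c (- s) x) = x"
proof
  fix k
  have "c * (c * x i - s * x j) + s * (c * x j + s * x i) = (c\<^sup>2 + s\<^sup>2) * x i"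
    "c * (c * x j + s * x i) - s * (c * x i - s * x j) = (c\<^sup>2 + s\<^sup>2) * x j"
    by (simp_all add: power2_eq_square algebra_simps)
  then show "givens i j c s (givens i j c (- s) x) k = x k"
    using assms by (simp add: givens_def)
qed

lemma measurable_givens:
  assumes "i < n" "j < n"
  shows "givens i j c s \<in> measurable (Rn n) (Rn n)"
proof (rule measurable_PiM_single')
  fix k assume "k \<in> {..<n}"
  have "(\<lambda>x. if k = j then c * x j - s * x i else if k = i then c * x i + s * x j else x k) \<in> borel_measurable (Rn n)"
    using assms \<open>k \<in> {..<n}\<close> by (cases "k = j"; cases "k = i") simp_all
  then show "(\<lambda>x. givens i j c s x k) \<in> borel_measurable (Rn n)"
    by (simp add: givens_def fun_upd_def)
next
  show "givens i j c s \<in> space (Rn n) \<rightarrow> {..<n} \<rightarrow>\<^sub>E space borel"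
    using assms by (auto simp: givens_def space_PiM PiE_def extensional_def)
qed

inductive rotation :: "nat \<Rightarrow> ((nat \<Rightarrow> real) \<Rightarrow> nat \<Rightarrow> real) \<Rightarrow> bool" for n where
  rotation_id: "rotation n (\<lambda>x. x)"
| rotation_givens: "rotation n T \<Longrightarrow> i < n \<Longrightarrow> j < n \<Longrightarrow> i \<noteq> j \<Longrightarrow> c\<^sup>2 + s\<^sup>2 = 1
    \<Longrightarrow> rotation n (\<lambda>x. givens i j c s (T x))"

lemma rotation_compose: "rotation n T' \<Longrightarrow> rotation n T \<Longrightarrow> rotation n (\<lambda>x. T' (T x))"
  by (induction rule: rotation.induct) (auto intro: rotation.intros)

lemma dot_rotation: "rotation n T \<Longrightarrow> dot n (T x) (T y) = dot n x y"
  by (induction rule: rotation.induct) (auto simp: dot_givens)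

lemma measurable_rotation: "rotation n T \<Longrightarrow> T \<in> measurable (Rn n) (Rn n)"
  by (induction rule: rotation.induct) (auto intro: measurable_compose[OF _ measurable_givens])

text \<open>
  A condition that spherical laws and the Gaussian measure share, so that the two can be treated
  alike.
\<close>

definition rotation_invariant :: "nat \<Rightarrow> (nat \<Rightarrow> real) measure \<Rightarrow> bool" where
  "rotation_invariant n \<mu> \<longleftrightarrow> sets \<mu> = sets (Rn n) \<and>
     (\<forall>i j c s. i < n \<longrightarrow> j < n \<longrightarrow> i \<noteq> j \<longrightarrow> c\<^sup>2 + s\<^sup>2 = 1 \<longrightarrow> distr \<mu> (Rn n) (givens i j c s) = \<mu>)"

lemma rotation_invariant_sets: "rotation_invariant n \<mu> \<Longrightarrow> sets \<mu> = sets (Rn n)"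
  by (simp add: rotation_invariant_def)

lemma distr_rotation:
  assumes \<mu>: "rotation_invariant n \<mu>" and T: "rotation n T"
  shows "distr \<mu> (Rn n) T = \<mu>"
  using T
proof (induction rule: rotation.induct)
  case rotation_id
  show ?case by (rule distr_id2) (use \<mu> in \<open>simp add: rotation_invariant_def\<close>)
next
  case (rotation_givens T i j c s)
  have meas: "T \<in> measurable \<mu> (Rn n)"
    using measurable_rotation[OF rotation_givens.hyps(1)] rotation_invariant_sets[OF \<mu>]
    by (simp cong: measurable_cong_sets)
  have "distr \<mu> (Rn n) (givens i j c s \<circ> T) = distr (distr \<mu> (Rn n) T) (Rn n) (givens i j c s)"
    by (rule distr_distr[symmetric]) (use meas rotation_givens.hyps measurable_givens in auto)
  also have "\<dots> = \<mu>"
    using \<mu> rotation_givens by (simp add: rotation_invariant_def)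
  finally show ?case by (simp add: comp_def)
qed

lemma measure_rotation_vimage:
  assumes \<mu>: "rotation_invariant n \<mu>" and T: "rotation n T" and A: "A \<in> sets (Rn n)"
  shows "measure \<mu> {x \<in> space (Rn n). T x \<in> A} = measure \<mu> A"
proof -
  have meas: "T \<in> measurable \<mu> (Rn n)"
    using measurable_rotation[OF T] rotation_invariant_sets[OF \<mu>]
    by (simp cong: measurable_cong_sets)
  have "measure \<mu> A = measure (distr \<mu> (Rn n) T) A"
    using distr_rotation[OF \<mu> T] by simp
  also have "\<dots> = measure \<mu> (T -` A \<inter> space \<mu>)"
    by (rule measure_distr[OF meas A])
  also have "T -` A \<inter> space \<mu> = {x \<in> space (Rn n). T x \<in> A}"
    using sets_eq_imp_space_eq[OF rotation_invariant_sets[OF \<mu>]] by auto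
  finally show ?thesis by simp
qed

text \<open>
  Gaussian elimination by plane rotations: the coordinates in \<open>J\<close> of \<open>u\<close> are rotated into coordinate
  \<open>m\<close> one at a time. No coordinate outside \<open>J\<close> and \<open>m\<close> is touched for any vector, so that a second
  elimination can leave the result of a first one intact.
\<close>

lemma rotation_annihilate:
  assumes "finite J" "J \<subseteq> {..<n} - {m}" "m < n"
  shows "\<exists>T. rotation n T \<and> (\<forall>k\<in>J. T u k = 0) \<and> (\<forall>v k. k \<notin> insert m J \<longrightarrow> T v k = v k)"
  using assms
proof (induction J rule: finite_induct)
  case empty
  show ?case by (rule exI[of _ "\<lambda>x. x"]) (auto intro: rotation_id)
next
  case (insert j J)
  then obtain T where T: "rotation n T" "\<And>k. k \<in> J \<Longrightarrow> T u k = 0"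
      "\<And>v k. k \<notin> insert m J \<Longrightarrow> T v k = v k"
    by auto
  have j: "j < n" "j \<noteq> m" "m \<notin> J" using insert.prems by auto
  define r where "r = sqrt ((T u m)\<^sup>2 + (T u j)\<^sup>2)"
  show ?case
  proof (cases "r = 0")
    case True
    then have "T u j = 0" unfolding r_def by (simp add: sum_power2_eq_zero_iff)
    then show ?thesis using T by (intro exI[of _ T]) auto
  next
    case False
    then have r2: "r\<^sup>2 = (T u m)\<^sup>2 + (T u j)\<^sup>2" unfolding r_def by simp
    let ?G = "givens m j (T u m / r) (T u j / r)"
    have "(T u m / r)\<^sup>2 + (T u j / r)\<^sup>2 = 1"
      using False by (simp add: power_divide add_divide_distrib[symmetric] r2[symmetric])
    then have "rotation n (\<lambda>x. ?G (T x))"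
      using T(1) j insert.prems by (intro rotation_givens) auto
    moreover have "?G (T u) k = 0" if "k \<in> insert j J" for k
      using that j insert.hyps T(2) by (auto simp: givens_def)
    moreover have "?G (T v) k = v k" if "k \<notin> insert m (insert j J)" for v k
      using that T(3) by (simp add: givens_def)
    ultimately show ?thesis by (intro exI[of _ "\<lambda>x. ?G (T x)"]) auto
  qed
qed

lemma dot_single:
  assumes "i < n" "\<And>k. k < n \<Longrightarrow> k \<noteq> i \<Longrightarrow> a k = 0"
  shows "dot n a y = a i * y i"
proof -
  have "dot n a y = (\<Sum>k<n. if k = i then a i * y i else 0)"
    unfolding dot_def using assms(2) by (intro sum.cong) auto
  then show ?thesis using assms(1) by simp
qed

text \<open>
  First \<open>u\<close> is rotated to the axis 0; as \<open>v\<close> is orthogonal to \<open>u\<close>, its image has no component there,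
  and a rotation of the other coordinates takes it to the axis 1.
\<close>

lemma orthogonal_pair_to_axes:
  assumes n: "2 \<le> n" and orth: "dot n u v = 0" and u: "dot n u u \<noteq> 0"
  obtains T a b where "rotation n T" "a\<^sup>2 = dot n u u" "b\<^sup>2 = dot n v v"
    "\<And>y. dot n u y = a * T y 0" "\<And>y. dot n v y = b * T y 1"
proof -
  obtain T1 where T1: "rotation n T1" "\<And>k. k \<in> {1..<n} \<Longrightarrow> T1 u k = 0"
    using rotation_annihilate[of "{1..<n}" n 0 u] n by fastforce
  have u1: "dot n (T1 u) y = T1 u 0 * y 0" for y
    by (rule dot_single) (use n T1(2) in auto)
  have a: "(T1 u 0)\<^sup>2 = dot n u u"
    using u1[of "T1 u"] dot_rotation[OF T1(1), of u u] by (simp add: power2_eq_square)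
  have "T1 u 0 * T1 v 0 = 0"
    using u1[of "T1 v"] dot_rotation[OF T1(1), of u v] orth by simp
  with a u have v0: "T1 v 0 = 0" by auto
  obtain T2 where T2: "rotation n T2" "\<And>k. k \<in> {2..<n} \<Longrightarrow> T2 (T1 v) k = 0"
      "\<And>w k. k \<notin> insert 1 {2..<n} \<Longrightarrow> T2 w k = w k"
    using rotation_annihilate[of "{2..<n}" n 1 "T1 v"] n by fastforce
  have v2: "dot n (T2 (T1 v)) y = T2 (T1 v) 1 * y 1" for y
  proof (rule dot_single)
    fix k assume "k < n" "k \<noteq> 1"
    then show "T2 (T1 v) k = 0"
      using T2(2)[of k] T2(3)[of 0 "T1 v"] v0 by (cases "k = 0") auto
  qed (use n in auto)
  let ?T = "\<lambda>x. T2 (T1 x)"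
  show thesis
  proof (rule that)
    show R: "rotation n ?T" by (rule rotation_compose[OF T2(1) T1(1)])
    show "(T1 u 0)\<^sup>2 = dot n u u" by (rule a)
    show "dot n u y = T1 u 0 * ?T y 0" for y
      using u1[of "T1 y"] dot_rotation[OF T1(1), of u y] T2(3)[of 0 "T1 y"] by simp
    show "dot n v y = T2 (T1 v) 1 * ?T y 1" for y
      using v2[of "?T y"] dot_rotation[OF R, of v y] by simp
    then show "(T2 (T1 v) 1)\<^sup>2 = dot n v v" by (simp add: power2_eq_square)
  qed
qed

section \<open>Correlation with a rotation invariant vector\<close>

text \<open>
  It vanishes exactly if \<open>x\<close> is constant, the case in which the correlation is degenerate.
\<close>

definition spread :: "nat \<Rightarrow> (nat \<Rightarrow> real) \<Rightarrow> real" where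
  "spread n x = (\<Sum>i<n. (x i - mean n x)\<^sup>2)"

definition tail_norm2 :: "nat \<Rightarrow> (nat \<Rightarrow> real) \<Rightarrow> real" where
  "tail_norm2 n z = (\<Sum>k=1..<n. (z k)\<^sup>2)"

lemma centred_inner:
  assumes "n > 0"
  shows "(\<Sum>i<n. (x i - mean n x) * (y i - mean n y)) = dot n (\<lambda>i. x i - mean n x) y"
proof -
  have "(\<Sum>i<n. x i - mean n x) = 0"
    using assms by (simp add: sum_subtractf mean_def)
  then have "(\<Sum>i<n. (x i - mean n x) * mean n y) = 0"
    by (simp add: sum_distrib_right[symmetric])
  then show ?thesis
    by (simp add: dot_def right_diff_distrib[of "x _ - _"] sum_subtractf)
qed

lemma dot_one: "dot n (\<lambda>_. 1) y = real n * mean n y" "dot n (\<lambda>_. 1) (\<lambda>_. 1) = real n"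
  by (cases "n = 0"; simp add: dot_def mean_def)+

lemma spread_eq:
  assumes "n > 0"
  shows "spread n y = dot n y y - (dot n (\<lambda>_. 1) y)\<^sup>2 / real n"
proof -
  have "spread n y = dot n (\<lambda>i. y i - mean n y) y"
    using centred_inner[OF assms, of y y] by (simp add: spread_def power2_eq_square)
  also have "\<dots> = dot n y y - mean n y * dot n (\<lambda>_. 1) y"
    by (simp add: dot_def left_diff_distrib sum_subtractf sum_distrib_left)
  finally show ?thesis
    using assms by (simp add: dot_one power2_eq_square)
qed

lemma dot_self_head:
  assumes "n > 0" shows "dot n z z = (z 0)\<^sup>2 + tail_norm2 n z"
proof -
  have "{..<n} = insert 0 {1..<n}" using assms by auto
  then show ?thesis by (simp add: dot_def tail_norm2_def power2_eq_square)
qed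

lemma tail_norm2_measurable [measurable]: "tail_norm2 n \<in> borel_measurable (Rn n)"
  unfolding tail_norm2_def by measurable

text \<open>
  The spread is the squared norm without the component along the all-ones vector, which the rotation
  turns into the coordinate 0.
\<close>

lemma spread_rotation:
  assumes n: "n > 0" and R: "rotation n T" and a: "a\<^sup>2 = real n"
    and T0: "\<And>y. dot n (\<lambda>_. 1) y = a * T y 0"
  shows "spread n y = tail_norm2 n (T y)"
proof -
  have "dot n y y = (T y 0)\<^sup>2 + tail_norm2 n (T y)"
    using dot_rotation[OF R, of y y] dot_self_head[OF n, of "T y"] by simp
  then show ?thesis
    using n by (simp add: spread_eq T0 power_mult_distrib a)
qed

text \<open>
  A pair of opposite spherical caps around the axis 1, in the space where coordinate 0 is
  disregarded: the event that the absolute correlation is at least \<open>t\<close>, after the all-ones vector and the centred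
  first argument have been rotated to the axes 0 and 1.
\<close>

definition cap :: "nat \<Rightarrow> real \<Rightarrow> (nat \<Rightarrow> real) set" where
  "cap n t = {z \<in> space (Rn n). 0 < tail_norm2 n z \<and> t\<^sup>2 * tail_norm2 n z \<le> (z 1)\<^sup>2}"

lemma cap_sets:
  assumes "2 \<le> n" shows "cap n t \<in> sets (Rn n)"
proof -
  have "(\<lambda>z. z 1) \<in> borel_measurable (Rn n)"
    by (rule measurable_component_singleton) (use assms in auto)
  then have "(\<lambda>z. (z 1)\<^sup>2) \<in> borel_measurable (Rn n)"
    by (rule borel_measurable_power)
  moreover have "(\<lambda>z. t\<^sup>2 * tail_norm2 n z) \<in> borel_measurable (Rn n)"
    by measurable
  ultimately have "{z \<in> space (Rn n). t\<^sup>2 * tail_norm2 n z \<le> (z 1)\<^sup>2} \<in> sets (Rn n)"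
    by (intro borel_measurable_le)
  moreover have "{z \<in> space (Rn n). 0 < tail_norm2 n z} \<in> sets (Rn n)"
    by measurable
  ultimately have "{z \<in> space (Rn n). 0 < tail_norm2 n z} \<inter> {z \<in> space (Rn n). t\<^sup>2 * tail_norm2 n z \<le> (z 1)\<^sup>2}
      \<in> sets (Rn n)"
    by (rule sets.Int[rotated])
  also have "{z \<in> space (Rn n). 0 < tail_norm2 n z} \<inter> {z \<in> space (Rn n). t\<^sup>2 * tail_norm2 n z \<le> (z 1)\<^sup>2} = cap n t"
    by (auto simp: cap_def)
  finally show ?thesis .
qed

text \<open>
  The centred vector \<open>x\<close> is orthogonal to the all-ones vector; rotating this pair to the axes 1 and 0
  turns the condition on \<open>y\<close> into membership of the rotated vector in the cap, whatever \<open>x\<close> is.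
\<close>

lemma measure_pearson_ge:
  assumes n: "2 \<le> n" and \<mu>: "rotation_invariant n \<mu>" and x: "spread n x \<noteq> 0" and t: "t > 0"
  shows "measure \<mu> {y \<in> space (Rn n). t \<le> \<bar>pearson n x y\<bar>} = measure \<mu> (cap n t)"
proof -
  define v where "v = (\<lambda>i. x i - mean n x)"
  have n0: "n > 0" using n by simp
  have vv: "dot n v v = spread n x"
    by (simp add: dot_def v_def spread_def power2_eq_square)
  have "dot n (\<lambda>_. 1) v = 0"
    using n by (simp add: dot_def v_def sum_subtractf mean_def)
  then obtain T a b where R: "rotation n T" and a: "a\<^sup>2 = dot n (\<lambda>_. 1) (\<lambda>_. 1)" and b: "b\<^sup>2 = dot n v v"
      and T0: "\<And>y. dot n (\<lambda>_. 1) y = a * T y 0" and T1: "\<And>y. dot n v y = b * T y 1"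
    by (rule orthogonal_pair_to_axes[OF n]) (use n in \<open>simp_all add: dot_one(2)\<close>)
  have spr: "spread n y = tail_norm2 n (T y)" for y
    by (rule spread_rotation[OF n0 R _ T0]) (simp add: a dot_one(2))
  have "spread n x \<ge> 0" by (simp add: spread_def sum_nonneg)
  with x have x0: "spread n x > 0" by simp
  have b0: "b \<noteq> 0" using b vv x0 by auto
  have iff: "t \<le> \<bar>pearson n x y\<bar> \<longleftrightarrow> 0 < tail_norm2 n (T y) \<and> t\<^sup>2 * tail_norm2 n (T y) \<le> (T y 1)\<^sup>2" for y
  proof -
    let ?S = "tail_norm2 n (T y)"
    have S0: "?S \<ge> 0" by (simp add: tail_norm2_def sum_nonneg)
    have "pearson n x y = b * T y 1 / sqrt (b\<^sup>2 * ?S)"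
      unfolding pearson_def centred_inner[OF n0] spread_def[symmetric] T1[unfolded v_def] spr[symmetric] b vv ..
    then have "\<bar>pearson n x y\<bar> = \<bar>T y 1\<bar> / sqrt ?S"
      using b0 S0 by (simp add: abs_mult real_sqrt_mult)
    moreover have "t \<le> \<bar>T y 1\<bar> / sqrt ?S \<longleftrightarrow> t\<^sup>2 * ?S \<le> (T y 1)\<^sup>2" if "?S > 0"
    proof -
      have "t \<le> \<bar>T y 1\<bar> / sqrt ?S \<longleftrightarrow> t * sqrt ?S \<le> \<bar>T y 1\<bar>"
        using that by (simp add: pos_le_divide_eq)
      also have "\<dots> \<longleftrightarrow> (t * sqrt ?S)\<^sup>2 \<le> \<bar>T y 1\<bar>\<^sup>2"
        using that t by (intro power_mono_iff[symmetric]) auto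
      finally show ?thesis using S0 by (simp add: power_mult_distrib)
    qed
    ultimately show ?thesis using S0 t by (cases "?S = 0") auto
  qed
  have "{y \<in> space (Rn n). t \<le> \<bar>pearson n x y\<bar>} = {y \<in> space (Rn n). T y \<in> cap n t}"
    using measurable_space[OF measurable_rotation[OF R]] by (auto simp: iff cap_def)
  then show ?thesis
    using measure_rotation_vimage[OF \<mu> R cap_sets[OF n]] by simp
qed

text \<open>
  The axis of coordinate 0 without the origin, so that its images under different rotations are
  disjoint.
\<close>

definition axis0 :: "nat \<Rightarrow> (nat \<Rightarrow> real) set" where
  "axis0 n = {z \<in> space (Rn n). tail_norm2 n z = 0 \<and> z 0 \<noteq> 0}"

lemma tail_norm2_eq_0_iff: "tail_norm2 n z = 0 \<longleftrightarrow> (\<forall>k\<in>{1..<n}. z k = 0)"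
  unfolding tail_norm2_def by (subst sum_nonneg_eq_0_iff) auto

lemma axis0_sets:
  assumes "n > 0" shows "axis0 n \<in> sets (Rn n)"
proof -
  have [simp]: "0 < n" using assms by simp
  show ?thesis unfolding axis0_def by measurable
qed

text \<open>
  Rotating by the angles \<open>arctan m\<close> in the plane of the coordinates 0 and 1 yields infinitely many
  lines that meet only in the origin. Without the origin they are disjoint and have equal measure, hence
  measure zero.
\<close>

lemma measure_axis0:
  assumes n: "2 \<le> n" and \<mu>: "rotation_invariant n \<mu>" and "prob_space \<mu>"
  shows "measure \<mu> (axis0 n) = 0"
proof -
  interpret prob_space \<mu> by fact
  have ax: "axis0 n \<in> sets (Rn n)"
    by (rule axis0_sets) (use n in simp)
  \<comment> \<open>cosine of the angle whose tangent is \<open>m\<close>\<close>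
  define c where "c m = 1 / sqrt (1 + (real m)\<^sup>2)" for m
  define T where "T m = givens 0 1 (c m) (real m * c m)" for m
  have c0: "c m \<noteq> 0" for m unfolding c_def by (simp add: add_nonneg_eq_0_iff)
  have "(c m)\<^sup>2 + (real m * c m)\<^sup>2 = (1 + (real m)\<^sup>2) * (c m)\<^sup>2" for m
    by (simp add: power_mult_distrib algebra_simps)
  moreover have "(c m)\<^sup>2 = 1 / (1 + (real m)\<^sup>2)" for m
    unfolding c_def by (simp add: power_divide)
  moreover have "1 + (real m)\<^sup>2 \<noteq> 0" for m by (simp add: add_nonneg_eq_0_iff)
  ultimately have cs: "(c m)\<^sup>2 + (real m * c m)\<^sup>2 = 1" for m by simp
  have R: "rotation n (T m)" for m
    unfolding T_def by (rule rotation_givens[OF rotation_id]) (use n cs in auto)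
  define E where "E m = {z \<in> space (Rn n). T m z \<in> axis0 n}" for m
  have E_sets: "E m \<in> sets \<mu>" for m
    using measurable_sets[OF measurable_rotation[OF R] ax, of m]
    by (simp add: E_def rotation_invariant_sets[OF \<mu>] vimage_def Int_def conj_commute)
  have E_line: "z 1 = real m * z 0 \<and> z 0 \<noteq> 0" if "z \<in> E m" for z m
  proof -
    have *: "T m z 1 = 0" "T m z 0 \<noteq> 0"
      using that n by (auto simp: E_def axis0_def tail_norm2_eq_0_iff)
    have "c m * (z 1 - real m * z 0) = 0"
      using *(1) by (simp add: T_def givens_def algebra_simps)
    with c0 have z1: "z 1 = real m * z 0" by simp
    then show ?thesis using *(2) by (auto simp: T_def givens_def)
  qed
  have disj: "disjoint_family E"
  proof (unfold disjoint_family_on_def, intro ballI impI)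
    fix l m :: nat assume "l \<noteq> m"
    show "E l \<inter> E m = {}"
    proof (intro equals0I)
      fix z assume "z \<in> E l \<inter> E m"
      then have "real l * z 0 = real m * z 0" "z 0 \<noteq> 0" using E_line[of z l] E_line[of z m] by auto
      with \<open>l \<noteq> m\<close> show False by simp
    qed
  qed
  have "(\<lambda>m. measure \<mu> (E m)) sums measure \<mu> (\<Union>m. E m)"
    by (rule finite_measure_UNION) (use E_sets disj in auto)
  then have "summable (\<lambda>m::nat. measure \<mu> (axis0 n))"
    using measure_rotation_vimage[OF \<mu> R ax] by (simp add: E_def sums_iff)
  then show ?thesis by (simp add: summable_const_iff)
qed

lemma spread_measurable [measurable]: "spread n \<in> borel_measurable (Rn n)"
  unfolding spread_def mean_def by measurable

text \<open>
  The constant vectors form a line, which a rotation takes to the axis 0.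
\<close>

lemma measure_spread_0:
  assumes n: "2 \<le> n" and \<mu>: "rotation_invariant n \<mu>" and "prob_space \<mu>"
    and zero: "measure \<mu> {x \<in> space (Rn n). \<forall>k<n. x k = 0} = 0"
  shows "measure \<mu> {x \<in> space (Rn n). spread n x = 0} = 0"
proof -
  interpret prob_space \<mu> by fact
  have n0: "n > 0" using n by simp
  obtain T a b where R: "rotation n T" and a: "a\<^sup>2 = dot n (\<lambda>_. 1) (\<lambda>_. 1)" and
      T0: "\<And>y. dot n (\<lambda>_. 1) y = a * T y 0"
    by (rule orthogonal_pair_to_axes[OF n, of "\<lambda>_. 1" "\<lambda>_. 0"]) (use n in \<open>simp_all add: dot_def\<close>)
  have spr: "spread n y = tail_norm2 n (T y)" for y
    by (rule spread_rotation[OF n0 R _ T0]) (simp add: a dot_one(2))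
  let ?A = "{z \<in> space (Rn n). tail_norm2 n z = 0}"
  let ?Z = "{x \<in> space (Rn n). \<forall>k<n. x k = 0}"
  have "{x \<in> space (Rn n). spread n x = 0} = {x \<in> space (Rn n). T x \<in> ?A}"
    using measurable_space[OF measurable_rotation[OF R]] by (auto simp: spr)
  then have "measure \<mu> {x \<in> space (Rn n). spread n x = 0} = measure \<mu> ?A"
    using measure_rotation_vimage[OF \<mu> R, of ?A] by simp
  also have "?A = axis0 n \<union> ?Z"
  proof -
    have "(\<forall>k<n. z k = 0) \<longleftrightarrow> z 0 = 0 \<and> (\<forall>k\<in>{1..<n}. z k = 0)" for z :: "nat \<Rightarrow> real"
      using n0 by (metis atLeastLessThan_iff less_one linorder_not_less)
    then show ?thesis by (auto simp: axis0_def tail_norm2_eq_0_iff)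
  qed
  also have "measure \<mu> (axis0 n \<union> ?Z) \<le> measure \<mu> (axis0 n) + measure \<mu> ?Z"
    using axis0_sets[OF n0] rotation_invariant_sets[OF \<mu>] by (intro measure_Un_le) auto
  also have "\<dots> = 0" using measure_axis0[OF n \<mu> \<open>prob_space \<mu>\<close>] zero by simp
  finally show ?thesis by (simp add: measure_le_0_iff)
qed

section \<open>Spherical vectors are invariant under rotations of coordinate planes\<close>

text \<open>
  The columns are the images of the unit vectors.
\<close>

definition givens_mat :: "nat \<Rightarrow> nat \<Rightarrow> real \<Rightarrow> real \<Rightarrow> nat \<Rightarrow> nat \<Rightarrow> real" where
  "givens_mat i j c s k l = givens i j c s (\<lambda>m. if m = l then 1 else 0) k"

lemma dot_unit:
  assumes "k < n" shows "dot n (\<lambda>m. if m = k then 1 else 0) x = x k"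
  using dot_single[of k n "\<lambda>m. if m = k then 1 else 0" x] assms by simp

lemma givens_mat_transpose:
  "i \<noteq> j \<Longrightarrow> givens_mat i j c s k l = givens i j c (- s) (\<lambda>m. if m = k then 1 else 0) l"
  by (auto simp: givens_mat_def givens_def)

lemma mat_vec_givens:
  assumes "i < n" "j < n" "i \<noteq> j" "c\<^sup>2 + s\<^sup>2 = 1" "x \<in> space (Rn n)"
  shows "mat_vec n (givens_mat i j c s) x = givens i j c s x"
proof
  fix k
  show "mat_vec n (givens_mat i j c s) x k = givens i j c s x k"
  proof (cases "k < n")
    case True
    let ?e = "\<lambda>m. if m = k then 1 else 0 :: real"
    have "mat_vec n (givens_mat i j c s) x k = dot n (givens i j c (- s) ?e) x"
      using True assms by (simp add: mat_vec_def dot_def givens_mat_transpose)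
    also have "\<dots> = dot n (givens i j c s (givens i j c (- s) ?e)) (givens i j c s x)"
      by (rule dot_givens[symmetric]) (use assms in auto)
    also have "\<dots> = givens i j c s x k"
      using assms True by (simp add: givens_inverse dot_unit)
    finally show ?thesis .
  next
    case False
    then have "x k = undefined" using assms(5) by (auto simp: space_PiM PiE_def extensional_def)
    then show ?thesis using False assms by (simp add: mat_vec_def givens_def)
  qed
qed

lemma orthogonal_givens_mat:
  assumes "i < n" "j < n" "i \<noteq> j" "c\<^sup>2 + s\<^sup>2 = 1"
  shows "orthogonal_mat n (givens_mat i j c s)"
  unfolding orthogonal_mat_def
proof (intro allI impI conjI)
  fix a b assume ab: "a < n" "b < n"
  let ?e = "\<lambda>k m. if m = k then 1 else 0 :: real"
  have "(\<Sum>k<n. givens_mat i j c s k a * givens_mat i j c s k b) = dot n (givens i j c s (?e a)) (givens i j c s (?e b))"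
    by (simp add: dot_def givens_mat_def)
  also have "\<dots> = dot n (?e a) (?e b)" by (rule dot_givens[OF assms])
  finally show "(\<Sum>k<n. givens_mat i j c s k a * givens_mat i j c s k b) = (if a = b then 1 else 0)"
    using ab by (simp add: dot_unit)
  have "(\<Sum>k<n. givens_mat i j c s a k * givens_mat i j c s b k) = dot n (givens i j c (- s) (?e a)) (givens i j c (- s) (?e b))"
    using assms by (simp add: dot_def givens_mat_transpose)
  also have "\<dots> = dot n (?e a) (?e b)" by (rule dot_givens) (use assms in auto)
  finally show "(\<Sum>k<n. givens_mat i j c s a k * givens_mat i j c s b k) = (if a = b then 1 else 0)"
    using ab by (simp add: dot_unit)
qed

lemma spherical_rotation_invariant:
  assumes Y: "spherical n M Y"
  shows "rotation_invariant n (distr M (Rn n) Y)"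
  unfolding rotation_invariant_def
proof (intro conjI allI impI)
  fix i j c s assume ij: "i < n" "j < n" "i \<noteq> j" "c\<^sup>2 + s\<^sup>2 = (1::real)"
  have meas: "Y \<in> measurable M (Rn n)" using Y by (simp add: spherical_def)
  have "distr (distr M (Rn n) Y) (Rn n) (givens i j c s) = distr M (Rn n) (givens i j c s \<circ> Y)"
    by (rule distr_distr) (use meas ij measurable_givens in auto)
  also have "\<dots> = distr M (Rn n) (\<lambda>\<omega>. mat_vec n (givens_mat i j c s) (Y \<omega>))"
    by (rule distr_cong) (use measurable_space[OF meas] ij in \<open>simp_all add: mat_vec_givens\<close>)
  also have "\<dots> = distr M (Rn n) Y"
    using Y orthogonal_givens_mat[OF ij] by (simp add: spherical_def)
  finally show "distr (distr M (Rn n) Y) (Rn n) (givens i j c s) = distr M (Rn n) Y" .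
qed simp

section \<open>Rotation invariance of the Gaussian measure\<close>

abbreviation Leb :: "nat set \<Rightarrow> (nat \<Rightarrow> real) measure" where
  "Leb J \<equiv> PiM J (\<lambda>_. lborel)"

lemma sets_Leb: "sets (Leb J) = sets (PiM J (\<lambda>_. borel))"
  by (rule sets_PiM_cong) auto

lemma space_Leb: "space (Leb J) = space (PiM J (\<lambda>_. borel))"
  by (rule sets_eq_imp_space_eq[OF sets_Leb])

interpretation coordinates: product_sigma_finite "\<lambda>_::nat. lborel :: real measure"
  by standard

text \<open>
  A plane rotation with \<open>c \<noteq> 0\<close> factors into two maps that change one variable each: first
  \<open>a' = c a + s b\<close> for fixed \<open>b\<close>, which scales by \<open>\<bar>c\<bar>\<close>, and then \<open>b' = (b - s a') / c\<close> for fixed \<open>a'\<close>,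
  which scales back. If \<open>c = 0\<close> it is a swap of the variables up to signs.
\<close>

lemma nn_integral_plane_rotation:
  fixes h :: "real \<times> real \<Rightarrow> ennreal"
  assumes h[measurable]: "h \<in> borel_measurable (borel \<Otimes>\<^sub>M borel)" and cs: "c\<^sup>2 + s\<^sup>2 = 1"
  shows "(\<integral>\<^sup>+b. \<integral>\<^sup>+a. h (c * a + s * b, c * b - s * a) \<partial>lborel \<partial>lborel)
       = (\<integral>\<^sup>+b. \<integral>\<^sup>+a. h (a, b) \<partial>lborel \<partial>lborel)"
proof -
  have swap: "(\<integral>\<^sup>+b. \<integral>\<^sup>+a. f (a, b) \<partial>lborel \<partial>lborel) = (\<integral>\<^sup>+a. \<integral>\<^sup>+b. f (a, b) \<partial>lborel \<partial>lborel)"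
    if "f \<in> borel_measurable (borel \<Otimes>\<^sub>M borel)" for f :: "real \<times> real \<Rightarrow> ennreal"
    by (rule lborel_pair.Fubini') (use that in simp)
  show ?thesis
  proof (cases "c = 0")
    case False
    have "\<bar>c\<bar> * (\<integral>\<^sup>+b. \<integral>\<^sup>+a. h (c * a + s * b, c * b - s * a) \<partial>lborel \<partial>lborel)
        = (\<integral>\<^sup>+b. \<bar>c\<bar> * (\<integral>\<^sup>+a. h (c * a + s * b, c * b - s * a) \<partial>lborel) \<partial>lborel)"
      by (rule nn_integral_cmult[symmetric]) measurable
    also have "\<dots> = (\<integral>\<^sup>+b. \<integral>\<^sup>+a. h (a, (b - s * a) / c) \<partial>lborel \<partial>lborel)"
    proof (rule nn_integral_cong)
      fix b :: real
      have eq: "(b - s * (s * b + c * a)) / c = c * b - s * a" for a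
      proof -
        have "b - s * (s * b + c * a) = (c\<^sup>2 + s\<^sup>2) * b - s * (s * b + c * a)" using cs by simp
        also have "\<dots> = c * (c * b - s * a)" by (simp add: power2_eq_square algebra_simps)
        finally show ?thesis using False by simp
      qed
      have "(\<integral>\<^sup>+a. h (a, (b - s * a) / c) \<partial>lborel)
          = \<bar>c\<bar> * (\<integral>\<^sup>+a. h (s * b + c * a, (b - s * (s * b + c * a)) / c) \<partial>lborel)"
        by (rule nn_integral_real_affine) (use False in measurable)
      then show "\<bar>c\<bar> * (\<integral>\<^sup>+a. h (c * a + s * b, c * b - s * a) \<partial>lborel) = (\<integral>\<^sup>+a. h (a, (b - s * a) / c) \<partial>lborel)"
        using eq by (simp add: add.commute[of "s * b"])
    qed
    also have "\<dots> = (\<integral>\<^sup>+a. \<integral>\<^sup>+b. h (a, (b - s * a) / c) \<partial>lborel \<partial>lborel)"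
      using swap[of "\<lambda>(a, b). h (a, (b - s * a) / c)"] by simp
    also have "\<dots> = (\<integral>\<^sup>+a. \<bar>c\<bar> * (\<integral>\<^sup>+b. h (a, b) \<partial>lborel) \<partial>lborel)"
    proof (rule nn_integral_cong)
      fix a :: real
      have eq: "(c * b + s * a - s * a) / c = b" for b using False by simp
      have "(\<integral>\<^sup>+b. h (a, (b - s * a) / c) \<partial>lborel)
          = \<bar>c\<bar> * (\<integral>\<^sup>+b. h (a, (s * a + c * b - s * a) / c) \<partial>lborel)"
        by (rule nn_integral_real_affine) (use False in measurable)
      then show "(\<integral>\<^sup>+b. h (a, (b - s * a) / c) \<partial>lborel) = \<bar>c\<bar> * (\<integral>\<^sup>+b. h (a, b) \<partial>lborel)"
        using False by simp
    qed
    also have "\<dots> = \<bar>c\<bar> * (\<integral>\<^sup>+a. \<integral>\<^sup>+b. h (a, b) \<partial>lborel \<partial>lborel)"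
      by (rule nn_integral_cmult) measurable
    also have "(\<integral>\<^sup>+a. \<integral>\<^sup>+b. h (a, b) \<partial>lborel \<partial>lborel) = (\<integral>\<^sup>+b. \<integral>\<^sup>+a. h (a, b) \<partial>lborel \<partial>lborel)"
      by (rule swap[symmetric]) measurable
    finally show ?thesis
      using False by (simp add: ennreal_mult_cancel_left)
  next
    case True
    then have s2: "s\<^sup>2 = 1" using cs by simp
    then have s: "\<bar>s\<bar> = 1" "s \<noteq> 0" by (auto simp: power2_eq_1_iff)
    have "(\<integral>\<^sup>+b. \<integral>\<^sup>+a. h (c * a + s * b, c * b - s * a) \<partial>lborel \<partial>lborel)
        = (\<integral>\<^sup>+b. \<integral>\<^sup>+a. h (s * b, a) \<partial>lborel \<partial>lborel)"
    proof (rule nn_integral_cong)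
      fix b :: real
      have "(\<integral>\<^sup>+a. h (s * b, a) \<partial>lborel) = \<bar>- s\<bar> * (\<integral>\<^sup>+a. h (s * b, 0 + (- s) * a) \<partial>lborel)"
        by (rule nn_integral_real_affine) (measurable, use s in simp)
      then show "(\<integral>\<^sup>+a. h (c * a + s * b, c * b - s * a) \<partial>lborel) = (\<integral>\<^sup>+a. h (s * b, a) \<partial>lborel)"
        using s True by simp
    qed
    also have "\<dots> = (\<integral>\<^sup>+b. \<integral>\<^sup>+a. h (b, a) \<partial>lborel \<partial>lborel)"
    proof -
      have "(\<integral>\<^sup>+b. (\<integral>\<^sup>+a. h (b, a) \<partial>lborel) \<partial>lborel)
          = \<bar>s\<bar> * (\<integral>\<^sup>+b. (\<integral>\<^sup>+a. h (0 + s * b, a) \<partial>lborel) \<partial>lborel)"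
        by (rule nn_integral_real_affine) (use s in measurable)
      then show ?thesis using s by simp
    qed
    also have "\<dots> = (\<integral>\<^sup>+b. \<integral>\<^sup>+a. h (a, b) \<partial>lborel \<partial>lborel)"
      by (rule swap[symmetric]) measurable
    finally show ?thesis .
  qed
qed

lemma measurable_update2:
  assumes "x \<in> space (Leb J)" "i \<notin> J" "j \<notin> J" "i \<noteq> j"
  shows "(\<lambda>(a, b). x(j := b, i := a)) \<in> measurable (borel \<Otimes>\<^sub>M borel) (Leb (insert i (insert j J)))"
proof (rule measurable_PiM_single')
  fix k assume "k \<in> insert i (insert j J)"
  have "(\<lambda>(a, b). if k = i then a else if k = j then b else x k) \<in> borel_measurable (borel \<Otimes>\<^sub>M borel)"
    by (cases "k = i"; cases "k = j") simp_all
  then show "(\<lambda>z. (case z of (a, b) \<Rightarrow> x(j := b, i := a)) k) \<in> measurable (borel \<Otimes>\<^sub>M borel) lborel"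
    by (simp add: fun_upd_def split_beta')
next
  show "(\<lambda>z. case z of (a, b) \<Rightarrow> x(j := b, i := a)) \<in> space (borel \<Otimes>\<^sub>M borel) \<rightarrow> insert i (insert j J) \<rightarrow>\<^sub>E space lborel"
    using assms by (auto simp: space_PiM PiE_def extensional_def)
qed

lemma nn_integral_Leb_insert2:
  assumes J: "finite J" "i \<notin> J" "j \<notin> J" "i \<noteq> j"
    and f: "f \<in> borel_measurable (Leb (insert i (insert j J)))"
  shows "(\<integral>\<^sup>+x. f x \<partial>Leb (insert i (insert j J))) = (\<integral>\<^sup>+x. \<integral>\<^sup>+b. \<integral>\<^sup>+a. f (x(j := b, i := a)) \<partial>lborel \<partial>lborel \<partial>Leb J)"
proof -
  have "(\<integral>\<^sup>+x. f x \<partial>Leb (insert i (insert j J))) = (\<integral>\<^sup>+x. \<integral>\<^sup>+a. f (x(i := a)) \<partial>lborel \<partial>Leb (insert j J))"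
    by (rule coordinates.product_nn_integral_insert) (use J f in auto)
  also have "\<dots> = (\<integral>\<^sup>+x. \<integral>\<^sup>+b. \<integral>\<^sup>+a. f ((x(j := b))(i := a)) \<partial>lborel \<partial>lborel \<partial>Leb J)"
  proof (rule coordinates.product_nn_integral_insert)
    have "(\<lambda>(x, a). x(i := a)) \<in> measurable (Leb (insert j J) \<Otimes>\<^sub>M lborel) (Leb (insert i (insert j J)))"
      by (rule measurable_add_dim)
    from measurable_compose[OF this f]
    have "(\<lambda>z. f ((fst z)(i := snd z))) \<in> borel_measurable (Leb (insert j J) \<Otimes>\<^sub>M lborel)"
      by (simp add: split_beta')
    then show "(\<lambda>x. \<integral>\<^sup>+a. f (x(i := a)) \<partial>lborel) \<in> borel_measurable (Leb (insert j J))"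
      by (intro lborel.borel_measurable_nn_integral) (simp add: split_beta')
  qed (use J in auto)
  finally show ?thesis .
qed

lemma nn_integral_givens:
  assumes ij: "i < n" "j < n" "i \<noteq> j" and cs: "c\<^sup>2 + s\<^sup>2 = 1"
    and f: "f \<in> borel_measurable (Rn n)"
  shows "(\<integral>\<^sup>+x. f (givens i j c s x) \<partial>Leb {..<n}) = (\<integral>\<^sup>+x. f x \<partial>Leb {..<n})"
proof -
  let ?J = "{..<n} - {i, j}"
  have I: "{..<n} = insert i (insert j ?J)" using ij by auto
  have f': "f \<in> borel_measurable (Leb {..<n})"
    using f by (simp cong: measurable_cong_sets add: sets_Leb)
  have fg: "(\<lambda>x. f (givens i j c s x)) \<in> borel_measurable (Leb {..<n})"
    using measurable_compose[OF measurable_givens[OF ij(1,2)] f] by (simp cong: measurable_cong_sets add: sets_Leb)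
  have "(\<integral>\<^sup>+x. f (givens i j c s x) \<partial>Leb {..<n})
      = (\<integral>\<^sup>+x. \<integral>\<^sup>+b. \<integral>\<^sup>+a. f (givens i j c s (x(j := b, i := a))) \<partial>lborel \<partial>lborel \<partial>Leb ?J)"
    using nn_integral_Leb_insert2[of ?J i j "\<lambda>x. f (givens i j c s x)"] fg ij unfolding I[symmetric] by simp
  also have "\<dots> = (\<integral>\<^sup>+x. \<integral>\<^sup>+b. \<integral>\<^sup>+a. f (x(j := b, i := a)) \<partial>lborel \<partial>lborel \<partial>Leb ?J)"
  proof (rule nn_integral_cong)
    fix x assume x: "x \<in> space (Leb ?J)"
    have m: "(\<lambda>(a, b). f (x(j := b, i := a))) \<in> borel_measurable (borel \<Otimes>\<^sub>M borel)"
      using measurable_compose[OF measurable_update2[OF x, of i j], of f borel] ij f' unfolding I[symmetric]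
      by (simp add: split_beta')
    have "givens i j c s (x(j := b, i := a)) = x(j := c * b - s * a, i := c * a + s * b)" for a b
      using ij by (auto simp: givens_def fun_eq_iff)
    then show "(\<integral>\<^sup>+b. \<integral>\<^sup>+a. f (givens i j c s (x(j := b, i := a))) \<partial>lborel \<partial>lborel)
        = (\<integral>\<^sup>+b. \<integral>\<^sup>+a. f (x(j := b, i := a)) \<partial>lborel \<partial>lborel)"
      using nn_integral_plane_rotation[OF m cs] by simp
  qed
  also have "\<dots> = (\<integral>\<^sup>+x. f x \<partial>Leb {..<n})"
    using nn_integral_Leb_insert2[of ?J i j f] f' ij unfolding I[symmetric] by simp
  finally show ?thesis .
qed

definition gauss :: "nat \<Rightarrow> (nat \<Rightarrow> real) measure" where
  "gauss n = density (Leb {..<n}) (\<lambda>x. \<Prod>k<n. ennreal (std_normal_density (x k)))"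

lemma sets_gauss: "sets (gauss n) = sets (Rn n)"
  by (simp add: gauss_def sets_Leb)

lemma prod_normal_density:
  "(\<Prod>k<n. ennreal (std_normal_density (x k))) = ennreal ((1 / sqrt (2 * pi)) ^ n * exp (- dot n x x / 2))"
proof -
  have "(\<Prod>k<n. ennreal (std_normal_density (x k))) = ennreal (\<Prod>k<n. 1 / sqrt (2 * pi) * exp (- (x k)\<^sup>2 / 2))"
    by (subst prod_ennreal) (auto simp: std_normal_density_def)
  also have "(\<Prod>k<n. 1 / sqrt (2 * pi) * exp (- (x k)\<^sup>2 / 2)) = (1 / sqrt (2 * pi)) ^ n * exp (\<Sum>k<n. - (x k)\<^sup>2 / 2)"
    by (simp only: prod.distrib exp_sum[OF finite_lessThan] prod_constant card_lessThan)
  also have "(\<Sum>k<n. - (x k)\<^sup>2 / 2) = - dot n x x / 2"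
    by (simp add: dot_def sum_negf sum_divide_distrib power2_eq_square)
  finally show ?thesis .
qed

lemma measurable_gauss_density [measurable]:
  "(\<lambda>x. \<Prod>k\<in>J. ennreal (std_normal_density (x k))) \<in> borel_measurable (Leb J)"
  by (intro borel_measurable_prod_ennreal) measurable

lemma prob_space_gauss: "prob_space (gauss n)"
proof
  have "(\<integral>\<^sup>+x. ennreal (std_normal_density x) \<partial>lborel) = 1"
    using prob_space.emeasure_space_1[OF prob_space_normal_density[of 1 0]]
    by (simp add: emeasure_density)
  moreover have "(\<integral>\<^sup>+x. (\<Prod>k<n. ennreal (std_normal_density (x k))) \<partial>Leb {..<n})
      = (\<Prod>k<n. \<integral>\<^sup>+x. ennreal (std_normal_density x) \<partial>lborel)"
    by (rule coordinates.product_nn_integral_prod) auto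
  ultimately show "emeasure (gauss n) (space (gauss n)) = 1"
    by (simp add: gauss_def emeasure_density)
qed

text \<open>
  The density is a function of the norm, which rotations preserve, as they preserve Lebesgue measure.
\<close>

lemma rotation_invariant_gauss: "rotation_invariant n (gauss n)"
  unfolding rotation_invariant_def
proof (intro conjI allI impI)
  show "sets (gauss n) = sets (Rn n)" by (rule sets_gauss)
  fix i j c s assume ij: "i < n" "j < n" "i \<noteq> j" "c\<^sup>2 + s\<^sup>2 = (1::real)"
  let ?g = "\<lambda>x. \<Prod>k<n. ennreal (std_normal_density (x k))"
  let ?G = "givens i j c s"
  have G: "?G \<in> measurable (gauss n) (Rn n)"
    using measurable_givens[OF ij(1,2)] sets_gauss by (simp cong: measurable_cong_sets)
  have g: "?g \<in> borel_measurable (Rn n)"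
    using measurable_gauss_density[of "{..<n}"] by (simp cong: measurable_cong_sets add: sets_Leb)
  show "distr (gauss n) (Rn n) ?G = gauss n"
  proof (rule measure_eqI)
    show "sets (distr (gauss n) (Rn n) ?G) = sets (gauss n)" by (simp add: sets_gauss)
    fix A assume "A \<in> sets (distr (gauss n) (Rn n) ?G)"
    then have A: "A \<in> sets (Rn n)" by simp
    have A': "A \<in> sets (Leb {..<n})" using A by (simp add: sets_Leb)
    have GA: "?G -` A \<inter> space (gauss n) \<in> sets (Leb {..<n})"
      using measurable_sets[OF G A] by (simp add: sets_gauss sets_Leb)
    have "emeasure (distr (gauss n) (Rn n) ?G) A = emeasure (gauss n) (?G -` A \<inter> space (gauss n))"
      by (rule emeasure_distr[OF G A])
    also have "\<dots> = (\<integral>\<^sup>+x. ?g x * indicator (?G -` A \<inter> space (gauss n)) x \<partial>Leb {..<n})"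
      using GA by (simp add: gauss_def emeasure_density)
    also have "\<dots> = (\<integral>\<^sup>+x. (\<lambda>y. ?g y * indicator A y) (?G x) \<partial>Leb {..<n})"
      by (rule nn_integral_cong)
         (simp add: prod_normal_density dot_givens[OF ij] indicator_def gauss_def)
    also have "\<dots> = (\<integral>\<^sup>+x. ?g x * indicator A x \<partial>Leb {..<n})"
      by (rule nn_integral_givens[OF ij]) (use g A in measurable)
    also have "\<dots> = emeasure (gauss n) A"
      using A' by (simp add: gauss_def emeasure_density)
    finally show "emeasure (distr (gauss n) (Rn n) ?G) A = emeasure (gauss n) A" .
  qed
qed

section \<open>The correlation law of a Gaussian vector\<close>

lemma AE_component_nonzero:
  assumes "finite J" "i \<in> J"
  shows "AE x in Leb J. x i \<noteq> 0"
proof -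
  let ?K = "J - {i}"
  let ?Z = "{x \<in> space (Leb J). x i = 0}"
  have J: "insert i ?K = J" using assms by auto
  have Z: "?Z \<in> sets (Leb J)" using assms by measurable
  have "emeasure (Leb J) ?Z = (\<integral>\<^sup>+x. indicator ?Z x \<partial>Leb (insert i ?K))"
    unfolding J using Z by simp
  also have "\<dots> = (\<integral>\<^sup>+x. \<integral>\<^sup>+y. indicator ?Z (x(i := y)) \<partial>lborel \<partial>Leb ?K)"
  proof (rule coordinates.product_nn_integral_insert)
    show "indicator ?Z \<in> borel_measurable (Leb (insert i ?K))"
      unfolding J using Z by (rule borel_measurable_indicator)
  qed (use assms in auto)
  also have "\<dots> = (\<integral>\<^sup>+x. 0 \<partial>Leb ?K)"
  proof (rule nn_integral_cong)
    fix x
    have "(\<integral>\<^sup>+y. indicator ?Z (x(i := y)) \<partial>lborel) \<le> (\<integral>\<^sup>+y. indicator {0} y \<partial>(lborel :: real measure))"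
      by (rule nn_integral_mono) (auto simp: indicator_def)
    then show "(\<integral>\<^sup>+y. indicator ?Z (x(i := y)) \<partial>lborel) = 0" by simp
  qed
  finally show ?thesis
    using Z by (intro AE_I[where N = ?Z]) auto
qed

lemma measurable_scale:
  "(\<lambda>x. \<lambda>k\<in>J. r * x k) \<in> measurable (Leb J) (Leb J)"
  by measurable

lemma nn_integral_scale:
  assumes "finite J" and r: "r > 0" and f: "f \<in> borel_measurable (Leb J)"
  shows "(\<integral>\<^sup>+x. f x \<partial>Leb J) = ennreal (r ^ card J) * (\<integral>\<^sup>+x. f (\<lambda>k\<in>J. r * x k) \<partial>Leb J)"
  using assms(1) f
proof (induction J arbitrary: f rule: finite_induct)
  case empty
  have "(\<integral>\<^sup>+x. f (\<lambda>k\<in>{}. r * x k) \<partial>Leb {}) = f (\<lambda>k\<in>({} :: nat set). r * undefined)"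
    by (rule coordinates.nn_integral_empty) simp
  moreover have "(\<integral>\<^sup>+x. f x \<partial>Leb {}) = f (\<lambda>_. undefined)"
    by (rule coordinates.nn_integral_empty) simp
  moreover have "(\<lambda>k\<in>({} :: nat set). r * undefined) = (\<lambda>_. undefined)" by (simp add: restrict_def)
  ultimately show ?case by (simp only: card.empty power_0 ennreal_1 mult_1_left)
next
  case (insert i J)
  note [measurable] = insert.prems
  have upd: "(\<lambda>x. f ((fst x)(i := snd x))) \<in> borel_measurable (Leb J \<Otimes>\<^sub>M lborel)"
    using measurable_compose[OF measurable_add_dim insert.prems] by (simp add: split_beta')
  then have F: "(\<lambda>x. \<integral>\<^sup>+y. f (x(i := y)) \<partial>lborel) \<in> borel_measurable (Leb J)"
    by (intro lborel.borel_measurable_nn_integral) (simp add: split_beta')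
  have fs: "(\<lambda>x. f (\<lambda>k\<in>insert i J. r * x k)) \<in> borel_measurable (Leb (insert i J))"
    by (rule measurable_compose[OF measurable_scale insert.prems])
  have upd_scale: "(\<lambda>k\<in>insert i J. r * (x(i := y)) k) = (\<lambda>k\<in>J. r * x k)(i := r * y)" for x y
    using insert.hyps by (auto simp: fun_eq_iff)
  have "(\<integral>\<^sup>+x. f x \<partial>Leb (insert i J)) = (\<integral>\<^sup>+x. \<integral>\<^sup>+y. f (x(i := y)) \<partial>lborel \<partial>Leb J)"
    by (rule coordinates.product_nn_integral_insert) (use insert in auto)
  also have "\<dots> = ennreal (r ^ card J) * (\<integral>\<^sup>+x. (\<integral>\<^sup>+y. f ((\<lambda>k\<in>J. r * x k)(i := y)) \<partial>lborel) \<partial>Leb J)"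
    by (rule insert.IH[OF F])
  also have "(\<integral>\<^sup>+x. (\<integral>\<^sup>+y. f ((\<lambda>k\<in>J. r * x k)(i := y)) \<partial>lborel) \<partial>Leb J)
      = (\<integral>\<^sup>+x. ennreal r * (\<integral>\<^sup>+y. f ((\<lambda>k\<in>J. r * x k)(i := r * y)) \<partial>lborel) \<partial>Leb J)"
  proof (rule nn_integral_cong)
    fix x assume "x \<in> space (Leb J)"
    then have "(\<lambda>k\<in>J. r * x k) \<in> space (Leb J)" by (auto simp: space_PiM)
    from measurable_compose[OF measurable_component_update[OF this insert.hyps(2)] insert.prems]
    have m: "(\<lambda>y. f ((\<lambda>k\<in>J. r * x k)(i := y))) \<in> borel_measurable borel" by simp
    show "(\<integral>\<^sup>+y. f ((\<lambda>k\<in>J. r * x k)(i := y)) \<partial>lborel)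
        = ennreal r * (\<integral>\<^sup>+y. f ((\<lambda>k\<in>J. r * x k)(i := r * y)) \<partial>lborel)"
      using nn_integral_real_affine[OF m, of r 0] r by simp
  qed
  also have "\<dots> = ennreal r * (\<integral>\<^sup>+x. (\<integral>\<^sup>+y. f (\<lambda>k\<in>insert i J. r * (x(i := y)) k) \<partial>lborel) \<partial>Leb J)"
    unfolding upd_scale
  proof (rule nn_integral_cmult)
    have "(\<lambda>x. (\<lambda>k\<in>J. r * fst x k)(i := r * snd x)) \<in> measurable (Leb J \<Otimes>\<^sub>M lborel) (Leb (insert i J))"
      using measurable_compose[OF measurable_add_dim measurable_scale[of r "insert i J"]]
      by (simp add: split_beta' upd_scale)
    from measurable_compose[OF this insert.prems]
    show "(\<lambda>x. \<integral>\<^sup>+y. f ((\<lambda>k\<in>J. r * x k)(i := r * y)) \<partial>lborel) \<in> borel_measurable (Leb J)"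
      by (intro lborel.borel_measurable_nn_integral) (simp add: split_beta')
  qed
  also have "(\<integral>\<^sup>+x. (\<integral>\<^sup>+y. f (\<lambda>k\<in>insert i J. r * (x(i := y)) k) \<partial>lborel) \<partial>Leb J)
      = (\<integral>\<^sup>+x. f (\<lambda>k\<in>insert i J. r * x k) \<partial>Leb (insert i J))"
    by (rule coordinates.product_nn_integral_insert[symmetric]) (use insert fs in auto)
  finally have step: "(\<integral>\<^sup>+x. f x \<partial>Leb (insert i J))
      = ennreal (r ^ card J) * (ennreal r * (\<integral>\<^sup>+x. f (\<lambda>k\<in>insert i J. r * x k) \<partial>Leb (insert i J)))" .
  have "ennreal (r ^ card J) * ennreal r = ennreal (r ^ card (insert i J))"
    using insert.hyps r by (simp add: ennreal_mult'[symmetric] mult.commute)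
  then show ?case unfolding step mult.assoc[symmetric] by (simp only:)
qed

text \<open>
  \<open>(1 + v\<^sup>2)\<close> to the power \<open>- (n - 1) / 2\<close>, up to scaling the density of Student's distribution
  with \<open>n - 2\<close> degrees of freedom.
\<close>

definition student_kernel :: "nat \<Rightarrow> real \<Rightarrow> real" where
  "student_kernel n v = (1 / sqrt (1 + v\<^sup>2)) ^ (n - 1)"

lemma student_kernel_measurable [measurable]: "student_kernel n \<in> borel_measurable borel"
  unfolding student_kernel_def by measurable

definition sq_sum :: "nat set \<Rightarrow> (nat \<Rightarrow> real) \<Rightarrow> real" where
  "sq_sum J x = (\<Sum>k\<in>J. (x k)\<^sup>2)"

lemma sq_sum_measurable [measurable]: "sq_sum J \<in> borel_measurable (Leb J)"
  unfolding sq_sum_def by measurable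

text \<open>
  The joint density of the coordinates \<open>2, ..., n - 1\<close> of a Gaussian vector and of the ratio \<open>v\<close> of
  coordinate 1 to their norm; the leading square root is the Jacobian of the substitution.
\<close>

definition radial :: "nat \<Rightarrow> (nat \<Rightarrow> real) \<Rightarrow> real \<Rightarrow> real" where
  "radial n x v = sqrt (sq_sum {2..<n} x) * (1 / sqrt (2 * pi)) ^ (n - 1) * exp (- (sq_sum {2..<n} x * (1 + v\<^sup>2)) / 2)"

lemma radial_measurable [measurable]:
  "(\<lambda>z. radial n (fst z) (snd z)) \<in> borel_measurable (Leb {2..<n} \<Otimes>\<^sub>M borel)"
  "(\<lambda>x. radial n x v) \<in> borel_measurable (Leb {2..<n})"
  unfolding radial_def by measurable

text \<open>
  The substitution of \<open>x / sqrt (1 + v\<^sup>2)\<close> for \<open>x\<close> removes \<open>v\<close> from the exponent. It contributes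
  \<open>n - 2\<close> factors \<open>1 / sqrt (1 + v\<^sup>2)\<close> from the volume and one from the Jacobian.
\<close>

lemma nn_integral_radial:
  assumes n: "2 \<le> n"
  shows "(\<integral>\<^sup>+x. ennreal (radial n x v) \<partial>Leb {2..<n})
       = ennreal (student_kernel n v) * (\<integral>\<^sup>+x. ennreal (radial n x 0) \<partial>Leb {2..<n})"
proof -
  define r where "r = 1 / sqrt (1 + v\<^sup>2)"
  have pos: "1 + v\<^sup>2 > 0" by (simp add: add_pos_nonneg)
  then have r: "r > 0" by (simp add: r_def)
  have r2: "r\<^sup>2 * (1 + v\<^sup>2) = 1" using pos by (simp add: r_def power_divide)
  have "sq_sum {2..<n} (\<lambda>k\<in>{2..<n}. r * x k) = r\<^sup>2 * sq_sum {2..<n} x" for x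
    by (simp add: sq_sum_def power_mult_distrib sum_distrib_left)
  moreover have "r\<^sup>2 * w * (1 + v\<^sup>2) = w" for w
    using r2 by (metis mult.assoc mult.commute mult.right_neutral)
  ultimately have scaled: "radial n (\<lambda>k\<in>{2..<n}. r * x k) v = r * radial n x 0" for x
    using r by (simp add: radial_def real_sqrt_mult)
  have "(\<integral>\<^sup>+x. ennreal (radial n x v) \<partial>Leb {2..<n})
      = ennreal (r ^ card {2..<n}) * (\<integral>\<^sup>+x. ennreal (radial n (\<lambda>k\<in>{2..<n}. r * x k) v) \<partial>Leb {2..<n})"
    by (rule nn_integral_scale) (use r in auto)
  also have "(\<integral>\<^sup>+x. ennreal (radial n (\<lambda>k\<in>{2..<n}. r * x k) v) \<partial>Leb {2..<n})
      = (\<integral>\<^sup>+x. ennreal r * ennreal (radial n x 0) \<partial>Leb {2..<n})"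
    unfolding scaled using r by (simp add: ennreal_mult')
  also have "\<dots> = ennreal r * (\<integral>\<^sup>+x. ennreal (radial n x 0) \<partial>Leb {2..<n})"
    by (rule nn_integral_cmult) measurable
  also have "ennreal (r ^ card {2..<n}) * (ennreal r * (\<integral>\<^sup>+x. ennreal (radial n x 0) \<partial>Leb {2..<n}))
      = ennreal (r ^ (n - 2) * r) * (\<integral>\<^sup>+x. ennreal (radial n x 0) \<partial>Leb {2..<n})"
    using r by (simp add: ennreal_mult mult.assoc)
  also have "r ^ (n - 2) * r = student_kernel n v"
  proof -
    obtain m where "n = 2 + m" using n le_Suc_ex by blast
    then show ?thesis by (simp add: student_kernel_def r_def)
  qed
  finally show ?thesis .
qed

text \<open>
  Coordinate 0 integrates out. Let \<open>W\<close> be the sum of the squares of the coordinates from 2 on. The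
  cap condition reads \<open>s\<^sup>2 W \<le> b\<^sup>2\<close> for coordinate 1, that is, \<open>s \<le> \<bar>v\<bar>\<close> after the substitution
  \<open>b = sqrt W * v\<close>, and for fixed \<open>v\<close> the remaining integral is the Student kernel up to a constant.
\<close>

lemma emeasure_gauss_cap:
  assumes n: "3 \<le> n" and t: "0 \<le> t" "t < 1"
  defines "s \<equiv> t / sqrt (1 - t\<^sup>2)"
  shows "emeasure (gauss n) (cap n t)
       = (\<integral>\<^sup>+x. ennreal (radial n x 0) \<partial>Leb {2..<n}) * (\<integral>\<^sup>+v. ennreal (student_kernel n v) * indicator {v. s \<le> \<bar>v\<bar>} v \<partial>lborel)"
proof -
  let ?J = "{2..<n}"
  let ?\<phi> = "std_normal_density"
  let ?W = "sq_sum ?J"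
  have I: "{..<n} = insert 0 (insert 1 ?J)" using n by auto
  define g where "g x = (\<Prod>k<n. ennreal (?\<phi> (x k)))" for x
  define P where "P x = (\<Prod>k\<in>?J. ennreal (?\<phi> (x k)))" for x
  define B where "B w = {b. 0 < b\<^sup>2 + w \<and> t\<^sup>2 * (b\<^sup>2 + w) \<le> b\<^sup>2}" for w :: real
  have cap: "cap n t \<in> sets (Leb {..<n})"
    using cap_sets[of n t] n by (simp add: sets_Leb)
  have gm: "g \<in> borel_measurable (Leb {..<n})"
    unfolding g_def by measurable
  have Pm [measurable]: "P \<in> borel_measurable (Leb ?J)"
    unfolding P_def by measurable
  have Bm [measurable]: "B w \<in> sets borel" for w unfolding B_def by measurable
  have one: "(\<integral>\<^sup>+x. ennreal (?\<phi> x) \<partial>lborel) = 1"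
    using prob_space.emeasure_space_1[OF prob_space_normal_density[of 1 0]]
    by (simp add: emeasure_density)
  have t2: "t\<^sup>2 < 1" using t by (simp add: power_less_one_iff abs_square_less_1)
  have s0: "0 \<le> s" using t t2 by (simp add: s_def)
  have s2: "s\<^sup>2 = t\<^sup>2 / (1 - t\<^sup>2)" using t2 by (simp add: s_def power_divide)
  have "emeasure (gauss n) (cap n t) = (\<integral>\<^sup>+x. g x * indicator (cap n t) x \<partial>Leb {..<n})"
    using cap gm by (simp add: gauss_def g_def emeasure_density)
  also have "\<dots> = (\<integral>\<^sup>+x. \<integral>\<^sup>+b. \<integral>\<^sup>+a. g (x(1 := b, 0 := a)) * indicator (cap n t) (x(1 := b, 0 := a)) \<partial>lborel \<partial>lborel \<partial>Leb ?J)"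
    using nn_integral_Leb_insert2[of ?J 0 1 "\<lambda>x. g x * indicator (cap n t) x"] cap gm
    unfolding I[symmetric] by simp
  also have "\<dots> = (\<integral>\<^sup>+x. \<integral>\<^sup>+b. P x * (ennreal (?\<phi> b) * indicator (B (?W x)) b) \<partial>lborel \<partial>Leb ?J)"
  proof (intro nn_integral_cong)
    fix x b assume x: "x \<in> space (Leb ?J)"
    have "tail_norm2 n (x(1 := b, 0 := a)) = b\<^sup>2 + ?W x" for a
    proof -
      have "{1..<n} = insert 1 ?J" using n by auto
      then show ?thesis by (simp add: tail_norm2_def sq_sum_def)
    qed
    moreover have "x(1 := b, 0 := a) \<in> space (Rn n)" for a
      using x n by (auto simp: space_PiM PiE_def extensional_def)
    ultimately have ind: "indicator (cap n t) (x(1 := b, 0 := a)) = (indicator (B (?W x)) b :: ennreal)" for a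
      by (simp add: cap_def B_def indicator_def)
    have dens: "g (x(1 := b, 0 := a)) = ennreal (?\<phi> a) * (ennreal (?\<phi> b) * P x)" for a
      unfolding g_def P_def I by simp
    have "(\<integral>\<^sup>+a. g (x(1 := b, 0 := a)) * indicator (cap n t) (x(1 := b, 0 := a)) \<partial>lborel)
        = (\<integral>\<^sup>+a. ennreal (?\<phi> a) * (ennreal (?\<phi> b) * P x * indicator (B (?W x)) b) \<partial>lborel)"
      unfolding ind dens by (simp add: mult.assoc)
    also have "\<dots> = ennreal (?\<phi> b) * P x * indicator (B (?W x)) b"
      by (subst nn_integral_multc) (simp_all add: one)
    finally show "(\<integral>\<^sup>+a. g (x(1 := b, 0 := a)) * indicator (cap n t) (x(1 := b, 0 := a)) \<partial>lborel)
        = P x * (ennreal (?\<phi> b) * indicator (B (?W x)) b)"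
      by (simp add: ac_simps)
  qed
  also have "\<dots> = (\<integral>\<^sup>+x. \<integral>\<^sup>+v. ennreal (radial n x v) * indicator {v. s \<le> \<bar>v\<bar>} v \<partial>lborel \<partial>Leb ?J)"
  proof (rule nn_integral_cong_AE)
    have "AE x in Leb ?J. x 2 \<noteq> 0" by (rule AE_component_nonzero) (use n in auto)
    then show "AE x in Leb ?J. (\<integral>\<^sup>+b. P x * (ennreal (?\<phi> b) * indicator (B (?W x)) b) \<partial>lborel)
        = (\<integral>\<^sup>+v. ennreal (radial n x v) * indicator {v. s \<le> \<bar>v\<bar>} v \<partial>lborel)"
    proof eventually_elim
      case (elim x)
      have "(x 2)\<^sup>2 \<le> ?W x"
        unfolding sq_sum_def by (rule member_le_sum) (use n in auto)
      with elim have W: "?W x > 0" by (meson less_le_trans zero_less_power2)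
      define w where "w = sqrt (?W x)"
      have w: "w > 0" "w\<^sup>2 = ?W x" using W by (simp_all add: w_def)
      have dens: "ennreal w * (P x * ennreal (?\<phi> (w * v))) = ennreal (radial n x v)" for v
      proof -
        have P: "P x = ennreal ((1 / sqrt (2 * pi)) ^ (n - 2) * exp (- ?W x / 2))"
        proof -
          have "P x = ennreal (\<Prod>k\<in>?J. 1 / sqrt (2 * pi) * exp (- (x k)\<^sup>2 / 2))"
            unfolding P_def by (subst prod_ennreal) (auto simp: std_normal_density_def)
          also have "(\<Prod>k\<in>?J. 1 / sqrt (2 * pi) * exp (- (x k)\<^sup>2 / 2)) = (1 / sqrt (2 * pi)) ^ (n - 2) * exp (\<Sum>k\<in>?J. - (x k)\<^sup>2 / 2)"
            by (simp only: prod.distrib exp_sum[OF finite_atLeastLessThan] prod_constant card_atLeastLessThan)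
          also have "(\<Sum>k\<in>?J. - (x k)\<^sup>2 / 2) = - ?W x / 2"
            by (simp add: sq_sum_def sum_negf sum_divide_distrib)
          finally show ?thesis .
        qed
        have e: "exp (- ?W x / 2) * exp (- (w * v)\<^sup>2 / 2) = exp (- (?W x * (1 + v\<^sup>2)) / 2)"
          by (simp add: exp_add[symmetric] power_mult_distrib w algebra_simps add_divide_distrib[symmetric])
        have nn: "n - 1 = Suc (n - 2)" using n by simp
        have "ennreal w * (P x * ennreal (?\<phi> (w * v)))
            = ennreal (w * ((1 / sqrt (2 * pi)) ^ (n - 2) * exp (- ?W x / 2) * (1 / sqrt (2 * pi) * exp (- (w * v)\<^sup>2 / 2))))"
          unfolding P using w by (simp add: std_normal_density_def ennreal_mult'[symmetric])
        also have "w * ((1 / sqrt (2 * pi)) ^ (n - 2) * exp (- ?W x / 2) * (1 / sqrt (2 * pi) * exp (- (w * v)\<^sup>2 / 2)))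
            = w * (1 / sqrt (2 * pi)) ^ (n - 1) * (exp (- ?W x / 2) * exp (- (w * v)\<^sup>2 / 2))"
          unfolding nn by simp
        finally show ?thesis unfolding e unfolding radial_def w_def .
      qed
      have B: "w * v \<in> B (?W x) \<longleftrightarrow> s \<le> \<bar>v\<bar>" for v
      proof -
        have "0 < (w * v)\<^sup>2 + ?W x" using W by (simp add: add_nonneg_pos)
        then have "w * v \<in> B (?W x) \<longleftrightarrow> ?W x * (t\<^sup>2 * (v\<^sup>2 + 1)) \<le> ?W x * v\<^sup>2"
          by (simp add: B_def power_mult_distrib w algebra_simps)
        also have "\<dots> \<longleftrightarrow> t\<^sup>2 * (v\<^sup>2 + 1) \<le> v\<^sup>2" using W by (simp only: mult_le_cancel_left_pos)
        also have "\<dots> \<longleftrightarrow> s\<^sup>2 \<le> \<bar>v\<bar>\<^sup>2" using t2 by (simp add: s2 field_simps)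
        also have "\<dots> \<longleftrightarrow> s \<le> \<bar>v\<bar>" using s0 by (simp add: abs_le_square_iff[symmetric])
        finally show ?thesis .
      qed
      have "(\<integral>\<^sup>+b. P x * (ennreal (?\<phi> b) * indicator (B (?W x)) b) \<partial>lborel)
          = ennreal \<bar>w\<bar> * (\<integral>\<^sup>+v. P x * (ennreal (?\<phi> (0 + w * v)) * indicator (B (?W x)) (0 + w * v)) \<partial>lborel)"
        by (rule nn_integral_real_affine) (use w in auto)
      also have "\<dots> = (\<integral>\<^sup>+v. ennreal w * (P x * (ennreal (?\<phi> (w * v)) * indicator (B (?W x)) (w * v))) \<partial>lborel)"
        using w by (subst nn_integral_cmult) auto
      also have "\<dots> = (\<integral>\<^sup>+v. ennreal (radial n x v) * indicator {v. s \<le> \<bar>v\<bar>} v \<partial>lborel)"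
        by (rule nn_integral_cong) (simp add: dens[symmetric] mult.assoc indicator_def B)
      finally show ?case .
    qed
  qed
  also have "\<dots> = (\<integral>\<^sup>+v. \<integral>\<^sup>+x. ennreal (radial n x v) * indicator {v. s \<le> \<bar>v\<bar>} v \<partial>Leb ?J \<partial>lborel)"
  proof (rule pair_sigma_finite.Fubini')
    show "pair_sigma_finite lborel (Leb ?J)"
      by (intro pair_sigma_finite.intro lborel.sigma_finite_measure_axioms coordinates.sigma_finite) auto
    have "(\<lambda>z. radial n (snd z) (fst z)) \<in> borel_measurable (lborel \<Otimes>\<^sub>M Leb ?J)"
      unfolding radial_def by measurable
    then show "(\<lambda>(v, x). ennreal (radial n x v) * indicator {v. s \<le> \<bar>v\<bar>} v) \<in> borel_measurable (lborel \<Otimes>\<^sub>M Leb ?J)"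
      by (simp add: split_beta')
  qed
  also have "\<dots> = (\<integral>\<^sup>+v. (\<integral>\<^sup>+x. ennreal (radial n x 0) \<partial>Leb ?J) * (ennreal (student_kernel n v) * indicator {v. s \<le> \<bar>v\<bar>} v) \<partial>lborel)"
  proof (rule nn_integral_cong)
    fix v :: real
    have "(\<integral>\<^sup>+x. ennreal (radial n x v) * indicator {v. s \<le> \<bar>v\<bar>} v \<partial>Leb ?J)
        = (\<integral>\<^sup>+x. ennreal (radial n x v) \<partial>Leb ?J) * indicator {v. s \<le> \<bar>v\<bar>} v"
      by (rule nn_integral_multc) measurable
    also have "(\<integral>\<^sup>+x. ennreal (radial n x v) \<partial>Leb ?J) = ennreal (student_kernel n v) * (\<integral>\<^sup>+x. ennreal (radial n x 0) \<partial>Leb ?J)"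
      by (rule nn_integral_radial) (use n in simp)
    finally show "(\<integral>\<^sup>+x. ennreal (radial n x v) * indicator {v. s \<le> \<bar>v\<bar>} v \<partial>Leb ?J)
        = (\<integral>\<^sup>+x. ennreal (radial n x 0) \<partial>Leb ?J) * (ennreal (student_kernel n v) * indicator {v. s \<le> \<bar>v\<bar>} v)"
      by (simp only: mult.assoc mult.left_commute)
  qed
  also have "\<dots> = (\<integral>\<^sup>+x. ennreal (radial n x 0) \<partial>Leb ?J) * (\<integral>\<^sup>+v. ennreal (student_kernel n v) * indicator {v. s \<le> \<bar>v\<bar>} v \<partial>lborel)"
    by (rule nn_integral_cmult) measurable
  finally show ?thesis .
qed

lemma measure_gauss_zero:
  assumes "n > 0"
  shows "measure (gauss n) {x \<in> space (Rn n). \<forall>k<n. x k = 0} = 0"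
proof -
  let ?Z = "{x \<in> space (Rn n). \<forall>k<n. x k = 0}"
  have "AE x in Leb {..<n}. x \<notin> ?Z"
    using AE_component_nonzero[of "{..<n}" 0] assms by auto
  then have "AE x in gauss n. x \<notin> ?Z"
    unfolding gauss_def by (subst AE_density) auto
  then have "emeasure (gauss n) ?Z = 0"
  proof (rule AE_iff_null_sets[THEN iffD2, THEN null_setsD1, rotated])
    show "?Z \<in> sets (gauss n)" unfolding sets_gauss by measurable
  qed
  then show ?thesis by (simp add: measure_def)
qed

definition kernel_tail :: "nat \<Rightarrow> real \<Rightarrow> ennreal" where
  "kernel_tail n s = (\<integral>\<^sup>+v. ennreal (student_kernel n v) * indicator {v. s \<le> \<bar>v\<bar>} v \<partial>lborel)"

lemma emeasure_gauss_cap_0: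
  assumes "3 \<le> n" shows "emeasure (gauss n) (cap n 0) = 1"
proof -
  interpret prob_space "gauss n" by (rule prob_space_gauss)
  have "AE x in Leb {..<n}. x 1 \<noteq> 0"
    by (rule AE_component_nonzero) (use assms in auto)
  moreover have "AE x in Leb {..<n}. x \<in> space (Rn n)"
    using AE_space[of "Leb {..<n}"] by (simp add: space_Leb)
  ultimately have "AE x in Leb {..<n}. x \<in> cap n 0"
  proof eventually_elim
    case (elim x)
    have "(x 1)\<^sup>2 \<le> tail_norm2 n x"
      unfolding tail_norm2_def by (rule member_le_sum) (use assms in auto)
    then have "0 < tail_norm2 n x" using elim by (meson less_le_trans zero_less_power2)
    then show ?case using elim by (simp add: cap_def)
  qed
  then have "AE x in gauss n. x \<in> cap n 0"
    unfolding gauss_def by (subst AE_density) auto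
  then show ?thesis
    using cap_sets[of n 0] assms by (subst emeasure_eq_1_AE) (auto simp: sets_gauss)
qed

text \<open>
  The constant in the preceding formula need not be computed: the case \<open>t = 0\<close> determines it.
\<close>

lemma gauss_cap_ratio:
  assumes n: "3 \<le> n" and t: "0 \<le> t" "t < 1"
  shows "emeasure (gauss n) (cap n t) * kernel_tail n 0 = kernel_tail n (t / sqrt (1 - t\<^sup>2))"
    and "kernel_tail n 0 \<noteq> \<infinity>"
proof -
  define C where "C = (\<integral>\<^sup>+x. ennreal (radial n x 0) \<partial>Leb {2..<n})"
  have one: "C * kernel_tail n 0 = 1"
    using emeasure_gauss_cap[OF n, of 0] emeasure_gauss_cap_0[OF n] by (simp add: C_def kernel_tail_def)
  have "emeasure (gauss n) (cap n t) = C * kernel_tail n (t / sqrt (1 - t\<^sup>2))"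
    using emeasure_gauss_cap[OF n t] by (simp add: C_def kernel_tail_def)
  then show "emeasure (gauss n) (cap n t) * kernel_tail n 0 = kernel_tail n (t / sqrt (1 - t\<^sup>2))"
    using one by (simp only: mult.assoc mult.commute[of "kernel_tail n (t / sqrt (1 - t\<^sup>2))"] mult.left_commute[of C] mult_1_left mult_1_right mult.assoc[symmetric])
  show "kernel_tail n 0 \<noteq> \<infinity>"
  proof
    assume inf: "kernel_tail n 0 = \<infinity>"
    have "C \<noteq> 0" using one by auto
    then show False using one inf by (simp add: ennreal_mult_top)
  qed
qed

section \<open>All spherical vectors have the same correlation law\<close>

lemma pearson_commute: "pearson n x y = pearson n y x"
  unfolding pearson_def by (simp add: mult.commute)

lemma pearson_measurable:
  "(\<lambda>z. pearson n (fst z) (snd z)) \<in> borel_measurable (Rn n \<Otimes>\<^sub>M Rn n)"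
  unfolding pearson_def mean_def by measurable

lemma AE_spread:
  assumes "2 \<le> n" and \<mu>: "rotation_invariant n \<mu>" and "prob_space \<mu>"
    and "measure \<mu> {x \<in> space (Rn n). \<forall>k<n. x k = 0} = 0"
  shows "AE x in \<mu>. spread n x \<noteq> 0"
proof -
  interpret prob_space \<mu> by fact
  note s = rotation_invariant_sets[OF \<mu>]
  have "{x \<in> space (Rn n). spread n x = 0} \<in> sets \<mu>" unfolding s by measurable
  moreover have "emeasure \<mu> {x \<in> space (Rn n). spread n x = 0} = 0"
    using measure_spread_0[OF assms] by (simp add: emeasure_eq_measure)
  ultimately show ?thesis
    by (intro AE_I[where N = "{x \<in> space (Rn n). spread n x = 0}"])
       (auto simp: sets_eq_imp_space_eq[OF s])
qed

text \<open>
  The probability that \<open>x\<close> and an independent Gaussian \<open>y\<close> have a correlation of absolute value at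
  least \<open>t\<close>, where \<open>x\<close> has the law \<open>\<mu>\<close>, is evaluated in both orders of integration. For almost every \<open>x\<close>
  the inner integral is the constant of the Gaussian, for almost every \<open>y\<close> the constant of \<open>\<mu>\<close>.
\<close>

lemma measure_cap_eq_gauss:
  assumes n: "3 \<le> n" and t: "t > 0" and \<mu>: "rotation_invariant n \<mu>" and "prob_space \<mu>"
    and zero: "measure \<mu> {x \<in> space (Rn n). \<forall>k<n. x k = 0} = 0"
  shows "measure \<mu> (cap n t) = measure (gauss n) (cap n t)"
proof -
  interpret \<mu>: prob_space \<mu> by fact
  interpret \<gamma>: prob_space "gauss n" by (rule prob_space_gauss)
  interpret pair_prob_space \<mu> "gauss n" ..
  have n2: "2 \<le> n" "n > 0" using n by auto
  have sets: "sets \<mu> = sets (Rn n)" "sets (gauss n) = sets (Rn n)"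
    by (rule rotation_invariant_sets[OF \<mu>], rule sets_gauss)
  note sp = sets[THEN sets_eq_imp_space_eq]
  have P [measurable]: "(\<lambda>z. pearson n (fst z) (snd z)) \<in> borel_measurable (\<mu> \<Otimes>\<^sub>M gauss n)"
    using pearson_measurable[of n] by (simp cong: measurable_cong_sets add: sets sets_pair_measure_cong[OF sets])
  let ?E = "\<lambda>x y. indicator {y. t \<le> \<bar>pearson n x y\<bar>} y :: ennreal"
  have E: "(\<lambda>(x, y). ?E x y) \<in> borel_measurable (\<mu> \<Otimes>\<^sub>M gauss n)"
  proof -
    have "(\<lambda>z. indicator {z \<in> space (\<mu> \<Otimes>\<^sub>M gauss n). t \<le> \<bar>pearson n (fst z) (snd z)\<bar>} z :: ennreal)
        \<in> borel_measurable (\<mu> \<Otimes>\<^sub>M gauss n)"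
      by measurable
    then show ?thesis
      by (rule measurable_cong[THEN iffD1, rotated]) (auto simp: indicator_def)
  qed
  have slice: "(\<integral>\<^sup>+y. indicator {y. t \<le> \<bar>pearson n x y\<bar>} y \<partial>\<nu>) = ennreal (measure \<nu> (cap n t))"
    if x: "spread n x \<noteq> 0" "x \<in> space (Rn n)" and inv: "rotation_invariant n \<nu>" and prob: "prob_space \<nu>" for x \<nu>
  proof -
    interpret \<nu>: prob_space \<nu> by fact
    note s = rotation_invariant_sets[OF inv]
    let ?A = "{y \<in> space (Rn n). t \<le> \<bar>pearson n x y\<bar>}"
    have "(\<lambda>y. (x, y)) \<in> measurable (Rn n) (Rn n \<Otimes>\<^sub>M Rn n)"
      using x by simp
    from measurable_compose[OF this pearson_measurable]
    have "(\<lambda>y. pearson n x y) \<in> borel_measurable (Rn n)" by simp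
    then have "?A \<in> sets \<nu>" unfolding s by measurable
    have "(\<integral>\<^sup>+y. indicator {y. t \<le> \<bar>pearson n x y\<bar>} y \<partial>\<nu>) = (\<integral>\<^sup>+y. indicator ?A y \<partial>\<nu>)"
      by (rule nn_integral_cong) (simp add: indicator_def sets_eq_imp_space_eq[OF s])
    also have "\<dots> = ennreal (measure \<nu> ?A)"
      using \<open>?A \<in> sets \<nu>\<close> by (simp add: \<nu>.emeasure_eq_measure)
    also have "measure \<nu> ?A = measure \<nu> (cap n t)"
      by (rule measure_pearson_ge[OF n2(1) inv x(1) t])
    finally show ?thesis .
  qed
  have "ennreal (measure (gauss n) (cap n t)) = (\<integral>\<^sup>+x. ennreal (measure (gauss n) (cap n t)) \<partial>\<mu>)"
    by (simp add: \<mu>.emeasure_space_1)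
  also have "\<dots> = (\<integral>\<^sup>+x. \<integral>\<^sup>+y. ?E x y \<partial>gauss n \<partial>\<mu>)"
  proof (rule nn_integral_cong_AE)
    show "AE x in \<mu>. ennreal (measure (gauss n) (cap n t)) = (\<integral>\<^sup>+y. ?E x y \<partial>gauss n)"
      using AE_spread[OF n2(1) \<mu> \<mu>.prob_space_axioms zero] AE_space[of \<mu>]
      by eventually_elim (simp add: slice rotation_invariant_gauss prob_space_gauss sp)
  qed
  also have "\<dots> = (\<integral>\<^sup>+y. \<integral>\<^sup>+x. ?E x y \<partial>\<mu> \<partial>gauss n)"
    by (rule Fubini'[OF E, symmetric])
  also have "\<dots> = (\<integral>\<^sup>+y. ennreal (measure \<mu> (cap n t)) \<partial>gauss n)"
  proof (rule nn_integral_cong_AE)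
    show "AE y in gauss n. (\<integral>\<^sup>+x. ?E x y \<partial>\<mu>) = ennreal (measure \<mu> (cap n t))"
      using AE_spread[OF n2(1) rotation_invariant_gauss prob_space_gauss measure_gauss_zero[OF n2(2)]] AE_space[of "gauss n"]
    proof eventually_elim
      case (elim y)
      have "(\<integral>\<^sup>+x. ?E x y \<partial>\<mu>) = (\<integral>\<^sup>+x. indicator {x. t \<le> \<bar>pearson n y x\<bar>} x \<partial>\<mu>)"
        by (rule nn_integral_cong) (simp add: indicator_def pearson_commute[of n y])
      then show ?case using slice[OF elim(1) _ \<mu> \<mu>.prob_space_axioms] elim(2) by (simp add: sp)
    qed
  qed
  also have "\<dots> = ennreal (measure \<mu> (cap n t))"
    by (simp add: \<gamma>.emeasure_space_1)
  finally show ?thesis by simp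
qed

lemma correlation_relation:
  assumes n: "3 \<le> n" and t: "t > 0" and \<mu>: "rotation_invariant n \<mu>" and "prob_space \<mu>"
    and zero: "measure \<mu> {x \<in> space (Rn n). \<forall>k<n. x k = 0} = 0"
  shows "homogeneous_relation \<mu> (\<lambda>x y. t \<le> \<bar>pearson n x y\<bar>) (measure (gauss n) (cap n t))"
proof -
  interpret prob_space \<mu> by fact
  have n2: "2 \<le> n" using n by simp
  note s = rotation_invariant_sets[OF \<mu>]
  show ?thesis
  proof
    have [measurable]: "(\<lambda>z. pearson n (fst z) (snd z)) \<in> borel_measurable (\<mu> \<Otimes>\<^sub>M \<mu>)"
      using pearson_measurable[of n] by (simp cong: measurable_cong_sets add: s sets_pair_measure_cong[OF s s])
    show "Measurable.pred (\<mu> \<Otimes>\<^sub>M \<mu>) (\<lambda>z. t \<le> \<bar>pearson n (fst z) (snd z)\<bar>)"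
      by measurable
    show "t \<le> \<bar>pearson n y x\<bar>" if "t \<le> \<bar>pearson n x y\<bar>" for x y
      using that by (simp add: pearson_commute[of n y])
    show "AE x in \<mu>. measure \<mu> {y \<in> space \<mu>. t \<le> \<bar>pearson n x y\<bar>} = measure (gauss n) (cap n t)"
      using AE_spread[OF n2 \<mu> prob_space_axioms zero]
      by eventually_elim
         (simp add: measure_pearson_ge[OF n2 \<mu> _ t] sets_eq_imp_space_eq[OF s]
            measure_cap_eq_gauss[OF n t \<mu> prob_space_axioms zero])
  qed
qed

section \<open>Asymptotics of the Student tail\<close>

definition half_tail :: "nat \<Rightarrow> real \<Rightarrow> ennreal" where
  "half_tail n s = (\<integral>\<^sup>+v. ennreal (student_kernel n v) * indicator {s..} v \<partial>lborel)"

lemma kernel_tail_half: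
  assumes "0 \<le> s" shows "kernel_tail n s = 2 * half_tail n s"
proof -
  let ?k = "\<lambda>v. ennreal (student_kernel n v)"
  have "kernel_tail n s = (\<integral>\<^sup>+v. ?k v * indicator {s..} v + ?k v * indicator {..-s} v \<partial>lborel)"
    unfolding kernel_tail_def
  proof (rule nn_integral_cong_AE)
    have "AE v in lborel. v \<noteq> (0::real)" by (rule AE_lborel_singleton)
    then show "AE v in lborel. ?k v * indicator {v. s \<le> \<bar>v\<bar>} v = ?k v * indicator {s..} v + ?k v * indicator {..-s} v"
      by eventually_elim (use assms in \<open>auto simp: indicator_def abs_if\<close>)
  qed
  also have "\<dots> = half_tail n s + (\<integral>\<^sup>+v. ?k v * indicator {..-s} v \<partial>lborel)"
    unfolding half_tail_def by (rule nn_integral_add) measurable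
  also have "(\<integral>\<^sup>+v. ?k v * indicator {..-s} v \<partial>lborel) = (\<integral>\<^sup>+v. ?k (0 + (-1) * v) * indicator {..-s} (0 + (-1) * v) \<partial>lborel)"
    by (subst nn_integral_real_affine[where c = "-1" and t = 0]) auto
  also have "\<dots> = half_tail n s"
    unfolding half_tail_def by (rule nn_integral_cong) (simp add: student_kernel_def indicator_def)
  finally show ?thesis by (simp add: mult_2)
qed

text \<open>
  Differentiating \<open>u\<^bsup>n-3\<^esup> / v\<close>, where \<open>u = 1 / sqrt (1 + v\<^sup>2)\<close> satisfies \<open>u' = - v u\<^sup>3\<close>, gives the
  kernel with a factor that varies only by \<open>1 / v\<^sup>2\<close>, against a main term \<open>n - 2\<close>.
\<close>

lemma kernel_antiderivative:
  assumes n: "3 \<le> n" and v: "v > 0"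
  shows "((\<lambda>v. - ((1 / sqrt (1 + v\<^sup>2)) ^ (n - 3) / v)) has_real_derivative
           student_kernel n v * (real n - 2 + 1 / v\<^sup>2)) (at v)"
proof -
  define u where "u = (\<lambda>v::real. 1 / sqrt (1 + v\<^sup>2))"
  have pos: "1 + x\<^sup>2 > 0" for x :: real by (simp add: add_pos_nonneg)
  have u2: "(u v)\<^sup>2 * (1 + v\<^sup>2) = 1" using pos[of v] by (simp add: u_def power_divide)
  have u3: "inverse (sqrt (1 + v\<^sup>2)) = u v" by (simp add: u_def inverse_eq_divide)
  have du: "(u has_real_derivative - v * u v ^ 3) (at v)"
    unfolding u_def using pos[of v]
    by (auto intro!: derivative_eq_intros simp: power3_eq_cube power2_eq_square field_simps)
  have "((\<lambda>v. - (u v ^ (n - 3) / v)) has_real_derivative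
      - ((real (n - 3) * (- v * u v ^ 3 * u v ^ (n - 3 - 1)) * v - u v ^ (n - 3)) / (v * v))) (at v)"
    using v by (auto intro!: derivative_eq_intros du)
  moreover have "- ((real (n - 3) * (- v * u v ^ 3 * u v ^ (n - 3 - 1)) * v - u v ^ (n - 3)) / (v * v))
      = u v ^ (n - 1) * (real n - 2 + 1 / v\<^sup>2)"
  proof -
    have a: "real (n - 3) * (u v ^ 3 * u v ^ (n - 3 - 1)) = (real n - 3) * u v ^ (n - 1)"
    proof (cases "n = 3")
      case False
      with n have "4 \<le> n" by simp
      then obtain m where m: "n = 4 + m" using le_Suc_ex by blast
      show ?thesis by (simp add: m power_add[symmetric])
    qed simp
    have b: "u v ^ (n - 3) = u v ^ (n - 1) * (1 + v\<^sup>2)"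
    proof -
      have "n - 1 = (n - 3) + 2" using n by simp
      then have "u v ^ (n - 1) * (1 + v\<^sup>2) = u v ^ (n - 3) * ((u v)\<^sup>2 * (1 + v\<^sup>2))"
        by (simp only: power_add mult.assoc)
      then show ?thesis using u2 by simp
    qed
    have "- ((real (n - 3) * (- v * u v ^ 3 * u v ^ (n - 3 - 1)) * v - u v ^ (n - 3)) / (v * v))
       = real (n - 3) * (u v ^ 3 * u v ^ (n - 3 - 1)) + u v ^ (n - 3) / (v * v)"
      using v by (simp add: field_simps)
    also have "\<dots> = u v ^ (n - 1) * (real n - 2 + 1 / v\<^sup>2)"
      unfolding a b using v by (simp add: field_simps power2_eq_square)
    finally show ?thesis .
  qed
  ultimately show ?thesis by (simp add: u_def student_kernel_def)
qed

lemma half_tail_bounds: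
  assumes n: "3 \<le> n" and s: "s > 0"
  defines "G \<equiv> (1 / sqrt (1 + s\<^sup>2)) ^ (n - 3) / s"
  shows "ennreal (real n - 2) * half_tail n s \<le> ennreal G"
    and "ennreal G \<le> ennreal (real n - 2 + 1 / s\<^sup>2) * half_tail n s"
proof -
  have k0: "0 \<le> student_kernel n v" for v by (simp add: student_kernel_def)
  have u1: "0 \<le> 1 / sqrt (1 + v\<^sup>2)" "1 / sqrt (1 + v\<^sup>2) \<le> 1" for v :: real
  proof -
    have "1 \<le> sqrt (1 + v\<^sup>2)" by (rule real_le_rsqrt) simp
    then show "1 / sqrt (1 + v\<^sup>2) \<le> 1" by (subst pos_divide_le_eq) (auto intro: add_pos_nonneg)
    show "0 \<le> 1 / sqrt (1 + v\<^sup>2)" by simp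
  qed
  have "(\<integral>\<^sup>+v. ennreal (student_kernel n v * (real n - 2 + 1 / v\<^sup>2)) * indicator {s..} v \<partial>lborel)
      = ennreal (0 - (- G))"
    unfolding G_def
  proof (rule nn_integral_FTC_atLeast)
    show "((\<lambda>v. - ((1 / sqrt (1 + v\<^sup>2)) ^ (n - 3) / v)) has_real_derivative
           student_kernel n v * (real n - 2 + 1 / v\<^sup>2)) (at v)" if "s \<le> v" for v
      by (rule kernel_antiderivative) (use n s that in auto)
    show "0 \<le> student_kernel n v * (real n - 2 + 1 / v\<^sup>2)" for v
      using n k0 by (intro mult_nonneg_nonneg add_nonneg_nonneg) auto
    have "((\<lambda>v. (1 / sqrt (1 + v\<^sup>2)) ^ (n - 3) / v) \<longlongrightarrow> 0) (at_top :: real filter)"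
    proof (rule tendsto_sandwich)
      show "\<forall>\<^sub>F v in at_top. 0 \<le> (1 / sqrt (1 + v\<^sup>2)) ^ (n - 3) / (v :: real)"
        using eventually_ge_at_top[of 1] by eventually_elim simp
      show "\<forall>\<^sub>F v in at_top. (1 / sqrt (1 + v\<^sup>2)) ^ (n - 3) / v \<le> 1 / (v :: real)"
        using eventually_ge_at_top[of 1]
        by eventually_elim (intro divide_right_mono power_le_one u1, auto)
      show "((\<lambda>v::real. 1 / v) \<longlongrightarrow> 0) at_top"
        using tendsto_inverse_0_at_top[OF filterlim_ident] by (simp add: inverse_eq_divide)
    qed auto
    then show "((\<lambda>v. - ((1 / sqrt (1 + v\<^sup>2)) ^ (n - 3) / v)) \<longlongrightarrow> 0) (at_top :: real filter)"
      using tendsto_minus by fastforce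
  qed measurable
  then have G: "ennreal G = (\<integral>\<^sup>+v. ennreal (student_kernel n v * (real n - 2 + 1 / v\<^sup>2)) * indicator {s..} v \<partial>lborel)"
    by simp
  have "ennreal (real n - 2) * half_tail n s
      = (\<integral>\<^sup>+v. ennreal (real n - 2) * (ennreal (student_kernel n v) * indicator {s..} v) \<partial>lborel)"
    unfolding half_tail_def by (rule nn_integral_cmult[symmetric]) measurable
  also have "\<dots> \<le> ennreal G"
    unfolding G
  proof (rule nn_integral_mono)
    fix v :: real
    have "ennreal (real n - 2) * ennreal (student_kernel n v) \<le> ennreal (student_kernel n v * (real n - 2 + 1 / v\<^sup>2))"
      using n k0 by (subst ennreal_mult[symmetric]) (auto intro!: ennreal_leI simp: mult.commute[of "real n - 2"] intro!: mult_left_mono)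
    then show "ennreal (real n - 2) * (ennreal (student_kernel n v) * indicator {s..} v)
        \<le> ennreal (student_kernel n v * (real n - 2 + 1 / v\<^sup>2)) * indicator {s..} v"
      by (simp add: indicator_def)
  qed
  finally show "ennreal (real n - 2) * half_tail n s \<le> ennreal G" .
  have "ennreal G \<le> (\<integral>\<^sup>+v. ennreal (real n - 2 + 1 / s\<^sup>2) * (ennreal (student_kernel n v) * indicator {s..} v) \<partial>lborel)"
    unfolding G
  proof (rule nn_integral_mono)
    fix v :: real
    have "ennreal (student_kernel n v * (real n - 2 + 1 / v\<^sup>2)) \<le> ennreal (real n - 2 + 1 / s\<^sup>2) * ennreal (student_kernel n v)" if "s \<le> v"
    proof -
      have "1 / v\<^sup>2 \<le> 1 / s\<^sup>2" using that s by (intro divide_left_mono power_mono mult_pos_pos) auto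
      then have "student_kernel n v * (real n - 2 + 1 / v\<^sup>2) \<le> (real n - 2 + 1 / s\<^sup>2) * student_kernel n v"
        using k0 by (subst mult.commute) (auto intro!: mult_right_mono)
      then show ?thesis
        using n k0 by (subst ennreal_mult[symmetric]) (auto intro!: ennreal_leI)
    qed
    then show "ennreal (student_kernel n v * (real n - 2 + 1 / v\<^sup>2)) * indicator {s..} v
        \<le> ennreal (real n - 2 + 1 / s\<^sup>2) * (ennreal (student_kernel n v) * indicator {s..} v)"
      by (simp add: indicator_def)
  qed
  also have "\<dots> = ennreal (real n - 2 + 1 / s\<^sup>2) * half_tail n s"
    unfolding half_tail_def by (rule nn_integral_cmult) measurable
  finally show "ennreal G \<le> ennreal (real n - 2 + 1 / s\<^sup>2) * half_tail n s" .
qed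

text \<open>
  The denominator of the ratio \<open>q\<close>; it is finite for \<open>n \<ge> 3\<close>, where \<open>enn2real\<close> loses nothing.
\<close>

definition half_mass :: "nat \<Rightarrow> real" where
  "half_mass n = enn2real (half_tail n 0)"

lemma half_tail_0: "3 \<le> n \<Longrightarrow> half_tail n 0 = ennreal (half_mass n)"
  using gauss_cap_ratio(2)[of n 0] kernel_tail_half[of 0 n]
  by (auto simp: half_mass_def less_top[symmetric] ennreal_mult_eq_top_iff)

lemma gauss_cap_bounds:
  assumes n: "3 \<le> n" and t: "0 < t" "t < 1"
  defines "q \<equiv> measure (gauss n) (cap n t)" and "s \<equiv> t / sqrt (1 - t\<^sup>2)"
  shows "(real n - 2) * (half_mass n * q) \<le> sqrt (1 - t\<^sup>2) ^ (n - 3) / s"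
    and "sqrt (1 - t\<^sup>2) ^ (n - 3) / s \<le> (real n - 2 + 1 / s\<^sup>2) * (half_mass n * q)"
proof -
  interpret prob_space "gauss n" by (rule prob_space_gauss)
  have t2: "t\<^sup>2 < 1" using t by (simp add: abs_square_less_1)
  have s: "s > 0" using t t2 by (simp add: s_def)
  have "1 + s\<^sup>2 = 1 / (1 - t\<^sup>2)" using t2 by (simp add: s_def power_divide field_simps)
  then have u: "1 / sqrt (1 + s\<^sup>2) = sqrt (1 - t\<^sup>2)" by (simp add: real_sqrt_divide)
  have q0: "0 \<le> q" "0 \<le> half_mass n" by (simp_all add: q_def half_mass_def)
  have "ennreal q * kernel_tail n 0 = kernel_tail n s"
    using gauss_cap_ratio(1)[OF n, of t] t by (simp add: q_def s_def emeasure_eq_measure)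
  then have "2 * (ennreal q * half_tail n 0) = 2 * half_tail n s"
    using s by (simp add: kernel_tail_half mult.left_commute)
  then have "ennreal q * half_tail n 0 = half_tail n s"
    by (simp add: ennreal_mult_cancel_left)
  then have h: "half_tail n s = ennreal (half_mass n * q)"
    using half_tail_0[OF n] q0 by (simp add: ennreal_mult'[symmetric] mult.commute)
  show "(real n - 2) * (half_mass n * q) \<le> sqrt (1 - t\<^sup>2) ^ (n - 3) / s"
    using half_tail_bounds(1)[OF n s] n q0 s t2
    by (simp add: h u ennreal_mult''[symmetric])
  show "sqrt (1 - t\<^sup>2) ^ (n - 3) / s \<le> (real n - 2 + 1 / s\<^sup>2) * (half_mass n * q)"
  proof -
    have c: "0 \<le> real n - 2 + 1 / s\<^sup>2" using n by (intro add_nonneg_nonneg) auto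
    have "ennreal (sqrt (1 - t\<^sup>2) ^ (n - 3) / s) \<le> ennreal ((real n - 2 + 1 / s\<^sup>2) * (half_mass n * q))"
      using half_tail_bounds(2)[OF n s] unfolding h u ennreal_mult'[OF c] .
    then show ?thesis using c q0 by (subst (asm) ennreal_le_iff) auto
  qed
qed

lemma nn_integral_lorentz: "(\<integral>\<^sup>+w. ennreal (1 / (1 + w\<^sup>2 / 2)) * indicator {0..} w \<partial>lborel) < \<infinity>"
proof -
  have "((\<lambda>w. sqrt 2 * arctan (w / sqrt 2)) has_real_derivative 1 / (1 + w\<^sup>2 / 2)) (at w)" for w
  proof -
    have "((\<lambda>w. sqrt 2 * arctan (w / sqrt 2)) has_real_derivative
        sqrt 2 * (inverse (1 + (w / sqrt 2)\<^sup>2) * (1 / sqrt 2))) (at w)"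
      by (auto intro!: derivative_eq_intros)
    then show ?thesis by (simp add: power_divide inverse_eq_divide)
  qed
  moreover have "((\<lambda>w. sqrt 2 * arctan (w / sqrt 2)) \<longlongrightarrow> sqrt 2 * (pi / 2)) at_top"
  proof (intro tendsto_intros)
    have "filterlim (\<lambda>w::real. w / sqrt 2) at_top at_top"
      using filterlim_tendsto_pos_mult_at_top[OF tendsto_const _ filterlim_ident, of "1 / sqrt 2"] by simp
    then show "((\<lambda>w. arctan (w / sqrt 2)) \<longlongrightarrow> pi / 2) at_top"
      by (rule filterlim_compose[OF tendsto_arctan_at_top])
  qed
  ultimately have "(\<integral>\<^sup>+w. ennreal (1 / (1 + w\<^sup>2 / 2)) * indicator {0..} w \<partial>lborel)
      = ennreal (sqrt 2 * (pi / 2) - sqrt 2 * arctan (0 / sqrt 2))"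
    by (intro nn_integral_FTC_atLeast) auto
  then show ?thesis by simp
qed

text \<open>
  The scale is chosen such that the limit is \<open>exp (- w\<^sup>2)\<close>.
\<close>

definition scaled_kernel :: "nat \<Rightarrow> real \<Rightarrow> real" where
  "scaled_kernel n w = student_kernel n (sqrt (2 / real n) * w)"

lemma scaled_kernel_tendsto: "(\<lambda>n. scaled_kernel n w) \<longlonglongrightarrow> exp (- w\<^sup>2)"
proof -
  let ?x = "\<lambda>n. 2 * w\<^sup>2 / real n"
  have "?x \<longlonglongrightarrow> 0"
    by (rule lim_const_over_n)
  then have "(\<lambda>n. sqrt (1 + ?x n) / sqrt ((1 + ?x n) ^ n)) \<longlonglongrightarrow> sqrt (1 + 0) / sqrt (exp (2 * w\<^sup>2))"
    by (intro tendsto_intros tendsto_exp_limit_sequentially) auto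
  moreover have "sqrt (1 + 0) / sqrt (exp (2 * w\<^sup>2)) = exp (- w\<^sup>2)"
  proof -
    have "sqrt (exp (2 * w\<^sup>2)) = exp (w\<^sup>2)"
      by (rule real_sqrt_unique) (simp_all add: exp_double[symmetric])
    then show ?thesis by (simp add: exp_minus inverse_eq_divide)
  qed
  ultimately have "(\<lambda>n. sqrt (1 + ?x n) / sqrt ((1 + ?x n) ^ n)) \<longlonglongrightarrow> exp (- w\<^sup>2)"
    by simp
  moreover have "\<forall>\<^sub>F n in sequentially. sqrt (1 + ?x n) / sqrt ((1 + ?x n) ^ n) = scaled_kernel n w"
    using eventually_ge_at_top[of 1]
  proof eventually_elim
    case (elim n)
    have "1 + ?x n > 0" by (simp add: add_pos_nonneg)
    then have r: "sqrt (1 + ?x n) \<noteq> 0" by simp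
    obtain m where m: "n = Suc m" using elim by (cases n) auto
    have "scaled_kernel n w = (1 / sqrt (1 + ?x n)) ^ (n - 1)"
      by (simp add: scaled_kernel_def student_kernel_def power_mult_distrib)
    also have "\<dots> = sqrt (1 + ?x n) / sqrt ((1 + ?x n) ^ n)"
      using r unfolding real_sqrt_power by (simp add: m power_one_over)
    finally show ?case by simp
  qed
  ultimately show ?thesis by (rule Lim_transform_eventually)
qed

text \<open>
  An integrable majorant that does not depend on \<open>n\<close>, from Bernoulli's inequality with the exponent
  \<open>(n - 1) div 2\<close>.
\<close>

lemma scaled_kernel_le:
  assumes "4 \<le> n" shows "scaled_kernel n w \<le> 1 / (1 + w\<^sup>2 / 2)"
proof -
  define x where "x = 2 * w\<^sup>2 / real n"
  define k where "k = (n - 1) div 2"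
  have x0: "0 \<le> x" by (simp add: x_def)
  have k: "2 * k \<le> n - 1" "real n \<le> 4 * real k"
    using assms by (auto simp: k_def)
  have s1: "1 \<le> sqrt (1 + x)" by (rule real_le_rsqrt) (use x0 in simp)
  have "1 + w\<^sup>2 / 2 \<le> 1 + real k * x"
  proof -
    have "w\<^sup>2 / 2 = (real n / 4) * x" using assms by (simp add: x_def)
    also have "\<dots> \<le> real k * x" using k x0 by (intro mult_right_mono) auto
    finally show ?thesis by simp
  qed
  also have "\<dots> \<le> (1 + x) ^ k" by (rule Bernoulli_inequality) (use x0 in simp)
  also have "\<dots> = sqrt (1 + x) ^ (2 * k)" using x0 by (simp add: power_mult)
  also have "\<dots> \<le> sqrt (1 + x) ^ (n - 1)" by (rule power_increasing[OF k(1) s1])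
  finally have le: "1 + w\<^sup>2 / 2 \<le> sqrt (1 + x) ^ (n - 1)" .
  have "scaled_kernel n w = 1 / sqrt (1 + x) ^ (n - 1)"
    by (simp add: scaled_kernel_def student_kernel_def power_mult_distrib x_def power_one_over)
  also have "\<dots> \<le> 1 / (1 + w\<^sup>2 / 2)"
  proof (rule divide_left_mono[OF le])
    have "0 < 1 + w\<^sup>2 / 2" by (simp add: add_pos_nonneg)
    then show "0 < sqrt (1 + x) ^ (n - 1) * (1 + w\<^sup>2 / 2)"
      using le by (intro mult_pos_pos) auto
  qed simp
  finally show ?thesis .
qed

text \<open>
  After the substitution \<open>v = sqrt (2 / n) * w\<close> the integrand tends to \<open>exp (- w\<^sup>2)\<close>, whose integral over
  the half line is \<open>sqrt pi / 2\<close>. The sequence starts at \<open>n = 4\<close>, from where on the majorant is valid.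
\<close>

lemma half_mass_asymp: "(\<lambda>n. half_mass n * sqrt (real n)) \<longlonglongrightarrow> sqrt (pi / 2)"
proof -
  let ?I = "\<lambda>n. \<integral>\<^sup>+w. ennreal (scaled_kernel (n + 4) w) * indicator {0..} w \<partial>lborel"
  have meas [measurable]: "scaled_kernel n \<in> borel_measurable borel" for n
    unfolding scaled_kernel_def[abs_def] by measurable
  have gauss_int: "(\<integral>\<^sup>+w. ennreal (exp (- w\<^sup>2)) * indicator {0..} w \<partial>lborel) = ennreal (sqrt pi / 2)"
  proof -
    have "(\<integral>\<^sup>+w. ennreal (indicator {0..} w *\<^sub>R exp (- w\<^sup>2)) \<partial>lborel) = ennreal (sqrt pi / 2)"
      using gaussian_moment_0 by (intro nn_integral_eq_integral[THEN trans])
        (auto simp: has_bochner_integral_iff)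
    moreover have "ennreal (indicator {0..} w *\<^sub>R exp (- w\<^sup>2)) = ennreal (exp (- w\<^sup>2)) * indicator {0..} w" for w :: real
      by (simp add: indicator_def)
    ultimately show ?thesis by (simp only:)
  qed
  have "?I \<longlonglongrightarrow> (\<integral>\<^sup>+w. ennreal (exp (- w\<^sup>2)) * indicator {0..} w \<partial>lborel)"
  proof (rule nn_integral_dominated_convergence[where w = "\<lambda>w. ennreal (1 / (1 + w\<^sup>2 / 2)) * indicator {0..} w"])
    show "AE w in lborel. ennreal (scaled_kernel (n + 4) w) * indicator {0..} w
        \<le> ennreal (1 / (1 + w\<^sup>2 / 2)) * indicator {0..} w" for n
      by (intro AE_I2 mult_right_mono ennreal_leI scaled_kernel_le) auto
    show "AE w in lborel. (\<lambda>n. ennreal (scaled_kernel (n + 4) w) * indicator {0..} w)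
        \<longlonglongrightarrow> ennreal (exp (- w\<^sup>2)) * indicator {0..} w"
    proof (rule AE_I2)
      fix w :: real
      have "(\<lambda>n. scaled_kernel (n + 4) w) \<longlonglongrightarrow> exp (- w\<^sup>2)"
        using scaled_kernel_tendsto by (rule LIMSEQ_ignore_initial_segment)
      then show "(\<lambda>n. ennreal (scaled_kernel (n + 4) w) * indicator {0..} w)
        \<longlonglongrightarrow> ennreal (exp (- w\<^sup>2)) * indicator {0..} w"
        by (cases "w \<ge> 0") (auto intro!: tendsto_ennrealI)
    qed
  qed (use nn_integral_lorentz in \<open>auto\<close>)
  then have "?I \<longlonglongrightarrow> ennreal (sqrt pi / 2)" unfolding gauss_int .
  then have lim: "(\<lambda>n. enn2real (?I n)) \<longlonglongrightarrow> sqrt pi / 2"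
    by (rule tendsto_enn2real) simp
  have "enn2real (?I n) * sqrt 2 = half_mass (n + 4) * sqrt (real (n + 4))" for n
  proof -
    let ?N = "n + 4"
    let ?c = "sqrt (2 / real ?N)"
    have c: "?c > 0" by simp
    have "half_tail ?N 0 = ennreal \<bar>?c\<bar> * (\<integral>\<^sup>+w. ennreal (student_kernel ?N (0 + ?c * w)) * indicator {0..} (0 + ?c * w) \<partial>lborel)"
      unfolding half_tail_def by (rule nn_integral_real_affine) (use c in auto)
    also have "(\<integral>\<^sup>+w. ennreal (student_kernel ?N (0 + ?c * w)) * indicator {0..} (0 + ?c * w) \<partial>lborel) = ?I n"
      using c by (intro nn_integral_cong) (auto simp: scaled_kernel_def indicator_def zero_le_mult_iff)
    finally have "half_mass ?N = ?c * enn2real (?I n)"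
      using c by (simp add: half_mass_def enn2real_mult)
    moreover have "?c * sqrt (real ?N) = sqrt 2" by (simp add: real_sqrt_divide)
    ultimately show ?thesis by (simp add: mult.commute mult.left_commute)
  qed
  moreover have "(\<lambda>n. enn2real (?I n) * sqrt 2) \<longlonglongrightarrow> sqrt pi / 2 * sqrt 2"
    by (intro tendsto_intros lim)
  ultimately have "(\<lambda>n. half_mass (n + 4) * sqrt (real (n + 4))) \<longlonglongrightarrow> sqrt pi / 2 * sqrt 2"
    by simp
  then have "(\<lambda>n. half_mass n * sqrt (real n)) \<longlonglongrightarrow> sqrt pi / 2 * sqrt 2"
    by (rule LIMSEQ_offset)
  moreover have "sqrt pi / 2 * sqrt 2 = sqrt (pi / 2)"
  proof -
    have "sqrt 2 * sqrt 2 = (2::real)" by simp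
    then show ?thesis by (simp add: real_sqrt_divide field_simps)
  qed
  ultimately show ?thesis by simp
qed

section \<open>The largest correlation as an edge of the random graph\<close>

lemma max_corr_ge_iff:
  assumes "2 \<le> p"
  shows "t \<le> max_corr n p x \<longleftrightarrow> (\<exists>j<p. \<exists>i<j. t \<le> \<bar>pearson n (x i) (x j)\<bar>)"
proof -
  let ?A = "{\<bar>pearson n (x i) (x j)\<bar> | i j. i < j \<and> j < p}"
  have "?A \<subseteq> (\<lambda>(i, j). \<bar>pearson n (x i) (x j)\<bar>) ` ({..<p} \<times> {..<p})" by auto
  then have "finite ?A" by (rule finite_subset) auto
  moreover have "\<bar>pearson n (x 0) (x 1)\<bar> \<in> ?A"
    using assms by (intro CollectI exI[of _ 0] exI[of _ 1]) auto
  then have "?A \<noteq> {}" by blast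
  ultimately show ?thesis
    unfolding max_corr_def by (subst Max_ge_iff) auto
qed

lemma max_corr_nonneg:
  assumes "2 \<le> p" shows "0 \<le> max_corr n p x"
  unfolding max_corr_ge_iff[OF assms] using assms by (intro exI[of _ 1] conjI exI[of _ 0]) auto

lemma max_corr_measurable:
  assumes p: "2 \<le> p" and X: "\<And>i. i < p \<Longrightarrow> X i \<in> measurable M (Rn n)"
  shows "(\<lambda>\<omega>. max_corr n p (\<lambda>i. X i \<omega>)) \<in> borel_measurable M"
proof (subst borel_measurable_iff_ge, intro allI)
  fix t :: real
  have "{\<omega> \<in> space M. t \<le> \<bar>pearson n (X i \<omega>) (X j \<omega>)\<bar>} \<in> sets M" if "i < j" "j < p" for i j
  proof -
    have "(\<lambda>\<omega>. (X i \<omega>, X j \<omega>)) \<in> measurable M (Rn n \<Otimes>\<^sub>M Rn n)"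
      using X that by simp
    from measurable_compose[OF this pearson_measurable]
    have "(\<lambda>\<omega>. pearson n (X i \<omega>) (X j \<omega>)) \<in> borel_measurable M" by simp
    then show ?thesis by measurable
  qed
  then have "(\<Union>j\<in>{..<p}. \<Union>i\<in>{..<j}. {\<omega> \<in> space M. t \<le> \<bar>pearson n (X i \<omega>) (X j \<omega>)\<bar>}) \<in> sets M"
    by (intro sets.finite_UN) auto
  also have "(\<Union>j\<in>{..<p}. \<Union>i\<in>{..<j}. {\<omega> \<in> space M. t \<le> \<bar>pearson n (X i \<omega>) (X j \<omega>)\<bar>})
      = {\<omega> \<in> space M. t \<le> max_corr n p (\<lambda>i. X i \<omega>)}"
    unfolding max_corr_ge_iff[OF p] by auto
  finally show "{\<omega> \<in> space M. t \<le> max_corr n p (\<lambda>i. X i \<omega>)} \<in> sets M" .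
qed

text \<open>
  The maximum is at least \<open>t\<close> if and only if the correlation graph of the sample has an edge.
\<close>

lemma prob_max_corr_ge:
  assumes M: "prob_space M" and n: "3 \<le> n" and p: "2 \<le> p" and t: "t > 0"
    and indep: "prob_space.indep_vars M (\<lambda>_. Rn n) X {..<p}"
    and common: "\<And>i j. i < p \<Longrightarrow> j < p \<Longrightarrow> distr M (Rn n) (X i) = distr M (Rn n) (X j)"
    and sph: "\<And>i. i < p \<Longrightarrow> spherical n M (X i)"
    and nonzero: "measure M {\<omega> \<in> space M. \<forall>k<n. X 0 \<omega> k = 0} = 0"
  defines "D \<equiv> distr M (Rn n) (X 0)" and "R \<equiv> \<lambda>x y. t \<le> \<bar>pearson n x y\<bar>"
  shows "homogeneous_relation D R (measure (gauss n) (cap n t))"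
    and "measure M {\<omega> \<in> space M. t \<le> max_corr n p (\<lambda>i. X i \<omega>)} = 1 - homogeneous_relation.avoidance D R p"
proof -
  interpret prob_space M by (rule M)
  have p0: "0 < p" using p by simp
  have X: "X i \<in> measurable M (Rn n)" if "i < p" for i
    using sph[OF that] by (simp add: spherical_def)
  have D: "prob_space D" unfolding D_def by (rule prob_space_distr[OF X[OF p0]])
  have "{x \<in> space (Rn n). \<forall>k<n. x k = 0} \<in> sets (Rn n)" by measurable
  then have "measure D {x \<in> space (Rn n). \<forall>k<n. x k = 0} = measure M (X 0 -` {x \<in> space (Rn n). \<forall>k<n. x k = 0} \<inter> space M)"
    unfolding D_def by (rule measure_distr[OF X[OF p0]])
  also have "X 0 -` {x \<in> space (Rn n). \<forall>k<n. x k = 0} \<inter> space M = {\<omega> \<in> space M. \<forall>k<n. X 0 \<omega> k = 0}"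
    using measurable_space[OF X[OF p0]] by auto
  finally have zero: "measure D {x \<in> space (Rn n). \<forall>k<n. x k = 0} = 0"
    using nonzero by simp
  show hom: "homogeneous_relation D R (measure (gauss n) (cap n t))"
    unfolding R_def using spherical_rotation_invariant[OF sph[OF p0]] D zero
    by (intro correlation_relation[OF n t]) (simp_all add: D_def)
  interpret H: homogeneous_relation D R "measure (gauss n) (cap n t)" by (rule hom)
  let ?X = "\<lambda>\<omega>. \<lambda>i\<in>{..<p}. X i \<omega>"
  have sets_sample: "sets (H.sample {..<p}) = sets (PiM {..<p} (\<lambda>_. Rn n))"
    by (rule sets_PiM_cong) (simp_all add: D_def)
  have Xm: "?X \<in> measurable M (PiM {..<p} (\<lambda>_. Rn n))"
    using X by (intro measurable_restrict) auto
  have "distr M (PiM {..<p} (\<lambda>_. Rn n)) ?X = PiM {..<p} (\<lambda>i. distr M (Rn n) (X i))"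
  proof (rule indep_vars_iff_distr_eq_PiM'[THEN iffD1, OF _ _ indep])
    show "{..<p} \<noteq> {}" using p0 by blast
  qed (use X in auto)
  also have "\<dots> = H.sample {..<p}"
  proof (rule PiM_cong[OF refl])
    fix i assume "i \<in> {..<p}"
    then show "distr M (Rn n) (X i) = D" unfolding D_def by (intro common p0) simp
  qed
  finally have joint: "distr M (PiM {..<p} (\<lambda>_. Rn n)) ?X = H.sample {..<p}" .
  have E: "{x \<in> space (H.sample {..<p}). H.avoid p x} \<in> sets (PiM {..<p} (\<lambda>_. Rn n))"
    using H.pred_avoid[of p "{..<p}"] unfolding sets_sample[symmetric] by (simp add: pred_def)
  have avoid: "H.avoid p (?X \<omega>) \<longleftrightarrow> \<not> t \<le> max_corr n p (\<lambda>i. X i \<omega>)" for \<omega>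
    unfolding max_corr_ge_iff[OF p] H.avoid_def by (auto simp: R_def)
  have "H.avoidance p = measure (distr M (PiM {..<p} (\<lambda>_. Rn n)) ?X) {x \<in> space (H.sample {..<p}). H.avoid p x}"
    by (simp add: H.avoidance_def joint)
  also have "\<dots> = measure M (?X -` {x \<in> space (H.sample {..<p}). H.avoid p x} \<inter> space M)"
    by (rule measure_distr[OF Xm E])
  also have "?X -` {x \<in> space (H.sample {..<p}). H.avoid p x} \<inter> space M
      = space M - {\<omega> \<in> space M. t \<le> max_corr n p (\<lambda>i. X i \<omega>)}"
    using measurable_space[OF Xm] sets_eq_imp_space_eq[OF sets_sample] avoid by auto
  also have "measure M \<dots> = 1 - measure M {\<omega> \<in> space M. t \<le> max_corr n p (\<lambda>i. X i \<omega>)}"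
    by (rule prob_compl) (use max_corr_measurable[OF p X] in measurable)
  finally show "measure M {\<omega> \<in> space M. t \<le> max_corr n p (\<lambda>i. X i \<omega>)} = 1 - homogeneous_relation.avoidance D R p"
    by simp
qed

section \<open>The expected number of exceedances\<close>

text \<open>
  The value of \<open>log (1 - L\<^sup>2)\<close> at which the normalized statistic equals \<open>y\<close>, where \<open>l\<close> is \<open>log p\<close>.
\<close>

definition log_level :: "nat \<Rightarrow> real \<Rightarrow> real \<Rightarrow> real" where
  "log_level n l y = (y - 4 * l + ln l) / real n"

definition threshold :: "nat \<Rightarrow> real \<Rightarrow> real \<Rightarrow> real" where
  "threshold n l y = sqrt (1 - exp (log_level n l y))"

lemma exponent_tendsto_at_top:
  fixes l :: "nat \<Rightarrow> real"
  assumes "\<beta> > 0" "(\<lambda>n. l n / real n) \<longlonglongrightarrow> \<beta>"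
  shows "filterlim l at_top sequentially"
proof -
  have "filterlim (\<lambda>n. l n / real n * real n) at_top sequentially"
    by (rule filterlim_tendsto_pos_mult_at_top[OF assms(2,1) filterlim_real_sequentially])
  moreover have "\<forall>\<^sub>F n in sequentially. l n / real n * real n = l n"
    using eventually_gt_at_top[of 0] by eventually_elim simp
  ultimately show ?thesis by (rule filterlim_cong[THEN iffD1, OF refl refl, rotated])
qed

lemma log_level_tendsto:
  fixes l :: "nat \<Rightarrow> real"
  assumes "\<beta> > 0" "(\<lambda>n. l n / real n) \<longlonglongrightarrow> \<beta>"
  shows "(\<lambda>n. log_level n (l n) y) \<longlonglongrightarrow> - 4 * \<beta>"
proof -
  note l = exponent_tendsto_at_top[OF assms]
  have "(\<lambda>n. ln (l n) / l n * (l n / real n)) \<longlonglongrightarrow> 0 * \<beta>"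
    by (intro tendsto_mult assms filterlim_compose[OF ln_x_over_x_tendsto_0 l])
  moreover have "\<forall>\<^sub>F n in sequentially. ln (l n) / l n * (l n / real n) = ln (l n) / real n"
    using eventually_compose_filterlim[OF eventually_gt_at_top[of 0] l] by eventually_elim simp
  ultimately have "(\<lambda>n. ln (l n) / real n) \<longlonglongrightarrow> 0 * \<beta>"
    by (rule Lim_transform_eventually)
  then have "(\<lambda>n. y / real n - 4 * (l n / real n) + ln (l n) / real n) \<longlonglongrightarrow> 0 - 4 * \<beta> + 0 * \<beta>"
    by (intro tendsto_intros assms lim_const_over_n)
  then show ?thesis
    by (simp add: log_level_def diff_divide_distrib add_divide_distrib)
qed

lemma threshold_tendsto:
  fixes l :: "nat \<Rightarrow> real"
  assumes "\<beta> > 0" "(\<lambda>n. l n / real n) \<longlonglongrightarrow> \<beta>"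
  shows "(\<lambda>n. threshold n (l n) y) \<longlonglongrightarrow> sqrt (1 - exp (- 4 * \<beta>))"
  unfolding threshold_def by (intro tendsto_intros log_level_tendsto[OF assms])

lemma log_level_neg:
  fixes l :: "nat \<Rightarrow> real"
  assumes "\<beta> > 0" "(\<lambda>n. l n / real n) \<longlonglongrightarrow> \<beta>"
  shows "\<forall>\<^sub>F n in sequentially. log_level n (l n) y < 0"
  by (rule order_tendstoD(2)[OF log_level_tendsto[OF assms]]) (use assms in simp)

lemma threshold_bounds:
  assumes "log_level n l y < 0"
  shows "0 < threshold n l y" "threshold n l y < 1" "sqrt (1 - (threshold n l y)\<^sup>2) = exp (log_level n l y / 2)"
proof -
  have e: "0 < exp (log_level n l y)" "exp (log_level n l y) < 1" using assms by auto
  then show "0 < threshold n l y" "threshold n l y < 1" by (simp_all add: threshold_def)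
  have "sqrt (exp (log_level n l y)) = exp (log_level n l y / 2)"
    by (rule real_sqrt_unique) (simp_all add: exp_double[symmetric])
  then show "sqrt (1 - (threshold n l y)\<^sup>2) = exp (log_level n l y / 2)"
    using e by (simp add: threshold_def)
qed

text \<open>
  By the choice of the threshold, \<open>p\<^sup>2 sqrt (1 - t\<^sup>2)\<^bsup>n-3\<^esup>\<close> is \<open>sqrt (log p)\<close> times a factor that
  converges; \<open>sqrt (log p / n)\<close> tends to \<open>sqrt \<beta>\<close>, and the remaining power of \<open>n\<close> is absorbed by the asymptotics
  of the half mass.
\<close>

lemma expected_exceedances_tendsto:
  fixes p :: "nat \<Rightarrow> nat"
  assumes beta: "\<beta> > 0" "(\<lambda>n. ln (real (p n)) / real n) \<longlonglongrightarrow> \<beta>"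
  shows "(\<lambda>n. (real (p n))\<^sup>2 * measure (gauss n) (cap n (threshold n (ln (real (p n))) y)) / 2)
           \<longlonglongrightarrow> K \<beta> * exp ((y + 8 * \<beta>) / 2)"
proof -
  define l where "l n = ln (real (p n))" for n
  define \<tau> where "\<tau> n = log_level n (l n) y" for n
  define t where "t n = threshold n (l n) y" for n
  define s where "s n = t n / sqrt (1 - (t n)\<^sup>2)" for n
  define q where "q n = measure (gauss n) (cap n (t n))" for n
  \<comment> \<open>the common main term of the lower and the upper bound for \<open>p\<^sup>2 q / 2\<close>\<close>
  define h where "h n = exp (y / 2) / 2 * (sqrt (l n / real n) * exp (- 3 * \<tau> n / 2) / s n / (half_mass n * sqrt (real n)))" for n
  define w where "w = sqrt (1 - exp (- 4 * \<beta>))"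
  have w: "w > 0" unfolding w_def using beta by simp
  have l: "(\<lambda>n. l n / real n) \<longlonglongrightarrow> \<beta>" using beta by (simp add: l_def)
  note l_top = exponent_tendsto_at_top[OF beta(1) l]
  have tau: "\<tau> \<longlonglongrightarrow> - 4 * \<beta>" unfolding \<tau>_def by (rule log_level_tendsto[OF beta(1) l])
  have neg: "\<forall>\<^sub>F n in sequentially. \<tau> n < 0" unfolding \<tau>_def by (rule log_level_neg[OF beta(1) l])
  have "(\<lambda>n. t n / exp (\<tau> n / 2)) \<longlonglongrightarrow> w / exp (- 4 * \<beta> / 2)"
    unfolding w_def t_def by (intro tendsto_intros threshold_tendsto[OF beta(1) l] tau) auto
  moreover have "\<forall>\<^sub>F n in sequentially. t n / exp (\<tau> n / 2) = s n"
    using neg by eventually_elim (simp add: s_def t_def \<tau>_def threshold_bounds)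
  ultimately have s: "s \<longlonglongrightarrow> w / exp (- 4 * \<beta> / 2)" by (rule Lim_transform_eventually)
  have s_inf: "w / exp (- 4 * \<beta> / 2) \<noteq> 0" using w by simp
  have "h \<longlonglongrightarrow> exp (y / 2) / 2 * (sqrt \<beta> * exp (- 3 * (- 4 * \<beta>) / 2) / (w / exp (- 4 * \<beta> / 2)) / sqrt (pi / 2))"
    unfolding h_def by (intro tendsto_intros l tau s half_mass_asymp s_inf) auto
  also have "exp (y / 2) / 2 * (sqrt \<beta> * exp (- 3 * (- 4 * \<beta>) / 2) / (w / exp (- 4 * \<beta> / 2)) / sqrt (pi / 2))
      = K \<beta> * exp ((y + 8 * \<beta>) / 2)"
  proof -
    have "exp ((y + 8 * \<beta>) / 2) = exp (y / 2) * (exp (6 * \<beta>) * exp (- 2 * \<beta>))"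
      by (simp add: exp_add[symmetric] add_divide_distrib)
    moreover have "K \<beta> = sqrt \<beta> / (sqrt (2 * pi) * w)"
      by (simp add: K_def w_def real_sqrt_divide real_sqrt_mult)
    moreover have "2 * sqrt (pi / 2) = sqrt (2 * pi)"
      by (rule real_sqrt_unique[symmetric]) (auto simp: power_mult_distrib)
    moreover have "exp (- 3 * (- 4 * \<beta>) / 2) = exp (6 * \<beta>)" "exp (- 4 * \<beta> / 2) = exp (- 2 * \<beta>)" by simp_all
    ultimately show ?thesis using w by (simp add: field_simps)
  qed
  finally have h: "h \<longlonglongrightarrow> K \<beta> * exp ((y + 8 * \<beta>) / 2)" .
  have ratio: "(\<lambda>n. h n * (1 / (1 + (c n - 2) * (1 / real n)))) \<longlonglongrightarrow> K \<beta> * exp ((y + 8 * \<beta>) / 2)"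
    if "c \<longlonglongrightarrow> d" for c :: "nat \<Rightarrow> real" and d
  proof -
    have "(\<lambda>n. h n * (1 / (1 + (c n - 2) * (1 / real n)))) \<longlonglongrightarrow> K \<beta> * exp ((y + 8 * \<beta>) / 2) * (1 / (1 + (d - 2) * 0))"
      by (intro tendsto_intros h that lim_1_over_n) auto
    then show ?thesis by simp
  qed
  have "(\<lambda>n. half_mass n * sqrt (real n)) \<longlonglongrightarrow> sqrt (pi / 2)" by (rule half_mass_asymp)
  then have "\<forall>\<^sub>F n in sequentially. 0 < half_mass n * sqrt (real n)"
    by (rule order_tendstoD) simp
  moreover have "\<forall>\<^sub>F n in sequentially. 1 \<le> l n"
    using eventually_compose_filterlim[OF eventually_ge_at_top[of 1] l_top] .
  ultimately have ev: "\<forall>\<^sub>F n in sequentially. 3 \<le> n \<and> \<tau> n < 0 \<and> 0 < half_mass n \<and> 1 \<le> l n"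
    using neg eventually_ge_at_top[of 3]
    by eventually_elim (auto simp: zero_less_mult_iff)
  \<comment> \<open>\<open>c = 1 / s\<^sup>2\<close> gives the lower bound, \<open>c = 0\<close> the upper bound\<close>
  have key: "(real (p n))\<^sup>2 / 2 * (exp (\<tau> n / 2) ^ (n - 3) / s n / (real n - 2 + c)) / half_mass n
      = h n * (1 / (1 + (c - 2) * (1 / real n)))"
    if n: "3 \<le> n" and m: "0 < half_mass n" and ln: "1 \<le> l n" for n c
  proof -
    have "p n \<noteq> 0" using ln by (cases "p n = 0") (simp_all add: l_def)
    then have p: "(real (p n))\<^sup>2 = exp (2 * l n)"
      by (simp add: l_def exp_double)
    have "exp (\<tau> n / 2) ^ (n - 3) = exp (real (n - 3) * (\<tau> n / 2))"
      by (rule exp_of_nat_mult[symmetric])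
    also have "real (n - 3) * (\<tau> n / 2) = y / 2 - 2 * l n + ln (l n) / 2 - 3 * \<tau> n / 2"
      using n by (simp add: \<tau>_def log_level_def field_simps of_nat_diff)
    also have "exp \<dots> = exp (y / 2) * exp (ln (l n) / 2) * exp (- 3 * \<tau> n / 2) / exp (2 * l n)"
      by (simp add: exp_add[symmetric] exp_diff[symmetric] algebra_simps)
    also have "exp (ln (l n) / 2) = sqrt (l n)"
      by (rule real_sqrt_unique[symmetric]) (use ln in \<open>simp_all add: exp_double[symmetric]\<close>)
    also have "sqrt (l n) = sqrt (l n / real n) * sqrt (real n)"
      using n by (simp add: real_sqrt_divide)
    finally have E: "exp (\<tau> n / 2) ^ (n - 3)
        = exp (y / 2) * (sqrt (l n / real n) * sqrt (real n)) * exp (- 3 * \<tau> n / 2) / exp (2 * l n)" .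
    have e: "(real (p n))\<^sup>2 * exp (\<tau> n / 2) ^ (n - 3) = exp (y / 2) * (sqrt (l n / real n) * sqrt (real n)) * exp (- 3 * \<tau> n / 2)"
    proof -
      have "a * (b / a) = b" if "a \<noteq> 0" for a b :: real using that by simp
      from this[OF exp_not_eq_zero] show ?thesis unfolding p E .
    qed
    have r: "sqrt (real n) / (real n - 2 + c) = 1 / (1 + (c - 2) * (1 / real n)) / sqrt (real n)"
    proof -
      have "1 + (a - 2) * (1 / b) = (b - 2 + a) / b" if "b \<noteq> 0" for a b :: real
        using that by (simp add: field_simps)
      note B = this[of "real n" c]
      have g: "1 / (a / b) / d = b / d / a" for a b d :: real
        by (simp add: mult_ac)
      have d: "real n / sqrt (real n) = sqrt (real n)" by (rule real_div_sqrt) simp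
      have "real n \<noteq> 0" using n by simp
      then show ?thesis unfolding B[OF \<open>real n \<noteq> 0\<close>] g[of "real n - 2 + c"] d by (intro refl)
    qed
    have "(real (p n))\<^sup>2 / 2 * (exp (\<tau> n / 2) ^ (n - 3) / s n / (real n - 2 + c)) / half_mass n
        = ((real (p n))\<^sup>2 * exp (\<tau> n / 2) ^ (n - 3)) / 2 / s n / half_mass n / (real n - 2 + c)"
    proof -
      have "a / 2 * (b / u / r) / m = (a * b) / 2 / u / m / r" for a b u m r :: real
        by (simp add: mult_ac)
      then show ?thesis .
    qed
    also have "\<dots> = exp (y / 2) / 2 * (sqrt (l n / real n) * exp (- 3 * \<tau> n / 2) / s n / half_mass n) * (sqrt (real n) / (real n - 2 + c))"
    proof -
      have "a * (b * d) * x / 2 / u / m / r = a / 2 * (b * x / u / m) * (d / r)" for a b d x u m r :: real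
        by (simp add: mult_ac)
      then show ?thesis unfolding e .
    qed
    also have "\<dots> = h n * (1 / (1 + (c - 2) * (1 / real n)))"
    proof -
      have "a * (b / m) * (v / u) = a * (b / (m * u)) * v" for a b m u v :: real
        by (simp add: mult_ac)
      then show ?thesis unfolding r h_def .
    qed
    finally show ?thesis .
  qed
  have "(\<lambda>n. (real (p n))\<^sup>2 * q n / 2) \<longlonglongrightarrow> K \<beta> * exp ((y + 8 * \<beta>) / 2)"
  proof (rule tendsto_sandwich)
    show "\<forall>\<^sub>F n in sequentially. h n * (1 / (1 + (1 / (s n)\<^sup>2 - 2) * (1 / real n))) \<le> (real (p n))\<^sup>2 * q n / 2"
      using ev
    proof eventually_elim
      case (elim n)
      note b = threshold_bounds[OF elim[THEN conjunct2, THEN conjunct1, unfolded \<tau>_def], folded t_def \<tau>_def]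
      have c: "0 < real n - 2 + 1 / (s n)\<^sup>2" using elim by (intro add_pos_nonneg) auto
      have "exp (\<tau> n / 2) ^ (n - 3) / s n \<le> (real n - 2 + 1 / (s n)\<^sup>2) * (half_mass n * q n)"
        using gauss_cap_bounds(2)[OF _ b(1,2), of n] elim b(3) by (simp add: s_def q_def)
      then have "exp (\<tau> n / 2) ^ (n - 3) / s n / (real n - 2 + 1 / (s n)\<^sup>2) \<le> half_mass n * q n"
        using c by (subst pos_divide_le_eq) (auto simp: mult.commute)
      then have "(real (p n))\<^sup>2 / 2 * (exp (\<tau> n / 2) ^ (n - 3) / s n / (real n - 2 + 1 / (s n)\<^sup>2)) / half_mass n
          \<le> (real (p n))\<^sup>2 / 2 * (half_mass n * q n) / half_mass n"
        using elim by (intro divide_right_mono mult_left_mono) auto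
      also have "\<dots> = (real (p n))\<^sup>2 * q n / 2" using elim by simp
      finally show ?case unfolding key[OF elim[THEN conjunct1] elim[THEN conjunct2, THEN conjunct2, THEN conjunct1]
          elim[THEN conjunct2, THEN conjunct2, THEN conjunct2]] .
    qed
    show "\<forall>\<^sub>F n in sequentially. (real (p n))\<^sup>2 * q n / 2 \<le> h n * (1 / (1 + (0 - 2) * (1 / real n)))"
      using ev
    proof eventually_elim
      case (elim n)
      note b = threshold_bounds[OF elim[THEN conjunct2, THEN conjunct1, unfolded \<tau>_def], folded t_def \<tau>_def]
      have "(real n - 2) * (half_mass n * q n) \<le> exp (\<tau> n / 2) ^ (n - 3) / s n"
        using gauss_cap_bounds(1)[OF _ b(1,2), of n] elim b(3) by (simp add: s_def q_def)
      then have "half_mass n * q n \<le> exp (\<tau> n / 2) ^ (n - 3) / s n / (real n - 2 + 0)"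
        using elim by (subst pos_le_divide_eq) (auto simp: mult.commute)
      then have "(real (p n))\<^sup>2 / 2 * (half_mass n * q n) / half_mass n
          \<le> (real (p n))\<^sup>2 / 2 * (exp (\<tau> n / 2) ^ (n - 3) / s n / (real n - 2 + 0)) / half_mass n"
        using elim by (intro divide_right_mono mult_left_mono) auto
      moreover have "(real (p n))\<^sup>2 / 2 * (half_mass n * q n) / half_mass n = (real (p n))\<^sup>2 * q n / 2"
        using elim by simp
      ultimately show ?case
        unfolding key[OF elim[THEN conjunct1] elim[THEN conjunct2, THEN conjunct2, THEN conjunct1]
          elim[THEN conjunct2, THEN conjunct2, THEN conjunct2]] by (simp only:)
    qed
    have "(\<lambda>n. 1 / (s n)\<^sup>2) \<longlonglongrightarrow> 1 / (w / exp (- 4 * \<beta> / 2))\<^sup>2"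
      by (intro tendsto_intros s) (use s_inf in auto)
    then show "(\<lambda>n. h n * (1 / (1 + (1 / (s n)\<^sup>2 - 2) * (1 / real n)))) \<longlonglongrightarrow> K \<beta> * exp ((y + 8 * \<beta>) / 2)"
      by (rule ratio)
    show "(\<lambda>n. h n * (1 / (1 + (0 - 2) * (1 / real n)))) \<longlonglongrightarrow> K \<beta> * exp ((y + 8 * \<beta>) / 2)"
      by (rule ratio) (rule tendsto_const)
  qed
  then show ?thesis by (simp add: q_def t_def l_def)
qed

section \<open>The limit theorem\<close>

lemma K_pos:
  assumes "\<beta> > 0" shows "K \<beta> > 0"
proof -
  have "0 < 2 * pi * (1 - exp (- 4 * \<beta>))" using assms by (intro mult_pos_pos) auto
  then show ?thesis using assms by (simp add: K_def)
qed

lemma limit_cdf_mono: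
  assumes "\<beta> > 0" "x \<le> y" shows "limit_cdf \<beta> x \<le> limit_cdf \<beta> y"
  using K_pos[OF assms(1)] assms(2) by (simp add: limit_cdf_def)

lemma limit_cdf_at_bot: "(limit_cdf \<beta> \<longlongrightarrow> 0) at_bot"
proof -
  have "filterlim (\<lambda>y. (y + 8 * \<beta>) / 2) at_bot at_bot"
    unfolding filterlim_at_bot
  proof
    fix Z :: real
    show "\<forall>\<^sub>F y in at_bot. (y + 8 * \<beta>) / 2 \<le> Z"
      using eventually_le_at_bot[of "2 * Z - 8 * \<beta>"] by eventually_elim simp
  qed
  then have "((\<lambda>y. exp ((y + 8 * \<beta>) / 2)) \<longlongrightarrow> 0) at_bot"
    by (rule filterlim_compose[OF exp_at_bot])
  then have "((\<lambda>y. 1 - exp (- (K \<beta> * exp ((y + 8 * \<beta>) / 2)))) \<longlongrightarrow> 1 - exp (- (K \<beta> * 0))) at_bot"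
    by (intro tendsto_intros)
  then show ?thesis by (simp add: limit_cdf_def[abs_def])
qed

lemma limit_cdf_at_top:
  assumes "\<beta> > 0" shows "(limit_cdf \<beta> \<longlongrightarrow> 1) at_top"
proof -
  have "filterlim (\<lambda>y. (y + 8 * \<beta>) / 2) at_top at_top"
    unfolding filterlim_at_top
  proof
    fix Z :: real
    show "\<forall>\<^sub>F y in at_top. Z \<le> (y + 8 * \<beta>) / 2"
      using eventually_ge_at_top[of "2 * Z - 8 * \<beta>"] by eventually_elim simp
  qed
  then have "filterlim (\<lambda>y. exp ((y + 8 * \<beta>) / 2)) at_top at_top"
    by (rule filterlim_compose[OF exp_at_top])
  then have "filterlim (\<lambda>y. K \<beta> * exp ((y + 8 * \<beta>) / 2)) at_top at_top"
    by (rule filterlim_tendsto_pos_mult_at_top[OF tendsto_const K_pos[OF assms]])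
  then have "filterlim (\<lambda>y. - (K \<beta> * exp ((y + 8 * \<beta>) / 2))) at_bot at_top"
    by (simp add: filterlim_uminus_at_bot)
  then have "((\<lambda>y. exp (- (K \<beta> * exp ((y + 8 * \<beta>) / 2)))) \<longlongrightarrow> 0) at_top"
    by (rule filterlim_compose[OF exp_at_bot])
  then have "((\<lambda>y. 1 - exp (- (K \<beta> * exp ((y + 8 * \<beta>) / 2)))) \<longlongrightarrow> 1 - 0) at_top"
    by (intro tendsto_intros)
  then show ?thesis by (simp add: limit_cdf_def[abs_def])
qed

lemma limit_cdf_real_distribution:
  assumes "\<beta> > 0"
  shows "real_distribution (interval_measure (limit_cdf \<beta>))"
    and "cdf (interval_measure (limit_cdf \<beta>)) = limit_cdf \<beta>"
proof -
  have cont: "continuous (at_right a) (limit_cdf \<beta>)" for a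
    unfolding limit_cdf_def[abs_def] by (intro continuous_intros) simp
  show "real_distribution (interval_measure (limit_cdf \<beta>))"
    by (rule real_distribution_interval_measure)
       (rule limit_cdf_mono[OF assms] cont limit_cdf_at_bot limit_cdf_at_top[OF assms], assumption?)+
  show "cdf (interval_measure (limit_cdf \<beta>)) = limit_cdf \<beta>"
    by (rule cdf_interval_measure) (rule limit_cdf_mono[OF assms] cont limit_cdf_at_bot, assumption?)+
qed

text \<open>
  The case \<open>L = 1\<close> has to be excluded, as the logarithm of 0 is 0 by convention.
\<close>

lemma normalized_le_iff:
  assumes n: "n > 0" and L: "0 \<le> L" "L < 1"
  shows "real n * ln (1 - L\<^sup>2) + 4 * l - ln l \<le> y \<longleftrightarrow> threshold n l y \<le> L"
proof -
  have L2: "1 - L\<^sup>2 > 0" using L by (simp add: abs_square_less_1)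
  have "real n * ln (1 - L\<^sup>2) + 4 * l - ln l \<le> y \<longleftrightarrow> ln (1 - L\<^sup>2) \<le> log_level n l y"
  proof -
    have "ln (1 - L\<^sup>2) \<le> log_level n l y \<longleftrightarrow> ln (1 - L\<^sup>2) * real n \<le> y - 4 * l + ln l"
      unfolding log_level_def by (rule pos_le_divide_eq) (use n in simp)
    then show ?thesis by (auto simp: mult.commute)
  qed
  also have "\<dots> \<longleftrightarrow> 1 - L\<^sup>2 \<le> exp (log_level n l y)"
    using exp_le_cancel_iff[of "ln (1 - L\<^sup>2)" "log_level n l y"] L2 by (simp only: exp_ln)
  also have "\<dots> \<longleftrightarrow> 1 - exp (log_level n l y) \<le> L\<^sup>2" by auto
  also have "\<dots> \<longleftrightarrow> threshold n l y \<le> L"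
    unfolding threshold_def
  proof
    show "sqrt (1 - exp (log_level n l y)) \<le> L" if "1 - exp (log_level n l y) \<le> L\<^sup>2"
      by (rule real_le_lsqrt[OF L(1) that])
  qed (rule sqrt_le_D)
  finally show ?thesis .
qed

theorem theorem2:
  fixes M :: "nat \<Rightarrow> 'a measure"
    and X :: "nat \<Rightarrow> nat \<Rightarrow> 'a \<Rightarrow> nat \<Rightarrow> real"
    and p :: "nat \<Rightarrow> nat"
    and \<beta> :: real
    and L T :: "nat \<Rightarrow> 'a \<Rightarrow> real"
  assumes beta: "\<beta> > 0" "(\<lambda>n. ln (real (p n)) / real n) \<longlonglongrightarrow> \<beta>"
    and prob: "\<And>n. n \<ge> 2 \<Longrightarrow> prob_space (M n)"
    and indep: "\<And>n. n \<ge> 2 \<Longrightarrow> prob_space.indep_vars (M n) (\<lambda>_. Rn n) (X n) {..<p n}"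
    and common: "\<And>n i j. n \<ge> 2 \<Longrightarrow> i < p n \<Longrightarrow> j < p n \<Longrightarrow>
                   distr (M n) (Rn n) (X n i) = distr (M n) (Rn n) (X n j)"
    and spherical: "\<And>n i. n \<ge> 2 \<Longrightarrow> i < p n \<Longrightarrow> spherical n (M n) (X n i)"
    and nonzero: "\<And>n i. n \<ge> 2 \<Longrightarrow> i < p n \<Longrightarrow>
                    measure (M n) {\<omega> \<in> space (M n). \<forall>k<n. X n i \<omega> k = 0} = 0"
  defines "L \<equiv> \<lambda>n \<omega>. max_corr n (p n) (\<lambda>i. X n i \<omega>)"
    and "T \<equiv> \<lambda>n \<omega>. ln (1 - (L n \<omega>)\<^sup>2)"
  shows "tendsto_in_prob M L (sqrt (1 - exp (- 4 * \<beta>))) \<and>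
         (\<exists>N. real_distribution N \<and> cdf N = limit_cdf \<beta> \<and>
            weak_conv_m
              (\<lambda>n. distr (M n) borel
                 (\<lambda>\<omega>. real n * T n \<omega> + 4 * ln (real (p n)) - ln (ln (real (p n))))) N)"
proof -
  define l where "l n = ln (real (p n))" for n
  define P where "P n t = measure (M n) {\<omega> \<in> space (M n). t \<le> L n \<omega>}" for n t
  define c where "c = sqrt (1 - exp (- 4 * \<beta>))"
  have l: "(\<lambda>n. l n / real n) \<longlonglongrightarrow> \<beta>" using beta by (simp add: l_def)
  note l_top = exponent_tendsto_at_top[OF beta(1) l]
  have p_top: "filterlim (\<lambda>n. real (p n)) at_top sequentially"
  proof -
    have "filterlim (\<lambda>n. exp (l n)) at_top sequentially"
      by (rule filterlim_compose[OF exp_at_top l_top])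
    moreover have "\<forall>\<^sub>F n in sequentially. exp (l n) = real (p n)"
      using eventually_compose_filterlim[OF eventually_gt_at_top[of 0] l_top]
    proof eventually_elim
      case (elim n)
      then have "p n \<noteq> 0" by (cases "p n = 0") (simp_all add: l_def)
      then show ?case by (simp add: l_def)
    qed
    ultimately show ?thesis by (rule filterlim_cong[THEN iffD1, OF refl refl, rotated])
  qed
  have p_top': "filterlim p at_top sequentially"
    using p_top by (simp add: filterlim_sequentially_iff_filterlim_real)
  have large: "\<forall>\<^sub>F n in sequentially. 3 \<le> n \<and> 2 \<le> p n"
    using eventually_ge_at_top[of 3] eventually_compose_filterlim[OF eventually_ge_at_top[of 2] p_top']
    by eventually_elim simp
  have L_meas: "L n \<in> borel_measurable (M n)" if "3 \<le> n" "2 \<le> p n" for n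
    unfolding L_def by (rule max_corr_measurable) (use that spherical in \<open>auto simp: spherical_def\<close>)
  have L_nonneg: "0 \<le> L n \<omega>" if "2 \<le> p n" for n \<omega>
    unfolding L_def by (rule max_corr_nonneg[OF that])
  have exceed: "(\<lambda>n. P n (threshold n (l n) y)) \<longlonglongrightarrow> limit_cdf \<beta> y" for y
  proof -
    let ?D = "\<lambda>n. distr (M n) (Rn n) (X n 0)"
    let ?t = "\<lambda>n. threshold n (l n) y"
    let ?R = "\<lambda>n x y. ?t n \<le> \<bar>pearson n x y\<bar>"
    let ?q = "\<lambda>n. measure (gauss n) (cap n (?t n))"
    have ev: "\<forall>\<^sub>F n in sequentially. homogeneous_relation (?D n) (?R n) (?q n) \<and>
        P n (?t n) = 1 - homogeneous_relation.avoidance (?D n) (?R n) (p n)"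
      using large log_level_neg[OF beta(1) l, of y]
    proof eventually_elim
      case (elim n)
      then have n: "3 \<le> n" "2 \<le> n" "2 \<le> p n" "0 < p n" by auto
      have t: "0 < ?t n" by (rule threshold_bounds(1)) (rule elim)
      note E = prob_max_corr_ge[OF prob[OF n(2)] n(1,3) t indep[OF n(2)] common[OF n(2)] spherical[OF n(2)] nonzero[OF n(2,4)]]
      show ?case
        unfolding P_def L_def by (intro conjI E) auto
    qed
    have "(\<lambda>n. homogeneous_relation.avoidance (?D n) (?R n) (p n)) \<longlonglongrightarrow> exp (- (K \<beta> * exp ((y + 8 * \<beta>) / 2)))"
    proof (rule avoidance_tendsto)
      show "\<forall>\<^sub>F n in sequentially. homogeneous_relation (?D n) (?R n) (?q n)"
        using ev by eventually_elim simp
      show "(\<lambda>n. (real (p n))\<^sup>2 * ?q n / 2) \<longlonglongrightarrow> K \<beta> * exp ((y + 8 * \<beta>) / 2)"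
        unfolding l_def by (rule expected_exceedances_tendsto[OF beta])
    qed (rule p_top')
    then have "(\<lambda>n. 1 - homogeneous_relation.avoidance (?D n) (?R n) (p n)) \<longlonglongrightarrow> limit_cdf \<beta> y"
      unfolding limit_cdf_def by (intro tendsto_intros)
    moreover have "\<forall>\<^sub>F n in sequentially. 1 - homogeneous_relation.avoidance (?D n) (?R n) (p n) = P n (?t n)"
      using ev by eventually_elim simp
    ultimately show ?thesis by (rule Lim_transform_eventually)
  qed
  have thr: "(\<lambda>n. threshold n (l n) y) \<longlonglongrightarrow> c" for y
    unfolding c_def by (rule threshold_tendsto[OF beta(1) l])
  have low: "\<exists>y. limit_cdf \<beta> y < e" if "e > 0" for e
    by (rule eventually_happens'[OF trivial_limit_at_bot_linorder order_tendstoD(2)[OF limit_cdf_at_bot that]])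
  have high: "\<exists>y. 1 - limit_cdf \<beta> y < e" if "e > 0" for e
  proof -
    have "1 - e < 1" using that by simp
    from eventually_happens'[OF trivial_limit_at_top_linorder order_tendstoD(1)[OF limit_cdf_at_top[OF beta(1)] this]]
    obtain y where "1 - e < limit_cdf \<beta> y" ..
    then show ?thesis by (intro exI[of _ y]) simp
  qed
  \<comment> \<open>all thresholds converge to \<open>c\<close>: a low \<open>y\<close> controls values above \<open>c\<close>, a high \<open>z\<close> those below\<close>
  have in_prob: "tendsto_in_prob M L c"
    unfolding tendsto_in_prob_def
  proof (intro allI impI)
    fix \<epsilon> :: real assume \<epsilon>: "\<epsilon> > 0"
    let ?E = "\<lambda>n. {\<omega> \<in> space (M n). \<bar>L n \<omega> - c\<bar> > \<epsilon>}"
    show "(\<lambda>n. measure (M n) (?E n)) \<longlonglongrightarrow> 0"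
    proof (rule order_tendstoI)
      fix e :: real assume "0 < e"
      obtain y z where y: "limit_cdf \<beta> y < e / 2" and z: "1 - limit_cdf \<beta> z < e / 2"
        using low[of "e / 2"] high[of "e / 2"] \<open>0 < e\<close> by auto
      have "\<forall>\<^sub>F n in sequentially. P n (threshold n (l n) y) < e / 2"
        by (rule order_tendstoD(2)[OF exceed y])
      moreover have "\<forall>\<^sub>F n in sequentially. 1 - P n (threshold n (l n) z) < e / 2"
        by (rule order_tendstoD(2)[OF tendsto_diff[OF tendsto_const exceed] z])
      moreover have "\<forall>\<^sub>F n in sequentially. threshold n (l n) y < c + \<epsilon>"
        by (rule order_tendstoD(2)[OF thr]) (use \<epsilon> in simp)
      moreover have "\<forall>\<^sub>F n in sequentially. c - \<epsilon> < threshold n (l n) z"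
        by (rule order_tendstoD(1)[OF thr]) (use \<epsilon> in simp)
      ultimately show "\<forall>\<^sub>F n in sequentially. measure (M n) (?E n) < e"
        using large
      proof eventually_elim
        case (elim n)
        then have n: "3 \<le> n" "2 \<le> p n" by auto
        interpret prob_space "M n" by (rule prob) (use n in simp)
        note [measurable] = L_meas[OF n]
        let ?A = "{\<omega> \<in> space (M n). threshold n (l n) y \<le> L n \<omega>}"
        let ?B = "{\<omega> \<in> space (M n). threshold n (l n) z \<le> L n \<omega>}"
        have "measure (M n) (?E n) \<le> measure (M n) (?A \<union> (space (M n) - ?B))"
        proof (rule finite_measure_mono)
          show "?E n \<subseteq> ?A \<union> (space (M n) - ?B)"
          proof
            fix \<omega> assume "\<omega> \<in> ?E n"
            moreover from this have "threshold n (l n) y \<le> L n \<omega> \<or> \<not> threshold n (l n) z \<le> L n \<omega>"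
              using elim(3,4) by auto
            ultimately show "\<omega> \<in> ?A \<union> (space (M n) - ?B)" by blast
          qed
        qed measurable
        also have "\<dots> \<le> measure (M n) ?A + measure (M n) (space (M n) - ?B)"
          by (rule measure_Un_le) measurable
        also have "measure (M n) (space (M n) - ?B) = 1 - measure (M n) ?B"
          by (rule prob_compl) measurable
        finally show ?case using elim(1,2) unfolding P_def by linarith
      qed
    next
      fix e :: real assume "e < 0"
      then show "\<forall>\<^sub>F n in sequentially. e < measure (M n) (?E n)"
        by (intro always_eventually allI less_le_trans[OF _ measure_nonneg])
    qed
  qed
  \<comment> \<open>values \<open>L \<ge> 1\<close>, for which \<open>T\<close> is degenerate, lie above every threshold\<close>
  have one: "(\<lambda>n. P n 1) \<longlonglongrightarrow> 0"
  proof (rule order_tendstoI)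
    fix e :: real assume "0 < e"
    then obtain y where y: "limit_cdf \<beta> y < e" using low by blast
    show "\<forall>\<^sub>F n in sequentially. P n 1 < e"
      using order_tendstoD(2)[OF exceed y] large log_level_neg[OF beta(1) l, of y]
    proof eventually_elim
      case (elim n)
      then have n: "3 \<le> n" "2 \<le> p n" by auto
      interpret prob_space "M n" by (rule prob) (use n in simp)
      note [measurable] = L_meas[OF n]
      have "P n 1 \<le> P n (threshold n (l n) y)"
        unfolding P_def
      proof (rule finite_measure_mono)
        show "{\<omega> \<in> space (M n). 1 \<le> L n \<omega>} \<subseteq> {\<omega> \<in> space (M n). threshold n (l n) y \<le> L n \<omega>}"
          using threshold_bounds(2)[of n "l n" y] elim by auto
      qed measurable
      then show ?case using elim by simp
    qed
  next
    fix e :: real assume "e < 0"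
    then show "\<forall>\<^sub>F n in sequentially. e < P n 1"
      unfolding P_def by (intro always_eventually allI less_le_trans[OF _ measure_nonneg])
  qed
  let ?Z = "\<lambda>n \<omega>. real n * T n \<omega> + 4 * ln (real (p n)) - ln (ln (real (p n)))"
  have cdf: "(\<lambda>n. cdf (distr (M n) borel (?Z n)) y) \<longlonglongrightarrow> limit_cdf \<beta> y" for y
  proof (rule Lim_transform2[OF exceed])
    show "(\<lambda>n. P n (threshold n (l n) y) - cdf (distr (M n) borel (?Z n)) y) \<longlonglongrightarrow> 0"
    proof (rule Lim_null_comparison[OF _ one])
      show "\<forall>\<^sub>F n in sequentially. norm (P n (threshold n (l n) y) - cdf (distr (M n) borel (?Z n)) y) \<le> P n 1"
        using large
      proof eventually_elim
        case (elim n)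
        then have n: "3 \<le> n" "2 \<le> p n" by auto
        interpret prob_space "M n" by (rule prob) (use n in simp)
        note [measurable] = L_meas[OF n]
        have Z [measurable]: "?Z n \<in> borel_measurable (M n)"
          unfolding T_def by measurable
        let ?A = "{\<omega> \<in> space (M n). threshold n (l n) y \<le> L n \<omega>}"
        let ?B = "{\<omega> \<in> space (M n). ?Z n \<omega> \<le> y}"
        let ?C = "{\<omega> \<in> space (M n). 1 \<le> L n \<omega>}"
        have "cdf (distr (M n) borel (?Z n)) y = measure (M n) (?Z n -` {..y} \<inter> space (M n))"
          unfolding cdf_def by (rule measure_distr) (use Z in auto)
        also have "?Z n -` {..y} \<inter> space (M n) = ?B" by auto
        finally have B: "cdf (distr (M n) borel (?Z n)) y = measure (M n) ?B" .
        have same: "?Z n \<omega> \<le> y \<longleftrightarrow> threshold n (l n) y \<le> L n \<omega>" if "L n \<omega> < 1" for \<omega>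
          using normalized_le_iff[of n "L n \<omega>" "l n" y] n L_nonneg[OF n(2)] that by (simp add: T_def l_def)
        have same': "?Z n \<omega> \<le> y \<or> 1 \<le> L n \<omega> \<longleftrightarrow> threshold n (l n) y \<le> L n \<omega> \<or> 1 \<le> L n \<omega>" for \<omega>
          using same[of \<omega>] by (cases "L n \<omega> < 1") simp_all
        have sub: "?A \<subseteq> ?B \<union> ?C" "?B \<subseteq> ?A \<union> ?C"
          using same' by blast+
        have sets: "?A \<in> sets (M n)" "?B \<in> sets (M n)" "?C \<in> sets (M n)"
          by measurable
        have "measure (M n) ?A \<le> measure (M n) (?B \<union> ?C)"
          by (rule finite_measure_mono[OF sub(1)]) (intro sets.Un sets)
        also have "\<dots> \<le> measure (M n) ?B + measure (M n) ?C"
          by (rule measure_Un_le) (rule sets)+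
        finally have 1: "measure (M n) ?A \<le> measure (M n) ?B + measure (M n) ?C" .
        have "measure (M n) ?B \<le> measure (M n) (?A \<union> ?C)"
          by (rule finite_measure_mono[OF sub(2)]) (intro sets.Un sets)
        also have "\<dots> \<le> measure (M n) ?A + measure (M n) ?C"
          by (rule measure_Un_le) (rule sets)+
        finally have 2: "measure (M n) ?B \<le> measure (M n) ?A + measure (M n) ?C" .
        show ?case using 1 2 unfolding B P_def real_norm_def by linarith
      qed
    qed
  qed
  have "weak_conv_m (\<lambda>n. distr (M n) borel (?Z n)) (interval_measure (limit_cdf \<beta>))"
    unfolding weak_conv_m_def weak_conv_def limit_cdf_real_distribution(2)[OF beta(1)]
    by (intro allI impI cdf)
  with limit_cdf_real_distribution[OF beta(1)]
  have "\<exists>N. real_distribution N \<and> cdf N = limit_cdf \<beta> \<and> weak_conv_m (\<lambda>n. distr (M n) borel (?Z n)) N"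
    by (intro exI[of _ "interval_measure (limit_cdf \<beta>)"] conjI)
  with in_prob show ?thesis
    unfolding c_def by (rule conjI)
qed

end
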